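(* Let $T\in(0,\infty]$. The following hold. 1. For any constant $C\in\mathbb{R}$ and $0<\gamma<1$, $D_c^\gamma C=0$. 2. For $0<\gamma<1$, $D_c^\gamma:X\to\mathscr E$ is a linear operator. 3. For all $\varphi\in X$, $0<\gamma_1<1$ and $\gamma_2>\gamma_1-1$, $$J_{\gamma_2}D_c^{\gamma_1}\varphi=\begin{cases}D_c^{\gamma_1-\gamma_2}\varphi,&\gamma_2<\gamma_1,\\ J_{\gamma_2-\gamma_1}(\varphi-\varphi(0+)),&\gamma_2\ge\gamma_1.\end{cases}$$ 4. Suppose $0<\gamma_1<1$. If $f\in Y_{\gamma_1}$, then $D_c^{\gamma_2}J_{\gamma_1}f=J_{\gamma_1-\gamma_2}f$ for $0<\gamma_2<1$. 5. Let $\varphi\in X$ and $0<\gamma_1<1$. If $D_c^{\gamma_1}\varphi\in X$, then for $0<\gamma_2<1$ with $0<\gamma_1+\gamma_2<1$, $$D_c^{\gamma_2}D_c^{\gamma_1}\varphi=D_c^{\gamma_1+\gamma_2}\varphi-\big(D_c^{\gamma_1}\varphi\big)(0+)\,g_{1-\gamma_2}.$$ 6. For $\varphi\in X$ and $0<\gamma<1$, $J_{\gamma-1}D_c^\gamma\varphi=J_{-1}\varphi-\varphi(0+)\delta(t)$. If this distribution is denoted $D_c^1\varphi$, then $D_c^1\varphi=\varphi'$ for $\varphi\in C^1[0,T)$.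
   Context: $L^1_{\mathrm{loc}}[0,T)$ is the set of functions integrable on every compact subset of $[0,T)$; such functions are identified with distributions in $\mathscr D'(-\infty,T)$ by extension by zero to $t<0$ (so e.g. in item 6 $\varphi'$ means $\theta\varphi'$). $\mathscr E$ is the set of distributions in $\mathscr D'(-\infty,T)$ whose support is contained in $[M,T)$ for some $M<T$. $\theta$ is the Heaviside function, $D$ the distributional derivative; $g_\alpha(t)=\theta(t)t^{\alpha-1}/\Gamma(\alpha)$ for $\alpha>0$, $g_0=\delta$, $g_{-1}=D\delta$, $g_{-\beta}=\frac{1}{\Gamma(1-\beta)}D(\theta(t)t^{-\beta})$ for $0<\beta<1$. For $v\in\mathscr E$, $g_\alpha*v\in\mathscr E$ is defined as follows: for every $R<T$, its restriction to $(-\infty,R)$ equals that of the convolution on $\mathbb{R}$ of $g_\alpha$ with $\chi v$ (extended by zero), where $\chi\in C_c^\infty(-\infty,T)$ equals $1$ in a neighborhood of $\operatorname{supp}v\cap(-\infty,R]$. For $\varphi\in L^1_{\mathrm{loc}}[0,T)$, $J_\alpha\varphi:=g_\alpha*(\theta\varphi)$; for a distribution $f$ supported in $[0,T)$, $J_\alpha f:=g_\alpha*f$. $X$ is the set of $\varphi\in L^1_{\mathrm{loc}}[0,T)$ for which there is a (unique) $\varphi_0\in\mathbb{R}$ with $\lim_{t\to0^+}\frac1t\int_0^t|\varphi-\varphi_0|\,ds=0$; one writes $\varphi(0+):=\varphi_0$. For $\varphi\in X$ and $0<\gamma<1$ the Caputo derivative is the distribution $D_c^\gamma\varphi:=J_{-\gamma}\varphi-\varphi(0+)g_{1-\gamma}=J_{-\gamma}(\varphi-\varphi(0+))$.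 For $0<\gamma<1$, $Y_\gamma:=\{f\in L^1_{\mathrm{loc}}[0,T):\lim_{\tau\to0^+}\frac1\tau\int_0^\tau|\int_0^t(t-s)^{\gamma-1}f(s)\,ds|\,dt=0\}$. *)

theory Defs
  imports "HOL-Analysis.Analysis"
begin

section \<open>Real distributions on open subsets of the line\<close>

definition smooth :: "(real \<Rightarrow> real) \<Rightarrow> bool" where
  "smooth p \<longleftrightarrow> (\<forall>n x. (deriv ^^ n) p differentiable (at x))"

definition fun_support :: "(real \<Rightarrow> real) \<Rightarrow> real set" where
  "fun_support p = closure {x. p x \<noteq> 0}"

text \<open>Elements of \<open>C\<^sub>c\<^sup>\<infinity>(S)\<close> are represented by their extension by zero to the whole line.\<close>

definition test_functions :: "real set \<Rightarrow> (real \<Rightarrow> real) set" where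
  "test_functions S = {p. smooth p \<and> compact (fun_support p) \<and> fun_support p \<subseteq> S}"

type_synonym functional = "(real \<Rightarrow> real) \<Rightarrow> real"

text \<open>The value outside the test functions on \<open>S\<close> is fixed to be 0, so that equality in
  \<open>\<D>'(S)\<close> is HOL equality. Sums and multiples of distributions are formed pointwise.\<close>

definition distributions :: "real set \<Rightarrow> functional set" where
  "distributions S = {u.
     (\<forall>p. p \<notin> test_functions S \<longrightarrow> u p = 0) \<and>
     (\<forall>p\<in>test_functions S. \<forall>q\<in>test_functions S. \<forall>a b.
        u (\<lambda>x. a * p x + b * q x) = a * u p + b * u q) \<and>
     (\<forall>K. compact K \<and> K \<subseteq> S \<longrightarrow>
        (\<exists>C N. \<forall>p\<in>test_functions S. fun_support p \<subseteq> K \<longrightarrow>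
           \<bar>u p\<bar> \<le> C * (\<Sum>k\<le>N. SUP x. \<bar>(deriv ^^ k) p x\<bar>)))}"

definition restrict_dist :: "real set \<Rightarrow> functional \<Rightarrow> functional" where
  "restrict_dist S u = (\<lambda>p. if p \<in> test_functions S then u p else 0)"

definition fun_dist :: "real set \<Rightarrow> (real \<Rightarrow> real) \<Rightarrow> functional" where
  "fun_dist S f = restrict_dist S (\<lambda>p. LINT t|lebesgue. f t * p t)"

definition dist_deriv :: "real set \<Rightarrow> functional \<Rightarrow> functional" where
  "dist_deriv S u = restrict_dist S (\<lambda>p. - u (deriv p))"

definition dirac :: functional where
  "dirac = restrict_dist UNIV (\<lambda>p. p 0)"

definition dist_support :: "real set \<Rightarrow> functional \<Rightarrow> real set" where
  "dist_support S u =
     S - \<Union>{U. open U \<and> U \<subseteq> S \<and> (\<forall>p\<in>test_functions U. u p = 0)}"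

text \<open>The product \<open>\<eta>v\<close>, extended by zero to the line, for \<open>v\<close> a distribution on an open set
  containing the support of the test function \<open>\<eta>\<close>.\<close>

definition cutoff_dist :: "(real \<Rightarrow> real) \<Rightarrow> functional \<Rightarrow> functional" where
  "cutoff_dist \<eta> v = restrict_dist UNIV (\<lambda>p. v (\<lambda>x. \<eta> x * p x))"

text \<open>Convolution on the line of a distribution \<open>u\<close> with a compactly supported distribution \<open>w\<close>;
  compactness of the support of \<open>w\<close> makes the argument of \<open>u\<close> a test function.\<close>

definition convolution_dist :: "functional \<Rightarrow> functional \<Rightarrow> functional" where
  "convolution_dist u w = restrict_dist UNIV (\<lambda>p. u (\<lambda>x. w (\<lambda>y. p (x + y))))"


section \<open>The half-line \<open>(-\<infinity>,T)\<close> and the fractional kernels\<close>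

definition below :: "ereal \<Rightarrow> real set" where
  "below T = {x. ereal x < T}"

definition heaviside :: "real \<Rightarrow> real" where
  "heaviside t = (if t \<ge> 0 then 1 else 0)"

definition E_space :: "ereal \<Rightarrow> functional set" where
  "E_space T = {u \<in> distributions (below T).
     \<exists>M::real. ereal M < T \<and> dist_support (below T) u \<subseteq> {M..}}"

text \<open>The distribution \<open>g\<^sub>\<alpha>\<close> on the line; only \<open>\<alpha> \<ge> -1\<close> is meaningful. In the last case
  \<open>\<alpha> = -\<beta>\<close> with \<open>0 < \<beta> < 1\<close>.\<close>

definition frac_kernel :: "real \<Rightarrow> functional" where
  "frac_kernel \<alpha> =
    (if \<alpha> > 0 then fun_dist UNIV (\<lambda>t. heaviside t * t powr (\<alpha> - 1) / Gamma \<alpha>)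
     else if \<alpha> = 0 then dirac
     else if \<alpha> = -1 then dist_deriv UNIV dirac
     else (\<lambda>p. 1 / Gamma (1 + \<alpha>) *
             dist_deriv UNIV (fun_dist UNIV (\<lambda>t. heaviside t * t powr \<alpha>)) p))"

text \<open>\<open>frac_J T \<alpha> v\<close> is \<open>g\<^sub>\<alpha> * v\<close> for \<open>v\<close> in \<open>E_space T\<close>: the distribution on \<open>(-\<infinity>,T)\<close> determined by its
  restrictions to \<open>(-\<infinity>,R)\<close>, \<open>R < T\<close>.\<close>

definition frac_J :: "ereal \<Rightarrow> real \<Rightarrow> functional \<Rightarrow> functional" where
  "frac_J T \<alpha> v = (THE w. w \<in> E_space T \<and>
     (\<forall>R::real. \<forall>\<eta>\<in>test_functions (below T).
        ereal R < T \<longrightarrow>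
        (\<exists>U. open U \<and> dist_support (below T) v \<inter> {..R} \<subseteq> U \<and> (\<forall>x\<in>U. \<eta> x = 1)) \<longrightarrow>
        restrict_dist {..<R} w =
        restrict_dist {..<R} (convolution_dist (frac_kernel \<alpha>) (cutoff_dist \<eta> v))))"


section \<open>Function spaces on \<open>[0,T)\<close> and the Caputo derivative\<close>

definition L1loc :: "ereal \<Rightarrow> (real \<Rightarrow> real) set" where
  "L1loc T = {f. \<forall>K. compact K \<and> K \<subseteq> {0..} \<inter> below T \<longrightarrow> f absolutely_integrable_on K}"

text \<open>The identification of a function on \<open>[0,T)\<close> with a distribution on \<open>(-\<infinity>,T)\<close>, by extension
  by zero. The values of \<open>f\<close> outside \<open>[0,T)\<close> are irrelevant.\<close>

definition emb :: "ereal \<Rightarrow> (real \<Rightarrow> real) \<Rightarrow> functional" where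
  "emb T f = fun_dist (below T) (\<lambda>t. heaviside t * f t)"

definition has_initial_value :: "(real \<Rightarrow> real) \<Rightarrow> real \<Rightarrow> bool" where
  "has_initial_value f c \<longleftrightarrow>
     ((\<lambda>t. 1 / t * (LINT s:{0..t}|lebesgue. \<bar>f s - c\<bar>)) \<longlongrightarrow> 0) (at_right 0)"

definition X_space :: "ereal \<Rightarrow> (real \<Rightarrow> real) set" where
  "X_space T = {f \<in> L1loc T. \<exists>c. has_initial_value f c}"

text \<open>The value \<open>u(0+)\<close> of a distribution identified with an element of \<open>X_space T\<close>; it does not depend
  on the representing function, since representatives agree almost everywhere on \<open>[0,T)\<close>.\<close>

definition initial_value :: "ereal \<Rightarrow> functional \<Rightarrow> real" where
  "initial_value T u = (THE c. \<exists>f\<in>X_space T. u = emb T f \<and> has_initial_value f c)"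

definition caputo :: "ereal \<Rightarrow> real \<Rightarrow> functional \<Rightarrow> functional" where
  "caputo T \<gamma> u =
     (\<lambda>p. frac_J T (-\<gamma>) u p - initial_value T u * restrict_dist (below T) (frac_kernel (1 - \<gamma>)) p)"

definition caputo_one :: "ereal \<Rightarrow> functional \<Rightarrow> functional" where
  "caputo_one T u =
     (\<lambda>p. frac_J T (-1) u p - initial_value T u * restrict_dist (below T) dirac p)"

definition Y_space :: "ereal \<Rightarrow> real \<Rightarrow> (real \<Rightarrow> real) set" where
  "Y_space T \<gamma> = {f \<in> L1loc T.
     ((\<lambda>\<tau>. 1 / \<tau> * (LINT t:{0..\<tau>}|lebesgue.
              \<bar>LINT s:{0..t}|lebesgue. (t - s) powr (\<gamma> - 1) * f s\<bar>)) \<longlongrightarrow> 0) (at_right 0)}"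

end

theory Submission
  imports Defs
begin

text \<open>Every distribution to which some \<open>J\<^sub>\<alpha>\<close> is applied is \<open>F\<close> or \<open>D F\<close> for a locally integrable
  function \<open>F\<close> vanishing on the negative axis. As \<open>g\<^sub>\<alpha> = D g\<^sub>1\<^sub>+\<^sub>\<alpha>\<close>, Fubini's theorem gives
  \<open>J\<^sub>\<alpha> (D\<^sup>j F) = D\<^sup>j\<^sup>+\<^sup>1 (g\<^sub>1\<^sub>+\<^sub>\<alpha> * F)\<close> with an ordinary convolution of functions on the right. In
  particular \<open>D\<^sub>c\<^sup>\<gamma> \<phi> = D (g\<^sub>1\<^sub>-\<^sub>\<gamma> * (\<phi> - \<phi>(0+)))\<close>, and the composition rules follow from
  \<open>g\<^sub>a * g\<^sub>b = g\<^sub>a\<^sub>+\<^sub>b\<close>, the Beta integral, and \<open>D (g\<^sub>1 * F) = F\<close>. The value \<open>\<phi>(0+)\<close> is determined by the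
  distribution because testing against smooth approximations of the indicator of \<open>[0,t]\<close> recovers
  the averages of \<open>\<phi>\<close>.\<close>


section \<open>Smooth functions\<close>

text \<open>Two obstacles shape the proof. \<open>frac_J\<close> is a definite description over all
  cutoffs that equal 1 merely near the support of \<open>v\<close>. For \<open>v = D F\<close> this
  support can miss large parts of the set where \<open>F\<close> is nonzero: it is {0} if
  \<open>F\<close> is the Heaviside function. So a cutoff cannot simply be dropped from an integral
  against \<open>F\<close>; it has to be exchanged, without changing the value of \<open>v\<close>,
  for one that equals 1 near [0,R]. This is what requires the vanishing of a distribution off its
  support, and with it a smooth partition. They are obtained after pairing with a probe, where
  Fubini's theorem turns convolution with \<open>g\<close> into correlation of the probe with
  \<open>g\<close>; the result is a probe again, so the step can be repeated.\<close>

lemma smooth_imp_DERIV: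
  assumes "smooth f" shows "(f has_real_derivative deriv f x) (at x)"
proof -
  have "(deriv ^^ 0) f differentiable (at x)"
    using assms unfolding smooth_def by blast
  then show ?thesis
    by (simp add: DERIV_deriv_iff_real_differentiable)
qed

lemma smooth_deriv: "smooth f \<Longrightarrow> smooth (deriv f)"
  unfolding smooth_def by (metis comp_apply funpow_Suc_right)

lemma smooth_deriv_power: "smooth f \<Longrightarrow> smooth ((deriv ^^ n) f)"
  by (induction n) (auto intro: smooth_deriv)

text \<open>All iterated derivatives stay in \<open>S\<close> by induction, so smoothness is proved
  without a formula for the n-th derivative. Used for affine functions,
  \<open>smooth_closure\<close>, antiderivatives, \<open>flat_fun\<close> and integrals with a
  parameter.\<close>

lemma smooth_coinduct:
  assumes "f \<in> S" and step: "\<And>f. f \<in> S \<Longrightarrow> \<exists>f'\<in>S. \<forall>x. (f has_real_derivative f' x) (at x)"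
  shows "smooth f"
proof -
  have D: "deriv g \<in> S \<and> (\<forall>x. g differentiable (at x))" if g: "g \<in> S" for g
  proof -
    obtain g' where g': "g' \<in> S" "\<And>x. (g has_real_derivative g' x) (at x)"
      using step[OF g] by blast
    then have "deriv g = g'"
      by (auto intro: DERIV_imp_deriv)
    with g' show ?thesis
      by (auto intro: differentiableI simp: real_differentiable_def)
  qed
  have "(deriv ^^ n) f \<in> S" for n
    by (induction n) (use assms(1) D in auto)
  with D show ?thesis
    unfolding smooth_def by blast
qed

lemma smooth_affine: "smooth (\<lambda>x. a + b * x)"
proof (rule smooth_coinduct[of _ "{f. \<exists>a b. f = (\<lambda>x. a + b * x)}"])
  fix f :: "real \<Rightarrow> real" assume "f \<in> {f. \<exists>a b. f = (\<lambda>x. a + b * x)}"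
  then obtain a b where f: "f = (\<lambda>x. a + b * x)" by blast
  have "(f has_real_derivative b + 0 * x) (at x)" for x
    unfolding f by (auto intro!: derivative_eq_intros)
  moreover have "(\<lambda>x. b + 0 * x) \<in> {f. \<exists>a b. f = (\<lambda>x. a + b * x)}" by blast
  ultimately show "\<exists>f'\<in>{f. \<exists>a b. f = (\<lambda>x. a + b * x)}. \<forall>x. (f has_real_derivative f' x) (at x)"
    by (intro bexI[of _ "\<lambda>x. b + 0 * x"] allI)
qed blast

lemma smooth_const: "smooth (\<lambda>x. c)"
  using smooth_affine[of c 0] by simp

text \<open>The derivative of a product is a sum of products, so closure under both operations is
  needed before \<open>smooth_coinduct\<close> applies. Affine substitution is built into
  \<open>base\<close> because its chain rule contributes only a constant factor, which is again a
  \<open>base\<close> element.\<close>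

inductive_set smooth_closure :: "(real \<Rightarrow> real) set" where
  base: "smooth f \<Longrightarrow> (\<lambda>x. f (a + b * x)) \<in> smooth_closure"
| add: "f \<in> smooth_closure \<Longrightarrow> g \<in> smooth_closure \<Longrightarrow> (\<lambda>x. f x + g x) \<in> smooth_closure"
| mult: "f \<in> smooth_closure \<Longrightarrow> g \<in> smooth_closure \<Longrightarrow> (\<lambda>x. f x * g x) \<in> smooth_closure"

lemma smooth_closure_smooth:
  assumes "f \<in> smooth_closure" shows "smooth f"
proof (rule smooth_coinduct[OF assms])
  fix f assume "f \<in> smooth_closure"
  then show "\<exists>f'\<in>smooth_closure. \<forall>x. (f has_real_derivative f' x) (at x)"
  proof induction
    case (base f a b)
    have "(\<lambda>x. deriv f (a + b * x) * (\<lambda>x. b) (a + b * x)) \<in> smooth_closure"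
      by (intro smooth_closure.mult smooth_closure.base[where f = "deriv f"]
          smooth_closure.base[where f = "\<lambda>x. b"] smooth_const smooth_deriv base)
    moreover have "((\<lambda>x. f (a + b * x)) has_real_derivative deriv f (a + b * x) * b) (at x)" for x
      by (rule DERIV_chain2[where f = f, OF smooth_imp_DERIV[OF base]])
        (auto intro!: derivative_eq_intros)
    ultimately show ?case
      by (intro bexI[of _ "\<lambda>x. deriv f (a + b * x) * b"] allI)
  next
    case (add f g)
    then obtain f' g' where *: "f' \<in> smooth_closure" "g' \<in> smooth_closure"
      "\<And>x. (f has_real_derivative f' x) (at x)" "\<And>x. (g has_real_derivative g' x) (at x)"
      by blast
    then show ?case
      by (intro bexI[of _ "\<lambda>x. f' x + g' x"] allI DERIV_add smooth_closure.add)
  next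
    case (mult f g)
    then obtain f' g' where *: "f' \<in> smooth_closure" "g' \<in> smooth_closure"
      "\<And>x. (f has_real_derivative f' x) (at x)" "\<And>x. (g has_real_derivative g' x) (at x)"
      by blast
    have "(\<lambda>x. f' x * g x + g' x * f x) \<in> smooth_closure"
      using * mult by (intro smooth_closure.add smooth_closure.mult)
    moreover have "((\<lambda>x. f x * g x) has_real_derivative f' x * g x + g' x * f x) (at x)" for x
      using * by (intro DERIV_mult)
    ultimately show ?case
      by (intro bexI[of _ "\<lambda>x. f' x * g x + g' x * f x"] allI)
  qed
qed

lemma smooth_in_closure: "smooth f \<Longrightarrow> f \<in> smooth_closure"
  using smooth_closure.base[of f 0 1] by simp

lemma smooth_add: "smooth f \<Longrightarrow> smooth g \<Longrightarrow> smooth (\<lambda>x. f x + g x)"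
  by (rule smooth_closure_smooth, rule smooth_closure.add; rule smooth_in_closure)

lemma smooth_mult: "smooth f \<Longrightarrow> smooth g \<Longrightarrow> smooth (\<lambda>x. f x * g x)"
  by (rule smooth_closure_smooth, rule smooth_closure.mult; rule smooth_in_closure)

lemma smooth_compose_affine: "smooth f \<Longrightarrow> smooth (\<lambda>x. f (a + b * x))"
  by (rule smooth_closure_smooth, rule smooth_closure.base)

lemma smooth_antiderivative:
  assumes "smooth f" "\<And>x. (F has_real_derivative f x) (at x)" shows "smooth F"
proof (rule smooth_coinduct[of _ "insert F (Collect smooth)"])
  fix g assume "g \<in> insert F (Collect smooth)"
  then show "\<exists>f'\<in>insert F (Collect smooth). \<forall>x. (g has_real_derivative f' x) (at x)"
  proof
    assume "g = F"
    with assms show ?thesis by (intro bexI[of _ f]) auto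
  next
    assume "g \<in> Collect smooth"
    then show ?thesis
      using smooth_deriv smooth_imp_DERIV by (intro bexI[of _ "deriv g"]) auto
  qed
qed simp

lemma smooth_continuous_on: "smooth f \<Longrightarrow> continuous_on S f"
  by (intro continuous_at_imp_continuous_on ballI DERIV_isCont[OF smooth_imp_DERIV])

section \<open>Construction of a smooth step function\<close>

lemma poly_times_exp_tendsto_0: "((\<lambda>y::real. poly P y * exp (- y)) \<longlongrightarrow> 0) at_top"
proof -
  have "((\<lambda>y. \<Sum>i\<le>degree P. coeff P i * (y ^ i / exp y)) \<longlongrightarrow> (\<Sum>i\<le>degree P. coeff P i * 0)) at_top"
    by (intro tendsto_intros tendsto_power_div_exp_0)
  then show ?thesis
    by (simp add: poly_altdef exp_minus divide_inverse sum_distrib_right mult.assoc)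
qed

text \<open>With \<open>P = 1\<close> this is the classical flat function exp(-1/x). The factor
  P(1/x) makes the family closed under differentiation: with y = 1/x, the derivative has y^2 (P -
  P') in place of P.\<close>

definition flat_fun :: "real poly \<Rightarrow> real \<Rightarrow> real" where
  "flat_fun P x = (if x > 0 then poly P (1 / x) * exp (- (1 / x)) else 0)"

lemma flat_fun_DERIV:
  "(flat_fun P has_real_derivative flat_fun ([:0, 0, 1:] * (P - pderiv P)) x) (at x)"
proof -
  consider "x < 0" | "x = 0" | "x > 0" by linarith
  then show ?thesis
  proof cases
    case 1
    have "((\<lambda>x. 0) has_real_derivative 0) (at x)" by simp
    then have "(flat_fun P has_real_derivative 0) (at x)"
      by (rule has_field_derivative_transform_within_open[of _ _ _ "{..<0}"])
        (use 1 in \<open>auto simp: flat_fun_def\<close>)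
    with 1 show ?thesis by (simp add: flat_fun_def)
  next
    case 2
    have "((\<lambda>h. (flat_fun P (0 + h) - flat_fun P 0) / h) \<longlongrightarrow> 0) (at 0)"
    proof (rule filterlim_split_at)
      show "((\<lambda>h. (flat_fun P (0 + h) - flat_fun P 0) / h) \<longlongrightarrow> 0) (at_left 0)"
        by (rule tendsto_eventually)
          (auto simp: flat_fun_def eventually_at_left_field intro!: exI[of _ "-1"])
      \<comment> \<open>With y = 1/h the difference quotient at 0 is y P(y) exp(-y), and
        \<open>pCons 0 P\<close> is the polynomial y P(y).\<close>
      have "((\<lambda>h. poly (pCons 0 P) (inverse h) * exp (- inverse h)) \<longlongrightarrow> 0) (at_right 0)"
        by (rule filterlim_compose[OF poly_times_exp_tendsto_0 filterlim_inverse_at_top_right])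
      then show "((\<lambda>h. (flat_fun P (0 + h) - flat_fun P 0) / h) \<longlongrightarrow> 0) (at_right 0)"
        by (rule Lim_transform_eventually)
          (auto simp: flat_fun_def eventually_at_right_field field_simps intro!: exI[of _ 1])
    qed
    then show ?thesis
      using 2 by (simp add: DERIV_def flat_fun_def)
  next
    case 3
    have I: "((\<lambda>x. 1 / x) has_real_derivative - (1 / x * (1 / x))) (at x)"
      using 3 DERIV_inverse[of x] by (simp add: inverse_eq_divide power2_eq_square)
    have "((\<lambda>x. poly P (1 / x) * exp (- (1 / x))) has_real_derivative
        poly ([:0, 0, 1:] * (P - pderiv P)) (1 / x) * exp (- (1 / x))) (at x)"
      by (rule DERIV_cong[OF DERIV_mult[OF DERIV_chain2[OF poly_DERIV I]
          DERIV_chain2[OF DERIV_exp DERIV_minus[OF I]]]]) (simp add: algebra_simps)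
    then have "(flat_fun P has_real_derivative
        poly ([:0, 0, 1:] * (P - pderiv P)) (1 / x) * exp (- (1 / x))) (at x)"
      by (rule has_field_derivative_transform_within_open[of _ _ _ "{0<..}"])
        (use 3 in \<open>auto simp: flat_fun_def\<close>)
    with 3 show ?thesis by (simp add: flat_fun_def)
  qed
qed

lemma smooth_flat_fun: "smooth (flat_fun P)"
  by (rule smooth_coinduct[of _ "range flat_fun"]) (use flat_fun_DERIV in auto)

text \<open>The normalised antiderivative of a smooth bump that is positive exactly on (0,1): it is
  monotone, and constant on either side of that interval.\<close>

lemma ex_smooth_step:
  obtains s :: "real \<Rightarrow> real"
  where "smooth s" "\<And>x. x \<le> 0 \<Longrightarrow> s x = 0" "\<And>x. x \<ge> 1 \<Longrightarrow> s x = 1" "\<And>x. 0 \<le> s x" "\<And>x. s x \<le> 1"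
proof -
  define b where "b x = flat_fun 1 x * flat_fun 1 (1 + (-1) * x)" for x
  have b: "smooth b"
    unfolding b_def by (intro smooth_mult smooth_compose_affine smooth_flat_fun)
  have b_nonneg: "b x \<ge> 0" and b_pos: "0 < x \<Longrightarrow> x < 1 \<Longrightarrow> b x > 0"
    and b_0: "x \<le> 0 \<or> x \<ge> 1 \<Longrightarrow> b x = 0" for x
    by (auto simp: b_def flat_fun_def)
  have "isCont b x" for x
    by (rule DERIV_isCont[OF smooth_imp_DERIV[OF b]])
  then obtain G where G: "\<And>x. (G has_real_derivative b x) (at x)"
    using einterval_antiderivative[of "-\<infinity>" \<infinity> b]
    unfolding has_real_derivative_iff_has_vector_derivative by auto
  have mono: "G x \<le> G y" if "x \<le> y" for x y
    using that by (rule DERIV_nonneg_imp_nondecreasing) (use G b_nonneg in blast)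
  have G0: "G x = G 0" if "x \<le> 0" for x
  proof (cases "x < 0")
    case True
    then obtain z where "z > x" "z < 0" "G 0 - G x = (0 - x) * b z"
      using MVT2[of x 0 G b] G by auto
    then show ?thesis using b_0[of z] by simp
  qed (use that in simp)
  have G1: "G x = G 1" if "x \<ge> 1" for x
  proof (cases "x > 1")
    case True
    then obtain z where "z > 1" "z < x" "G x - G 1 = (x - 1) * b z"
      using MVT2[of 1 x G b] G by auto
    then show ?thesis using b_0[of z] by simp
  qed (use that in simp)
  obtain z where "z > 0" "z < 1" "G 1 - G 0 = (1 - 0) * b z"
    using MVT2[of 0 1 G b] G by auto
  then have pos: "G 1 - G 0 > 0" using b_pos[of z] by simp
  have range: "G 0 \<le> G x" "G x \<le> G 1" for x
    using mono[of 0 x] mono[of x 1] G0[of x] G1[of x] mono[of 0 1] by linarith+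
  define s where "s x = (- G 0 + G x) * inverse (G 1 - G 0)" for x
  have "smooth s"
    unfolding s_def
    by (intro smooth_mult smooth_add smooth_const smooth_antiderivative[OF b G])
  moreover have "0 \<le> s x" "s x \<le> 1" for x
    using range[of x] pos by (auto simp: s_def field_simps)
  moreover have "s x = 0" if "x \<le> 0" for x
    using G0[OF that] by (simp add: s_def)
  moreover have "s x = 1" if "x \<ge> 1" for x
    using G1[OF that] pos by (simp add: s_def)
  ultimately show ?thesis
    using that[of s] by blast
qed


section \<open>Test functions and supports\<close>

lemma zero_outside_fun_support: "x \<notin> fun_support p \<Longrightarrow> p x = 0"
  unfolding fun_support_def using closure_subset[of "{x. p x \<noteq> 0}"] by blast

lemma fun_support_subset: "closed C \<Longrightarrow> (\<And>x. x \<notin> C \<Longrightarrow> p x = 0) \<Longrightarrow> fun_support p \<subseteq> C"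
  unfolding fun_support_def by (rule closure_minimal) auto

lemma not_in_fun_supportI:
  assumes "open U" "x \<in> U" "\<And>y. y \<in> U \<Longrightarrow> p y = 0" shows "x \<notin> fun_support p"
proof -
  have "fun_support p \<subseteq> - U"
    using assms by (intro fun_support_subset) auto
  with assms show ?thesis by auto
qed

lemma test_functionsI:
  assumes "smooth p" "compact K" "K \<subseteq> S" "\<And>x. x \<notin> K \<Longrightarrow> p x = 0"
  shows "p \<in> test_functions S"
proof -
  have "fun_support p \<subseteq> K"
    using assms by (intro fun_support_subset compact_imp_closed) auto
  moreover from this have "compact (fun_support p)"
    using assms(2) compact_Int_closed[of K "fun_support p"]
    by (simp add: fun_support_def Int_absorb1)
  ultimately show ?thesis
    using assms by (auto simp: test_functions_def)
qed

lemma test_functionsD: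
  assumes "p \<in> test_functions S"
  shows "smooth p" "compact (fun_support p)" "fun_support p \<subseteq> S"
  using assms by (auto simp: test_functions_def)

lemma test_functions_mono: "p \<in> test_functions S \<Longrightarrow> S \<subseteq> S' \<Longrightarrow> p \<in> test_functions S'"
  by (auto simp: test_functions_def)

lemma test_functions_UNIV: "p \<in> test_functions S \<Longrightarrow> p \<in> test_functions UNIV"
  by (rule test_functions_mono) auto

lemma test_functions_mult:
  assumes "smooth e" "p \<in> test_functions S" shows "(\<lambda>x. e x * p x) \<in> test_functions S"
proof (rule test_functionsI[of _ "fun_support p"])
  show "smooth (\<lambda>x. e x * p x)"
    by (rule smooth_mult[OF assms(1) test_functionsD(1)[OF assms(2)]])
qed (use test_functionsD[OF assms(2)] zero_outside_fun_support[of _ p] in auto)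

lemma test_functions_mult_left:
  assumes "e \<in> test_functions S" "smooth p" shows "(\<lambda>x. e x * p x) \<in> test_functions S"
  using test_functions_mult[OF assms(2,1)] by (simp add: mult.commute)

lemma test_functions_add:
  assumes "p \<in> test_functions S" "q \<in> test_functions S"
  shows "(\<lambda>x. p x + q x) \<in> test_functions S"
proof (rule test_functionsI[of _ "fun_support p \<union> fun_support q"])
  show "smooth (\<lambda>x. p x + q x)"
    by (rule smooth_add[OF test_functionsD(1)[OF assms(1)] test_functionsD(1)[OF assms(2)]])
  show "compact (fun_support p \<union> fun_support q)"
    by (rule compact_Un[OF test_functionsD(2)[OF assms(1)] test_functionsD(2)[OF assms(2)]])
  show "fun_support p \<union> fun_support q \<subseteq> S"
    using test_functionsD(3)[OF assms(1)] test_functionsD(3)[OF assms(2)] by blast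
  show "p x + q x = 0" if "x \<notin> fun_support p \<union> fun_support q" for x
    using that zero_outside_fun_support[of x p] zero_outside_fun_support[of x q] by simp
qed

lemma test_functions_cmult:
  "p \<in> test_functions S \<Longrightarrow> (\<lambda>x. c * p x) \<in> test_functions S"
  by (rule test_functions_mult[OF smooth_const])

lemma test_functions_diff:
  assumes "p \<in> test_functions S" "q \<in> test_functions S"
  shows "(\<lambda>x. p x - q x) \<in> test_functions S"
  using test_functions_add[OF assms(1) test_functions_cmult[OF assms(2), of "-1"]] by simp

lemma fun_support_deriv: "fun_support (deriv p) \<subseteq> fun_support p"
proof (rule fun_support_subset)
  fix x assume x: "x \<notin> fun_support p"
  have "((\<lambda>x. 0) has_real_derivative 0) (at x)" by simp
  then have "(p has_real_derivative 0) (at x)"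
  proof (rule has_field_derivative_transform_within_open[of _ _ _ "- fun_support p"])
    show "open (- fun_support p)"
      unfolding fun_support_def by (rule open_Compl[OF closed_closure])
    show "0 = p y" if "y \<in> - fun_support p" for y
      using that zero_outside_fun_support[of y p] by simp
  qed (use x in simp)
  then show "deriv p x = 0" by (rule DERIV_imp_deriv)
qed (simp add: fun_support_def)

lemma test_functions_deriv:
  assumes "p \<in> test_functions S" shows "deriv p \<in> test_functions S"
proof (rule test_functionsI[of _ "fun_support p"])
  show "smooth (deriv p)" by (rule smooth_deriv[OF test_functionsD(1)[OF assms]])
  show "deriv p x = 0" if "x \<notin> fun_support p" for x
    by (rule zero_outside_fun_support[of x "deriv p"]) (use that fun_support_deriv[of p] in auto)
qed (use test_functionsD[OF assms] in auto)

lemma test_functions_deriv_power: "p \<in> test_functions S \<Longrightarrow> (deriv ^^ k) p \<in> test_functions S"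
  by (induction k) (auto intro: test_functions_deriv)

lemma deriv_lincomb:
  assumes "smooth p" "smooth q"
  shows "deriv (\<lambda>x. a * p x + b * q x) = (\<lambda>x. a * deriv p x + b * deriv q x)"
  by (intro ext DERIV_imp_deriv DERIV_add DERIV_cmult smooth_imp_DERIV assms)

lemma smooth_translate: "smooth p \<Longrightarrow> smooth (\<lambda>y. p (x + y))"
  using smooth_compose_affine[of p x 1] by simp

lemma deriv_translate:
  assumes "smooth p" shows "deriv (\<lambda>y. p (x + y)) = (\<lambda>y. deriv p (x + y))"
proof
  fix y
  have "(p has_real_derivative deriv p (x + y)) (at (x + y))"
    using assms by (rule smooth_imp_DERIV)
  then have "((\<lambda>y. p (x + y)) has_real_derivative deriv p (x + y)) (at y)"
    using DERIV_shift[of p "deriv p (x + y)" y x] by (simp add: add.commute)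
  then show "deriv (\<lambda>y. p (x + y)) y = deriv p (x + y)"
    by (rule DERIV_imp_deriv)
qed

lemma test_functions_translate:
  assumes "p \<in> test_functions UNIV" shows "(\<lambda>y. p (x + y)) \<in> test_functions UNIV"
proof (rule test_functionsI[of _ "(\<lambda>z. - x + z) ` fun_support p"])
  show "compact ((\<lambda>z. - x + z) ` fun_support p)"
    using test_functionsD[OF assms] by (intro compact_translation)
  fix y assume "y \<notin> (\<lambda>z. - x + z) ` fun_support p"
  then have "x + y \<notin> fun_support p"
    by (auto simp: image_iff dest!: bspec[of _ _ "x + y"])
  then show "p (x + y) = 0" by (rule zero_outside_fun_support[of _ p])
next
  show "smooth (\<lambda>y. p (x + y))"
    by (rule smooth_translate[OF test_functionsD(1)[OF assms]])
qed simp

lemma test_function_bounded: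
  assumes "p \<in> test_functions S" obtains B where "B \<ge> 0" "\<And>x. \<bar>p x\<bar> \<le> B"
proof -
  have "compact (p ` fun_support p)"
    using test_functionsD[OF assms] by (intro compact_continuous_image smooth_continuous_on)
  then obtain B where B: "\<And>x. x \<in> fun_support p \<Longrightarrow> \<bar>p x\<bar> \<le> B"
    using compact_imp_bounded[of "p ` fun_support p"] by (auto simp: bounded_iff)
  have "\<bar>p x\<bar> \<le> max 0 B" for x
    using B[of x] zero_outside_fun_support[of x p] by (cases "x \<in> fun_support p") auto
  then show ?thesis using that[of "max 0 B"] by simp
qed

lemma abs_le_SUP_test_function:
  assumes "p \<in> test_functions S" shows "\<bar>p x\<bar> \<le> (SUP x. \<bar>p x\<bar>)"
proof -
  obtain B where "\<And>x. \<bar>p x\<bar> \<le> B" using test_function_bounded[OF assms] by blast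
  then show ?thesis by (intro cSUP_upper bdd_aboveI2) auto
qed

lemma test_function_bounded_support:
  assumes "p \<in> test_functions UNIV" obtains a b where "\<And>x. x \<le> a \<or> x \<ge> b \<Longrightarrow> p x = 0" "a < b"
proof -
  obtain B where B: "\<And>x. x \<in> fun_support p \<Longrightarrow> \<bar>x\<bar> \<le> B"
    using compact_imp_bounded[OF test_functionsD(2)[OF assms]] by (auto simp: bounded_iff)
  have "p x = 0" if "x \<le> - (\<bar>B\<bar> + 1) \<or> x \<ge> \<bar>B\<bar> + 1" for x
    by (rule zero_outside_fun_support[of x p]) (use B[of x] that in auto)
  then show ?thesis using that[of "- (\<bar>B\<bar> + 1)" "\<bar>B\<bar> + 1"] by auto
qed

lemma test_function_borel [measurable_dest]: "p \<in> test_functions S \<Longrightarrow> p \<in> borel_measurable borel"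
  by (intro borel_measurable_continuous_onI smooth_continuous_on test_functionsD(1))

text \<open>A nonempty compact support has a maximum below T, and density leaves room for a strict
  bound. As \<open>frac_J\<close> prescribes only restrictions to half-lines with endpoint R < T,
  this is how a single test function is reached.\<close>

lemma test_function_below:
  assumes "0 < T" "p \<in> test_functions (below T)"
  obtains R where "ereal R < T" "0 < R" "p \<in> test_functions {..<R}"
proof -
  \<comment> \<open>\<open>R0\<close> handles an empty support and forces the final bound to be
    positive.\<close>
  obtain R0 where R0: "0 < ereal R0" "ereal R0 < T"
    using ereal_dense2[OF \<open>0 < T\<close>] by auto
  obtain R where R: "ereal R < T" "R \<ge> R0" "\<And>x. x \<in> fun_support p \<Longrightarrow> x \<le> R"
  proof (cases "fun_support p = {}")
    case True then show ?thesis using that[of R0] R0 by auto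
  next
    case False
    then obtain m where m: "m \<in> fun_support p" "\<And>x. x \<in> fun_support p \<Longrightarrow> x \<le> m"
      using compact_attains_sup[OF test_functionsD(2)[OF assms(2)]] by blast
    have "ereal m < T"
      using test_functionsD(3)[OF assms(2)] m(1) by (auto simp: below_def)
    then show ?thesis
      by (intro that[of "max m R0"]) (use R0 m(2) in \<open>auto simp: max_def intro: order_trans\<close>)
  qed
  obtain R' where "R < R'" "ereal R' < T"
    using ereal_dense2[OF R(1)] by auto
  then have "fun_support p \<subseteq> {..<R'}"
    using R(3) by fastforce
  then have "p \<in> test_functions {..<R'}"
    using test_functionsD[OF assms(2)] by (simp add: test_functions_def)
  moreover have "0 < R'" using R0(1) R(2) \<open>R < R'\<close> by simp
  ultimately show ?thesis using that \<open>ereal R' < T\<close> by blast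
qed

lemma test_functions_lessThan_below: "ereal R < T \<Longrightarrow> p \<in> test_functions {..<R} \<Longrightarrow> p \<in> test_functions (below T)"
  by (erule test_functions_mono) (auto simp: below_def intro: less_trans[of _ "ereal R" T])

lemma lessThan_test_zero: "p \<in> test_functions {..<R} \<Longrightarrow> x \<ge> R \<Longrightarrow> p x = 0"
  by (rule zero_outside_fun_support[of x p]) (use test_functionsD(3)[of p "{..<R}"] in auto)

text \<open>Ensures that the condition on cutoffs in \<open>frac_J\<close> can be met, and provides
  the cutoff that replaces an arbitrary admissible one.\<close>

lemma ex_cutoff:
  assumes "ereal R < T"
  obtains e U where "e \<in> test_functions (below T)" "open U" "{0..R} \<subseteq> U" "\<And>x. x \<in> U \<Longrightarrow> e x = 1"
proof -
  obtain s where s: "smooth s" "\<And>x. x \<le> 0 \<Longrightarrow> s x = 0" "\<And>x. x \<ge> 1 \<Longrightarrow> s x = 1"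
    using ex_smooth_step by metis
  obtain R2 where R2: "R < R2" "ereal R2 < T" using ereal_dense2[OF assms] by auto
  define d where "d = (R2 - R) / 2"
  have d: "d > 0" "R2 = R + 2 * d" using R2 by (auto simp: d_def field_simps)
  \<comment> \<open>The first factor rises on [-2,-1], the second falls on [R+d,R2]; hence
    \<open>e\<close> is 1 on (-1,R+d), a neighbourhood of [0,R].\<close>
  define e where "e x = s (2 + 1 * x) * s (R2 / d + (- 1 / d) * x)" for x
  have "e \<in> test_functions (below T)"
  proof (rule test_functionsI[of _ "{-2..R2}"])
    show "smooth e"
      unfolding e_def by (intro smooth_mult smooth_compose_affine s)
    show "{-2..R2} \<subseteq> below T"
      using R2 by (auto simp: below_def intro: order_le_less_trans[of _ "ereal R2"])
    show "e x = 0" if "x \<notin> {-2..R2}" for x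
    proof (cases "x < -2")
      case False
      then have "R2 / d + (- 1 / d) * x \<le> 0"
        using that d(1) by (simp add: field_simps)
      then show ?thesis by (simp only: e_def s mult_zero_right)
    qed (simp add: e_def s)
  qed simp
  moreover have "e x = 1" if "x \<in> {-1<..<R + d}" for x
  proof -
    have "1 \<le> (R2 - x) / d" using that d by (simp add: pos_le_divide_eq)
    then have "R2 / d + (- 1 / d) * x \<ge> 1" by (simp add: diff_divide_distrib)
    then have "s (R2 / d + (- 1 / d) * x) = 1" by (rule s)
    moreover have "s (2 + 1 * x) = 1" using that by (intro s) auto
    ultimately show ?thesis by (simp only: e_def mult_1)
  qed
  moreover have "{0..R} \<subseteq> {-1<..<R + d}" using d by auto
  ultimately show ?thesis
    using that open_greaterThanLessThan by blast
qed

section \<open>Vanishing of a distribution off its support\<close>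

lemma distributions_lincomb:
  assumes "v \<in> distributions S" "p \<in> test_functions S" "q \<in> test_functions S"
  shows "v (\<lambda>x. a * p x + b * q x) = a * v p + b * v q"
  using assms by (auto simp: distributions_def)

lemma distributions_diff:
  assumes "v \<in> distributions S" "p \<in> test_functions S" "q \<in> test_functions S"
  shows "v (\<lambda>x. p x - q x) = v p - v q"
  using distributions_lincomb[OF assms, of 1 "-1"] by simp

text \<open>A smooth step \<open>s\<close> gives the pieces \<open>(s (x / h - k) - s (x / h - k - 1)) p x\<close>, each
  supported in an interval of length \<open>2 h\<close>, and their sum telescopes to \<open>p\<close>.\<close>

lemma dist_zero_outside_support:
  assumes v: "v \<in> distributions S" and p: "p \<in> test_functions S"
    and disj: "fun_support p \<inter> dist_support S v = {}"
  shows "v p = 0"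
proof -
  define \<G> where "\<G> = {U. open U \<and> U \<subseteq> S \<and> (\<forall>p\<in>test_functions U. v p = 0)}"
  have sub: "fun_support p \<subseteq> \<Union>\<G>"
    using disj test_functionsD(3)[OF p] unfolding dist_support_def \<G>_def by blast
  obtain e where e: "e > 0" "\<And>x. x \<in> fun_support p \<Longrightarrow> \<exists>G\<in>\<G>. ball x e \<subseteq> G"
    using Heine_Borel_lemma[OF test_functionsD(2)[OF p] sub] by (auto simp: \<G>_def)
  obtain a b where ab: "\<And>x. x \<le> a \<or> x \<ge> b \<Longrightarrow> p x = 0" "a < b"
    using test_function_bounded_support[OF test_functions_UNIV[OF p]] by blast
  obtain s where s: "smooth s" "\<And>x. x \<le> 0 \<Longrightarrow> s x = 0" "\<And>x. x \<ge> 1 \<Longrightarrow> s x = 1"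
    using ex_smooth_step by metis
  \<comment> \<open>\<open>e\<close> is a Lebesgue number of the cover. A piece lives in an interval
    of length \<open>2 * h\<close>, that is \<open>e / 2\<close>, so once this interval meets the
    support of \<open>p\<close> it lies in one member of the cover.\<close>
  define h where "h = e / 4"
  have h: "h > 0" "e = 4 * h" using e(1) by (simp_all add: h_def)
  \<comment> \<open>The argument of \<open>s\<close> is 1 + (x - a)/h - k. For x > a and k = 0 it is
    at least 1, giving \<open>q 0 = p\<close>; for x < b and large k it is at most 0, giving
    \<open>q k = 0\<close>. What has to be seen is that \<open>v (q k)\<close> does not depend on
    k.\<close>
  define q where "q k x = s ((1 - a / h - real k) + (1 / h) * x) * p x" for k x
  have q: "q k \<in> test_functions S" for k
    unfolding q_def by (intro test_functions_mult smooth_compose_affine s p)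
  have step: "v (q k) = v (q (Suc k))" for k
  proof -
    define r where "r x = q k x - q (Suc k) x" for x
    have r: "r \<in> test_functions S"
      unfolding r_def by (intro test_functions_diff q)
    define I where "I = {a + h * (real k - 1) .. a + h * (real k + 1)}"
    have r_out: "r x = 0" if "x \<notin> I" for x
    proof (cases "x < a + h * (real k - 1)")
      case True
      then have "(1 - a / h - real k) + (1 / h) * x \<le> 0"
        "(1 - a / h - real (Suc k)) + (1 / h) * x \<le> 0"
        using h(1) by (simp_all add: field_simps)
      then show ?thesis by (simp only: r_def q_def s mult_zero_left diff_self)
    next
      case False
      then have "x > a + h * (real k + 1)" using that by (auto simp: I_def)
      then have "(1 - a / h - real k) + (1 / h) * x \<ge> 1"
        "(1 - a / h - real (Suc k)) + (1 / h) * x \<ge> 1"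
        using h(1) by (simp_all add: field_simps)
      then show ?thesis by (simp only: r_def q_def s diff_self)
    qed
    have "v r = 0"
    proof (cases "fun_support p \<inter> I = {}")
      case True
      then have "r x = 0" for x
        using r_out[of x] zero_outside_fun_support[of x p]
        by (cases "x \<in> I") (auto simp: r_def q_def)
      then have "r = (\<lambda>x. 0 * p x + 0 * p x)" by auto
      then show ?thesis using distributions_lincomb[OF v p p, of 0 0] by simp
    next
      case False
      then obtain x0 where x0: "x0 \<in> fun_support p" "x0 \<in> I" by blast
      then obtain G where G: "G \<in> \<G>" "ball x0 e \<subseteq> G" using e(2) by blast
      have "I \<subseteq> ball x0 e"
        using x0(2) h by (auto simp: I_def dist_real_def algebra_simps abs_less_iff)
      then have "r \<in> test_functions G"
        using G by (intro test_functionsI[of _ I] r_out test_functionsD(1)[OF r]) (auto simp: I_def)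
      then show ?thesis using G(1) by (auto simp: \<G>_def)
    qed
    moreover have "v r = v (q k) - v (q (Suc k))"
      unfolding r_def by (intro distributions_diff[OF v] q)
    ultimately show ?thesis by simp
  qed
  have const: "v (q 0) = v (q k)" for k
    by (induction k) (use step in auto)
  have "q 0 x = p x" for x
  proof (cases "x \<le> a")
    case False
    then have "(1 - a / h - real 0) + (1 / h) * x \<ge> 1"
      using h(1) by (simp add: field_simps)
    then show ?thesis by (simp only: q_def s mult_1)
  qed (simp add: q_def ab)
  then have 1: "q 0 = p" by auto
  obtain k where k: "real k > (b - a) / h + 1" using reals_Archimedean2 by blast
  have "q k x = 0" for x
  proof (cases "x \<ge> b")
    case False
    have "(1 - a / h - real k) + (1 / h) * x \<le> 1 - a / h - real k + (1 / h) * b"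
      using False h(1) by (simp add: field_simps)
    also have "\<dots> \<le> 0" using k by (simp add: field_simps diff_divide_distrib)
    finally show ?thesis by (simp only: q_def s mult_zero_left)
  qed (simp add: q_def ab)
  then have "q k = (\<lambda>x. 0 * p x + 0 * p x)" by auto
  then have "v (q k) = 0" using distributions_lincomb[OF v p p, of 0 0] by simp
  with const[of k] 1 show ?thesis by simp
qed


section \<open>Convolution of causal functions\<close>

text \<open>Locally integrable functions on [0,T), extended by zero to the left and given in a Borel
  version, so that Fubini's theorem on \<open>lborel\<close> applies. Values from T on are left
  free; probes do not see them.\<close>

definition causal :: "ereal \<Rightarrow> (real \<Rightarrow> real) set" where
  "causal T = {F. F \<in> borel_measurable borel \<and> (\<forall>t<0. F t = 0) \<and>
     (\<forall>R. ereal R < T \<longrightarrow> integrable lborel (\<lambda>t. indicator {..R} t * F t))}"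

text \<open>Bounds are imposed only on \<open>t \<ge> 0\<close>: for \<open>x < 0\<close> the integrals \<open>\<integral> g y * q (x + y) dy\<close>, which
  have to be probes again, may fail to exist.\<close>

definition probes :: "ereal \<Rightarrow> (real \<Rightarrow> real) set" where
  "probes T = {q. q \<in> borel_measurable borel \<and> (\<exists>B. \<forall>t\<ge>0. \<bar>q t\<bar> \<le> B) \<and>
     (\<exists>R. ereal R < T \<and> (\<forall>t\<ge>R. q t = 0))}"

text \<open>Where the integrand is not integrable the value is the default 0. Apart from
  \<open>conv_commute\<close> and \<open>frac_fun_conv\<close>, the algebraic laws are therefore
  claimed only after pairing with probes.\<close>

definition conv :: "(real \<Rightarrow> real) \<Rightarrow> (real \<Rightarrow> real) \<Rightarrow> real \<Rightarrow> real" where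
  "conv f g t = (LINT x|lborel. f x * g (t - x))"

lemma causalD:
  assumes "F \<in> causal T"
  shows "F \<in> borel_measurable borel" "t < 0 \<Longrightarrow> F t = 0"
    "ereal R < T \<Longrightarrow> integrable lborel (\<lambda>t. indicator {..R} t * F t)"
  using assms by (auto simp: causal_def)

lemma causal_lincomb:
  assumes "F \<in> causal T" "G \<in> causal T" shows "(\<lambda>t. a * F t + b * G t) \<in> causal T"
proof -
  have "integrable lborel (\<lambda>t. a * (indicator {..R} t * F t) + b * (indicator {..R} t * G t))"
    if "ereal R < T" for R
    using causalD(3)[OF assms(1) that] causalD(3)[OF assms(2) that]
    by (intro Bochner_Integration.integrable_add integrable_mult_right)
  moreover have "a * (indicator {..R} t * F t) + b * (indicator {..R} t * G t) =
      indicator {..R} t * (a * F t + b * G t)" for R t :: real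
    by (simp add: algebra_simps)
  ultimately show ?thesis
    using causalD(1,2)[OF assms(1)] causalD(1,2)[OF assms(2)] by (auto simp: causal_def)
qed

lemma probesI:
  assumes "q \<in> borel_measurable borel" "\<And>t. t \<ge> 0 \<Longrightarrow> \<bar>q t\<bar> \<le> B"
    "ereal R < T" "\<And>t. t \<ge> R \<Longrightarrow> q t = 0"
  shows "q \<in> probes T"
  using assms unfolding probes_def by blast

lemma probesE:
  assumes "q \<in> probes T"
  obtains B R where "q \<in> borel_measurable borel" "B \<ge> 0" "\<And>t. t \<ge> 0 \<Longrightarrow> \<bar>q t\<bar> \<le> B"
    "ereal R < T" "\<And>t. t \<ge> R \<Longrightarrow> q t = 0"
proof -
  obtain B R where *: "q \<in> borel_measurable borel" "\<And>t. t \<ge> 0 \<Longrightarrow> \<bar>q t\<bar> \<le> B"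
    "ereal R < T" "\<And>t. t \<ge> R \<Longrightarrow> q t = 0"
    using assms by (auto simp: probes_def)
  from *(2)[of 0] have "B \<ge> 0" by simp
  with * that show ?thesis by blast
qed

lemma probes_translate:
  assumes "q \<in> probes T" "x \<ge> 0" shows "(\<lambda>y. q (x + y)) \<in> probes T"
proof -
  obtain B R where [measurable]: "q \<in> borel_measurable borel"
    and *: "\<And>t. t \<ge> 0 \<Longrightarrow> \<bar>q t\<bar> \<le> B" "ereal R < T" "\<And>t. t \<ge> R \<Longrightarrow> q t = 0"
    using probesE[OF assms(1)] by metis
  have "(\<lambda>y. q (x + y)) \<in> borel_measurable borel" by measurable
  then show ?thesis
    by (rule probesI[of _ B R]) (use * assms(2) in auto)
qed

lemma test_function_probes:
  assumes "0 < T" "p \<in> test_functions (below T)" shows "p \<in> probes T"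
proof -
  obtain R where "ereal R < T" "p \<in> test_functions {..<R}"
    using test_function_below[OF assms] by blast
  moreover obtain B where "\<And>x. \<bar>p x\<bar> \<le> B" using test_function_bounded[OF assms(2)] by blast
  ultimately show ?thesis
    using test_function_borel[OF assms(2)] lessThan_test_zero unfolding probes_def by blast
qed

lemma causal_probe_integrable:
  assumes f: "f \<in> causal T" and q: "q \<in> probes T"
  shows "integrable lborel (\<lambda>t. f t * q t)"
proof -
  obtain B R where [measurable]: "q \<in> borel_measurable borel"
    and B: "B \<ge> 0" "\<And>t. t \<ge> 0 \<Longrightarrow> \<bar>q t\<bar> \<le> B" and R: "ereal R < T" "\<And>t. t \<ge> R \<Longrightarrow> q t = 0"
    using probesE[OF q] by metis
  have [measurable]: "f \<in> borel_measurable borel" by (rule causalD(1)[OF f])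
  have "\<bar>f t * q t\<bar> \<le> \<bar>B * (indicator {..R} t * f t)\<bar>" for t
  proof (cases "0 \<le> t \<and> t < R")
    case True
    then have "\<bar>f t\<bar> * \<bar>q t\<bar> \<le> \<bar>f t\<bar> * B" by (intro mult_left_mono B) auto
    with True B show ?thesis by (simp add: abs_mult mult.commute)
  next
    case False
    then have "f t * q t = 0" using causalD(2)[OF f, of t] R(2)[of t] by auto
    then show ?thesis by (simp only: abs_zero abs_ge_zero)
  qed
  then show ?thesis
    by (intro Bochner_Integration.integrable_bound[OF
          integrable_mult_right[OF causalD(3)[OF f R(1)], of B]]) auto
qed

text \<open>This is the transpose of convolution with \<open>g\<close>. The L^1 norm of
  \<open>g\<close> up to R gives a bound on x >= 0, and the endpoint R is kept because
  \<open>g\<close> lives on y >= 0. Since the result is a probe, \<open>integral_conv_probe\<close>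
  can be iterated.\<close>

lemma probes_corr:
  assumes g: "g \<in> causal T" and q: "q \<in> probes T"
  shows "(\<lambda>x. LINT y|lborel. g y * q (x + y)) \<in> probes T"
proof -
  obtain B R where [measurable]: "q \<in> borel_measurable borel"
    and B: "B \<ge> 0" "\<And>t. t \<ge> 0 \<Longrightarrow> \<bar>q t\<bar> \<le> B" and R: "ereal R < T" "\<And>t. t \<ge> R \<Longrightarrow> q t = 0"
    using probesE[OF q] by metis
  have [measurable]: "g \<in> borel_measurable borel" by (rule causalD(1)[OF g])
  have "(\<lambda>x. LINT y|lborel. g y * q (x + y)) \<in> borel_measurable borel" by measurable
  moreover have "\<bar>LINT y|lborel. g y * q (x + y)\<bar> \<le> (LINT y|lborel. \<bar>indicator {..R} y * g y\<bar> * B)"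
    if "x \<ge> 0" for x
  proof -
    have "\<bar>LINT y|lborel. g y * q (x + y)\<bar> \<le> (LINT y|lborel. \<bar>g y * q (x + y)\<bar>)"
      by (rule integral_abs_bound)
    also have "\<dots> \<le> (LINT y|lborel. \<bar>indicator {..R} y * g y\<bar> * B)"
    proof (rule integral_mono)
      show "integrable lborel (\<lambda>y. \<bar>g y * q (x + y)\<bar>)"
        by (intro integrable_abs causal_probe_integrable[OF g] probes_translate q that)
      show "integrable lborel (\<lambda>y. \<bar>indicator {..R} y * g y\<bar> * B)"
        by (intro integrable_mult_left integrable_abs causalD(3)[OF g] R)
      show "\<bar>g y * q (x + y)\<bar> \<le> \<bar>indicator {..R} y * g y\<bar> * B" for y
      proof (cases "0 \<le> y \<and> x + y < R")
        case True
        then have "\<bar>g y\<bar> * \<bar>q (x + y)\<bar> \<le> \<bar>g y\<bar> * B"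
          using that by (intro mult_left_mono B) auto
        with True that show ?thesis by (simp add: abs_mult)
      next
        case False
        then have "g y * q (x + y) = 0" using causalD(2)[OF g, of y] R(2)[of "x + y"] by auto
        then show ?thesis using B(1) by (simp only: abs_zero) simp
      qed
    qed
    finally show ?thesis .
  qed
  moreover have "(LINT y|lborel. g y * q (x + y)) = 0" if "x \<ge> R" for x
  proof -
    have "g y * q (x + y) = 0" for y
      using causalD(2)[OF g, of y] R(2)[of "x + y"] that by (cases "y < 0") auto
    then show ?thesis by (simp only: Bochner_Integration.integral_zero)
  qed
  ultimately show ?thesis
    using R(1) by (intro probesI)
qed

lemma conv_commute: "conv f g = conv g f"
proof
  fix t
  show "conv f g t = conv g f t"
    unfolding conv_def
    using lborel_integral_real_affine[of "-1" "\<lambda>x. f x * g (t - x)" t] by (simp add: mult.commute)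
qed

lemma conv_borel [measurable]:
  assumes [measurable]: "f \<in> borel_measurable borel" "g \<in> borel_measurable borel"
  shows "conv f g \<in> borel_measurable borel"
  unfolding conv_def by measurable

lemma conv_negative:
  assumes "f \<in> causal T" "g \<in> causal T" "t < 0" shows "conv f g t = 0"
proof -
  have "f x * g (t - x) = 0" for x
    using causalD(2)[OF assms(1), of x] causalD(2)[OF assms(2), of "t - x"] assms(3)
    by (cases "x < 0") auto
  then show ?thesis by (simp only: conv_def Bochner_Integration.integral_zero)
qed

text \<open>Fubini's theorem for f x * g (t - x) * q t. Only 0 <= x <= t < R contributes, so
  \<open>f\<close> and \<open>g\<close> may be truncated at R, which makes them integrable on the
  whole line.\<close>

lemma conv_pairing:
  assumes f: "f \<in> causal T" and g: "g \<in> causal T" and q: "q \<in> probes T"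
  shows integrable_conv_probe: "integrable lborel (\<lambda>t. conv f g t * q t)"
    and integral_conv_probe: "(LINT t|lborel. conv f g t * q t) =
      (LINT x|lborel. f x * (LINT y|lborel. g y * q (x + y)))"
proof -
  obtain B R where [measurable]: "q \<in> borel_measurable borel"
    and B: "B \<ge> 0" "\<And>t. t \<ge> 0 \<Longrightarrow> \<bar>q t\<bar> \<le> B" and R: "ereal R < T" "\<And>t. t \<ge> R \<Longrightarrow> q t = 0"
    using probesE[OF q] by metis
  have [measurable]: "f \<in> borel_measurable borel" "g \<in> borel_measurable borel"
    by (rule causalD(1)[OF f] causalD(1)[OF g])+
  define f' where "f' x = indicator {..R} x * f x" for x
  define g' where "g' x = indicator {..R} x * g x" for x
  \<comment> \<open>A probe may be unbounded on the negative axis, hence it is cut off there as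
    well.\<close>
  define q' where "q' x = indicator {0..} x * q x" for x
  have [measurable]: "f' \<in> borel_measurable borel" "g' \<in> borel_measurable borel"
    "q' \<in> borel_measurable borel"
    unfolding f'_def g'_def q'_def by measurable
  have f': "integrable lborel f'" and g': "integrable lborel g'"
    unfolding f'_def g'_def by (intro causalD(3)[OF f R(1)] causalD(3)[OF g R(1)])+
  have q'B: "\<bar>q' t\<bar> \<le> B" for t
    using B by (auto simp: q'_def indicator_def)
  define H where "H x t = f' x * (g' (t - x) * q' t)" for x t
  have int_g: "integrable lborel (\<lambda>t. g' (t - x))" for x
    using lborel_integrable_real_affine[OF g', of 1 "- x"] by (simp add: add.commute)
  have int_gq: "integrable lborel (\<lambda>t. g' (t - x) * q' t)" for x
  proof (rule Bochner_Integration.integrable_bound[OF integrable_mult_left[OF int_g[of x], of B]])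
    show "AE t in lborel. norm (g' (t - x) * q' t) \<le> norm (g' (t - x) * B)"
      using q'B B(1) by (intro AE_I2) (auto simp: abs_mult intro!: mult_left_mono)
  qed measurable
  have bound: "(LINT t|lborel. \<bar>g' (t - x) * q' t\<bar>) \<le> (LINT y|lborel. \<bar>g' y\<bar>) * B" for x
  proof -
    have "(LINT t|lborel. \<bar>g' (t - x) * q' t\<bar>) \<le> (LINT t|lborel. \<bar>g' (t - x)\<bar> * B)"
      using q'B by (intro integral_mono integrable_abs int_gq integrable_mult_left int_g)
        (auto simp: abs_mult intro!: mult_left_mono)
    also have "\<dots> = (LINT t|lborel. \<bar>g' (t - x)\<bar>) * B" by simp
    also have "(LINT t|lborel. \<bar>g' (t - x)\<bar>) = (LINT y|lborel. \<bar>g' y\<bar>)"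
      using lborel_integral_real_affine[of 1 "\<lambda>y. \<bar>g' y\<bar>" "- x"] by (simp add: add.commute)
    finally show ?thesis .
  qed
  have H: "integrable (lborel \<Otimes>\<^sub>M lborel) (case_prod H)"
  proof (rule lborel_pair.Fubini_integrable)
    show "case_prod H \<in> borel_measurable (lborel \<Otimes>\<^sub>M lborel)"
      unfolding H_def by measurable
    have "integrable lborel (\<lambda>x. \<bar>f' x\<bar> * (LINT t|lborel. \<bar>g' (t - x) * q' t\<bar>))"
    proof (rule Bochner_Integration.integrable_bound)
      show "integrable lborel (\<lambda>x. \<bar>f' x\<bar> * ((LINT y|lborel. \<bar>g' y\<bar>) * B))"
        by (intro integrable_mult_left integrable_abs f')
      show "AE x in lborel. norm (\<bar>f' x\<bar> * (LINT t|lborel. \<bar>g' (t - x) * q' t\<bar>))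
          \<le> norm (\<bar>f' x\<bar> * ((LINT y|lborel. \<bar>g' y\<bar>) * B))"
      proof (rule AE_I2)
        fix x
        have "0 \<le> (LINT t|lborel. \<bar>g' (t - x) * q' t\<bar>)" by simp
        moreover have "0 \<le> (LINT y|lborel. \<bar>g' y\<bar>) * B" using B by simp
        ultimately show "norm (\<bar>f' x\<bar> * (LINT t|lborel. \<bar>g' (t - x) * q' t\<bar>))
            \<le> norm (\<bar>f' x\<bar> * ((LINT y|lborel. \<bar>g' y\<bar>) * B))"
          using mult_left_mono[OF bound[of x] abs_ge_zero[of "f' x"]]
          by (simp only: real_norm_def abs_mult[of "\<bar>f' x\<bar>"] abs_idempotent abs_of_nonneg)
      qed
    qed measurable
    then show "integrable lborel (\<lambda>x. LINT t|lborel. norm (case (x, t) of (x, t) \<Rightarrow> H x t))"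
      by (simp add: H_def abs_mult)
    show "AE x in lborel. integrable lborel (\<lambda>t. case (x, t) of (x, t) \<Rightarrow> H x t)"
      unfolding H_def by (intro AE_I2) (simp add: int_gq)
  qed
  have left: "(LINT x|lborel. H x t) = conv f g t * q t" for t
  proof (cases "0 \<le> t \<and> t < R")
    case True
    have "H x t = f x * g (t - x) * q t" for x
      using causalD(2)[OF f, of x] causalD(2)[OF g, of "t - x"] True
      by (auto simp: H_def f'_def g'_def q'_def indicator_def)
    then show ?thesis by (simp add: conv_def)
  next
    case False
    then have "conv f g t * q t = 0" using conv_negative[OF f g, of t] R(2)[of t] by auto
    moreover have "H x t = 0" for x
      using False R(2)[of t] by (auto simp: H_def q'_def indicator_def)
    ultimately show ?thesis by simp
  qed
  have right: "(LINT t|lborel. H x t) = f x * (LINT y|lborel. g y * q (x + y))" for x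
  proof (cases "0 \<le> x \<and> x \<le> R")
    case True
    have "g' y * q' (x + y) = g y * q (x + y)" for y
      using causalD(2)[OF g, of y] R(2)[of "x + y"] True
      by (auto simp: g'_def q'_def indicator_def)
    then have "(LINT t|lborel. g' (t - x) * q' t) = (LINT y|lborel. g y * q (x + y))"
      using lborel_integral_real_affine[of 1 "\<lambda>t. g' (t - x) * q' t" x] by simp
    then show ?thesis using True by (simp add: H_def f'_def)
  next
    case False
    have "f x * (LINT y|lborel. g y * q (x + y)) = 0"
    proof (cases "x < 0")
      case True then show ?thesis using causalD(2)[OF f] by simp
    next
      case nonneg: False
      then have "g y * q (x + y) = 0" for y
        using causalD(2)[OF g, of y] R(2)[of "x + y"] False by (cases "y < 0") auto
      then show ?thesis by (simp only: Bochner_Integration.integral_zero mult_zero_right)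
    qed
    moreover have "f' x = 0" using False causalD(2)[OF f, of x] by (auto simp: f'_def indicator_def)
    ultimately show ?thesis by (simp add: H_def)
  qed
  show "integrable lborel (\<lambda>t. conv f g t * q t)"
    using lborel_pair.integrable_snd[OF H] by (simp add: left)
  show "(LINT t|lborel. conv f g t * q t) = (LINT x|lborel. f x * (LINT y|lborel. g y * q (x + y)))"
    using lborel_pair.Fubini_integral[OF H] by (simp add: left right)
qed

lemma conv_causal:
  assumes f: "f \<in> causal T" and g: "g \<in> causal T" shows "conv f g \<in> causal T"
proof -
  have "integrable lborel (\<lambda>t. indicator {..R} t * conv f g t)" if R: "ereal R < T" for R
  proof -
    \<comment> \<open>\<open>indicator {..R}\<close> is still 1 at R, while a probe with endpoint R'
      vanishes at R' itself; hence R' > R.\<close>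
    obtain R' where R': "R < R'" "ereal R' < T" using ereal_dense2[OF R] by auto
    have "indicator {..R} \<in> probes T"
      by (rule probesI[of _ 1 R']) (use R' in \<open>auto simp: indicator_def\<close>)
    from integrable_conv_probe[OF f g this] show ?thesis by (simp add: mult.commute)
  qed
  then show ?thesis
    using conv_negative[OF f g] conv_borel[OF causalD(1)[OF f] causalD(1)[OF g]]
    by (auto simp: causal_def)
qed

text \<open>Three transpositions meet at the pairing of \<open>conv f g\<close> with
  \<open>r\<close>, the correlation of the probe with \<open>h\<close>.\<close>

lemma integral_conv_assoc_probe:
  assumes f: "f \<in> causal T" and g: "g \<in> causal T" and h: "h \<in> causal T" and q: "q \<in> probes T"
  shows "(LINT t|lborel. conv f (conv g h) t * q t) = (LINT t|lborel. conv (conv f g) h t * q t)"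
proof -
  define r where "r x = (LINT z|lborel. h z * q (x + z))" for x
  have r: "r \<in> probes T" unfolding r_def by (rule probes_corr[OF h q])
  \<comment> \<open>For x < 0 the translate of \<open>q\<close> need not be a probe, but there
    \<open>f x = 0\<close>.\<close>
  have inner: "f x * (LINT y|lborel. conv g h y * q (x + y)) = f x * (LINT y|lborel. g y * r (x + y))" for x
  proof (cases "x < 0")
    case False
    then have "(\<lambda>y. q (x + y)) \<in> probes T" by (intro probes_translate q) simp
    from integral_conv_probe[OF g h this] show ?thesis by (simp add: r_def add.assoc)
  qed (simp add: causalD(2)[OF f])
  have "(LINT t|lborel. conv f (conv g h) t * q t) =
      (LINT x|lborel. f x * (LINT y|lborel. conv g h y * q (x + y)))"
    by (rule integral_conv_probe[OF f conv_causal[OF g h] q])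
  also have "\<dots> = (LINT t|lborel. conv f g t * r t)"
    unfolding inner by (rule integral_conv_probe[OF f g r, symmetric])
  also have "\<dots> = (LINT t|lborel. conv (conv f g) h t * q t)"
    unfolding r_def by (rule integral_conv_probe[OF conv_causal[OF f g] h q, symmetric])
  finally show ?thesis .
qed

text \<open>Additivity can fail at points where one of the convolution integrals diverges. Once
  \<open>f\<close> has been moved onto the probe, both remaining integrands are integrable.\<close>

lemma integral_conv_lincomb_probe:
  assumes f: "f \<in> causal T" and g: "g \<in> causal T" and h: "h \<in> causal T" and q: "q \<in> probes T"
  shows "(LINT t|lborel. conv f (\<lambda>t. a * g t + b * h t) t * q t) =
    a * (LINT t|lborel. conv f g t * q t) + b * (LINT t|lborel. conv f h t * q t)"
proof -
  define r where "r x = (LINT z|lborel. f z * q (x + z))" for x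
  have r: "r \<in> probes T" unfolding r_def by (rule probes_corr[OF f q])
  have eq: "(LINT t|lborel. conv f k t * q t) = (LINT x|lborel. k x * r x)" if "k \<in> causal T" for k
    unfolding conv_commute[of f] r_def by (rule integral_conv_probe[OF that f q])
  have "(LINT t|lborel. conv f (\<lambda>t. a * g t + b * h t) t * q t) =
      (LINT x|lborel. a * (g x * r x) + b * (h x * r x))"
    unfolding eq[OF causal_lincomb[OF g h]] by (simp add: algebra_simps)
  also have "\<dots> = a * (LINT x|lborel. g x * r x) + b * (LINT x|lborel. h x * r x)"
    using causal_probe_integrable[OF g r] causal_probe_integrable[OF h r]
    by simp
  finally show ?thesis
    unfolding eq[OF g] eq[OF h] .
qed


section \<open>The kernels and derivatives of causal functions\<close>

definition frac_fun :: "real \<Rightarrow> real \<Rightarrow> real" where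
  "frac_fun \<beta> t = heaviside t * t powr (\<beta> - 1) / Gamma \<beta>"

lemma heaviside_indicator: "heaviside = indicator {0..}"
  by (auto simp: heaviside_def indicator_def)

lemma heaviside_borel [measurable]: "heaviside \<in> borel_measurable borel"
  unfolding heaviside_indicator by measurable

lemma frac_fun_borel [measurable]: "frac_fun \<beta> \<in> borel_measurable borel"
  unfolding frac_fun_def by measurable

lemma heaviside_causal: "heaviside \<in> causal T"
proof -
  have "integrable lborel (\<lambda>t. indicator {..R} t * heaviside t)" for R
  proof -
    have "(\<lambda>t. indicator {..R} t * heaviside t) = indicator {0..R}"
      by (auto simp: heaviside_indicator indicator_def)
    then show ?thesis by (simp add: integrable_indicator_iff emeasure_lborel_Icc_eq)
  qed
  then show ?thesis
    unfolding causal_def using heaviside_borel by (simp add: heaviside_def)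
qed

lemma frac_fun_causal:
  assumes "\<beta> > 0" shows "frac_fun \<beta> \<in> causal T"
proof -
  have "integrable lborel (\<lambda>t. indicator {..R} t * frac_fun \<beta> t)" for R
  proof -
    \<comment> \<open>The absolute value keeps the interval nonempty for negative R.\<close>
    have "(\<lambda>t. t powr (\<beta> - 1)) absolutely_integrable_on {0..\<bar>R\<bar>}"
      by (subst absolutely_integrable_on_iff_nonneg)
        (use assms integrable_on_powr_from_0[of "\<beta> - 1" "\<bar>R\<bar>"] in auto)
    then have "integrable lborel (\<lambda>t. indicator {0..\<bar>R\<bar>} t * t powr (\<beta> - 1))"
      unfolding set_integrable_def by (subst (asm) integrable_completion) auto
    from integrable_mult_right[OF this, of "1 / Gamma \<beta>"] show ?thesis
    proof (rule Bochner_Integration.integrable_bound)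
      show "(\<lambda>t. indicator {..R} t * frac_fun \<beta> t) \<in> borel_measurable lborel" by measurable
    qed (auto intro!: AE_I2 simp: frac_fun_def heaviside_def indicator_def abs_mult)
  qed
  then show ?thesis
    unfolding causal_def using frac_fun_borel by (simp add: frac_fun_def heaviside_def)
qed

text \<open>For t > 0 the substitution of t x for x produces t^(a+b-1) times the Beta integral:
  t^(a+b-2) comes from the integrand and one t from the measure. The identity holds at every t, in
  contrast to the general laws for \<open>conv\<close>.\<close>

lemma frac_fun_conv:
  assumes "a > 0" "b > 0" shows "conv (frac_fun a) (frac_fun b) = frac_fun (a + b)"
proof
  fix t :: real
  consider "t < 0" | "t = 0" | "t > 0" by linarith
  then show "conv (frac_fun a) (frac_fun b) t = frac_fun (a + b) t"
  proof cases
    case 1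
    then show ?thesis
      using conv_negative[OF frac_fun_causal[OF assms(1)] frac_fun_causal[OF assms(2)]]
      by (simp add: frac_fun_def heaviside_def)
  next
    case 2
    \<comment> \<open>At t = 0 the supports meet only in x = 0, where \<open>0 powr (a - 1)\<close>
      is 0 by convention, even for a <= 1.\<close>
    have "frac_fun a x * frac_fun b (t - x) = 0" for x
      using 2 by (auto simp: frac_fun_def heaviside_def)
    then have "conv (frac_fun a) (frac_fun b) t = 0"
      by (simp only: conv_def Bochner_Integration.integral_zero)
    with 2 show ?thesis by (simp add: frac_fun_def)
  next
    case 3
    have int: "set_integrable lborel {0..1} (\<lambda>t. t powr (a - 1) * (1 - t) powr (b - 1))"
      by (rule integrable_Beta[OF assms])
    have "(LINT x:{0..1}|lborel. x powr (a - 1) * (1 - x) powr (b - 1)) = Beta a b"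
      using set_borel_integral_eq_integral(2)[OF int] has_integral_Beta_real[OF assms]
      by (simp add: integral_unique)
    moreover have "frac_fun a (t * x) * frac_fun b (t - t * x) =
        t powr (a + b - 2) / (Gamma a * Gamma b) *
          (indicator {0..1} x *\<^sub>R (x powr (a - 1) * (1 - x) powr (b - 1)))" for x
    proof (cases "0 \<le> x \<and> x \<le> 1")
      case True
      have "(t - t * x) powr (b - 1) = t powr (b - 1) * (1 - x) powr (b - 1)"
        using 3 True powr_mult[of t "1 - x" "b - 1"] by (simp add: algebra_simps)
      moreover have "(t * x) powr (a - 1) = t powr (a - 1) * x powr (a - 1)"
        using 3 True by (simp add: powr_mult)
      moreover have "t powr (a + b - 2) = t powr (a - 1) * t powr (b - 1)"
        by (simp add: powr_add[symmetric])
      moreover have "t * x \<le> t" using 3 True by (simp add: mult_le_cancel_left2)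
      ultimately show ?thesis using 3 True by (simp add: frac_fun_def heaviside_def)
    next
      case False
      then have "t * x < 0 \<or> t - t * x < 0"
        using 3 by (auto simp: mult_less_0_iff not_le)
      then have "heaviside (t * x) * heaviside (t - t * x) = 0"
        by (auto simp: heaviside_def)
      with False show ?thesis by (auto simp: frac_fun_def indicator_def)
    qed
    ultimately have "conv (frac_fun a) (frac_fun b) t =
        t * (t powr (a + b - 2) / (Gamma a * Gamma b) * Beta a b)"
      using lborel_integral_real_affine[of t "\<lambda>x. frac_fun a x * frac_fun b (t - x)" 0] 3
      by (simp add: conv_def set_lebesgue_integral_def)
    also have "Beta a b = Gamma a * Gamma b / Gamma (a + b)"
      by (simp add: Beta_def)
    also have "t * (t powr (a + b - 2) / (Gamma a * Gamma b) * (Gamma a * Gamma b / Gamma (a + b))) =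
        (t * t powr (a + b - 2)) / Gamma (a + b)"
      using Gamma_real_pos[OF assms(1)] Gamma_real_pos[OF assms(2)] by simp
    also have "t * t powr (a + b - 2) = t powr (a + b - 1)"
      using 3 powr_add[of t 1 "a + b - 2"] by (simp add: add.commute)
    finally show ?thesis using 3 by (simp add: frac_fun_def[of "a + b"] heaviside_def)
  qed
qed

text \<open>The fundamental theorem of calculus on [0,c]. It says that D of the Heaviside function
  is delta, translated to x and written as a correlation, the form in which it meets
  \<open>integral_conv_probe\<close>.\<close>

lemma integral_heaviside_deriv:
  assumes p: "p \<in> test_functions S"
  shows "(LINT y|lborel. heaviside y * deriv p (x + y)) = - p x"
proof -
  obtain a b where b: "\<And>z. z \<le> a \<or> z \<ge> b \<Longrightarrow> p z = 0"
    using test_function_bounded_support[OF test_functions_UNIV[OF p]] by blast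
  \<comment> \<open>Chosen so that c >= 0 and x + c lies beyond b, where \<open>p\<close>
    vanishes.\<close>
  define c where "c = max 0 (b - x) + 1"
  have "deriv p z = 0" if "z > b" for z
    by (rule zero_outside_fun_support[of z "deriv p"])
      (use that b fun_support_deriv[of p] not_in_fun_supportI[of "{b<..}" z p] in auto)
  then have eq: "heaviside y * deriv p (x + y) = deriv p (x + y) * indicator {0..c} y" for y
    by (auto simp: heaviside_def indicator_def c_def)
  have "(LINT y|lborel. deriv p (x + y) * indicator {0..c} y) = p (x + c) - p (x + 0)"
  proof (rule integral_FTC_Icc_real)
    show "((\<lambda>y. p (x + y)) has_real_derivative deriv p (x + y)) (at y)" for y
      using smooth_imp_DERIV[OF smooth_translate[OF test_functionsD(1)[OF p], of x], of y]
      by (simp add: deriv_translate[OF test_functionsD(1)[OF p]])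
    show "isCont (\<lambda>y. deriv p (x + y)) y" for y
      by (rule DERIV_isCont[OF smooth_imp_DERIV[OF smooth_translate[OF smooth_deriv[OF test_functionsD(1)[OF p]]]]])
  qed (simp add: c_def)
  also have "p (x + c) = 0" by (rule b) (auto simp: c_def)
  finally show ?thesis by (simp add: eq)
qed

text \<open>\<open>frac_fun 1\<close> differs from \<open>heaviside\<close> at 0 only, because
  \<open>0 powr 0 = 0\<close>; the integral does not notice.\<close>

lemma integral_frac_fun_1_deriv:
  assumes p: "p \<in> test_functions S"
  shows "(LINT y|lborel. frac_fun 1 y * deriv p (x + y)) = - p x"
proof -
  have [measurable]: "deriv p \<in> borel_measurable borel"
    by (rule test_function_borel[OF test_functions_deriv[OF p]])
  have "AE y in lborel. y \<noteq> (0::real)"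
    by (rule AE_lborel_singleton)
  then have "AE y in lborel. frac_fun 1 y * deriv p (x + y) = heaviside y * deriv p (x + y)"
    by eventually_elim (auto simp: frac_fun_def heaviside_def)
  then have "(LINT y|lborel. frac_fun 1 y * deriv p (x + y)) = (LINT y|lborel. heaviside y * deriv p (x + y))"
    by (intro integral_cong_AE) auto
  then show ?thesis by (simp add: integral_heaviside_deriv[OF p])
qed

section \<open>Distributional identities for convolutions\<close>

lemma restrict_dist_apply: "p \<in> test_functions S \<Longrightarrow> restrict_dist S u p = u p"
  and restrict_dist_outside: "p \<notin> test_functions S \<Longrightarrow> restrict_dist S u p = 0"
  by (simp_all add: restrict_dist_def)

lemma fun_dist_apply:
  assumes "F \<in> borel_measurable borel" "p \<in> test_functions S"
  shows "fun_dist S F p = (LINT t|lborel. F t * p t)"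
proof -
  have "(\<lambda>t. F t * p t) \<in> borel_measurable lborel"
    using assms(1) test_function_borel[OF assms(2)] by simp
  then show ?thesis
    unfolding fun_dist_def restrict_dist_apply[OF assms(2)] by (rule integral_completion)
qed

lemma dist_deriv_apply: "p \<in> test_functions S \<Longrightarrow> dist_deriv S u p = - u (deriv p)"
  by (simp add: dist_deriv_def restrict_dist_def)

lemma fun_dist_eqI:
  assumes "F \<in> borel_measurable borel" "G \<in> borel_measurable borel"
    "\<And>p. p \<in> test_functions S \<Longrightarrow> (LINT t|lborel. F t * p t) = (LINT t|lborel. G t * p t)"
  shows "fun_dist S F = fun_dist S G"
proof
  fix p show "fun_dist S F p = fun_dist S G p"
  proof (cases "p \<in> test_functions S")
    case True with assms show ?thesis by (simp add: fun_dist_apply)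
  qed (simp add: fun_dist_def restrict_dist_outside)
qed

lemma dist_deriv_fun_dist_eqI:
  assumes "F \<in> borel_measurable borel" "G \<in> borel_measurable borel"
    "\<And>p. p \<in> test_functions S \<Longrightarrow> - (LINT t|lborel. F t * deriv p t) = (LINT t|lborel. G t * p t)"
  shows "dist_deriv S (fun_dist S F) = fun_dist S G"
proof
  fix p show "dist_deriv S (fun_dist S F) p = fun_dist S G p"
  proof (cases "p \<in> test_functions S")
    case True
    then show ?thesis
      using assms by (simp add: dist_deriv_apply fun_dist_apply test_functions_deriv)
  qed (simp add: fun_dist_def dist_deriv_def restrict_dist_outside)
qed

lemma conv_assoc_dist:
  assumes "0 < T" "f \<in> causal T" "g \<in> causal T" "h \<in> causal T"
  shows "fun_dist (below T) (conv f (conv g h)) = fun_dist (below T) (conv (conv f g) h)"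
  using assms by (intro fun_dist_eqI causalD(1) conv_causal integral_conv_assoc_probe test_function_probes)

lemma conv_frac_fun_dist:
  assumes "0 < T" "a > 0" "b > 0" "h \<in> causal T"
  shows "fun_dist (below T) (conv (frac_fun a) (conv (frac_fun b) h)) =
    fun_dist (below T) (conv (frac_fun (a + b)) h)"
  using conv_assoc_dist[OF assms(1) frac_fun_causal frac_fun_causal assms(4)] assms frac_fun_conv
  by simp

lemma fun_dist_conv_lincomb:
  assumes "0 < T" "f \<in> causal T" "g \<in> causal T" "h \<in> causal T"
  shows "fun_dist (below T) (conv f (\<lambda>t. a * g t + b * h t)) p =
    a * fun_dist (below T) (conv f g) p + b * fun_dist (below T) (conv f h) p"
proof (cases "p \<in> test_functions (below T)")
  case True
  then show ?thesis
    using integral_conv_lincomb_probe[OF assms(2-4) test_function_probes[OF assms(1) True]]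
      causalD(1)[OF conv_causal[OF assms(2) causal_lincomb[OF assms(3,4)]]]
      causalD(1)[OF conv_causal[OF assms(2,3)]] causalD(1)[OF conv_causal[OF assms(2,4)]]
    by (simp add: fun_dist_apply)
qed (simp add: fun_dist_def restrict_dist_outside)

lemma fun_dist_lincomb:
  assumes "0 < T" "g \<in> causal T" "h \<in> causal T"
  shows "fun_dist (below T) (\<lambda>t. a * g t + b * h t) p =
    a * fun_dist (below T) g p + b * fun_dist (below T) h p"
proof (cases "p \<in> test_functions (below T)")
  case True
  note q = test_function_probes[OF assms(1) True]
  have "(LINT t|lborel. (a * g t + b * h t) * p t) = (LINT t|lborel. a * (g t * p t) + b * (h t * p t))"
    by (simp add: algebra_simps)
  also have "\<dots> = a * (LINT t|lborel. g t * p t) + b * (LINT t|lborel. h t * p t)"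
    using causal_probe_integrable[OF assms(2) q] causal_probe_integrable[OF assms(3) q] by simp
  finally show ?thesis
    using True causalD(1)[OF causal_lincomb[OF assms(2,3), of a b]] causalD(1)[OF assms(2)]
      causalD(1)[OF assms(3)] by (simp add: fun_dist_apply)
qed (simp add: fun_dist_def restrict_dist_outside)

text \<open>Transposition moves \<open>h\<close> onto \<open>deriv p\<close>, and by the last
  assumption the resulting correlation is -p. \<open>h\<close> stands for \<open>heaviside\<close>
  and \<open>frac_fun 1\<close> alike.\<close>

lemma deriv_dist_conv_fundamental:
  assumes "0 < T" "H \<in> causal T" "h \<in> causal T"
    "\<And>p x. p \<in> test_functions (below T) \<Longrightarrow> (LINT y|lborel. h y * deriv p (x + y)) = - p x"
  shows "dist_deriv (below T) (fun_dist (below T) (conv H h)) = fun_dist (below T) H"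
proof (rule dist_deriv_fun_dist_eqI)
  show "- (LINT t|lborel. conv H h t * deriv p t) = (LINT t|lborel. H t * p t)"
    if p: "p \<in> test_functions (below T)" for p
    using integral_conv_probe[OF assms(2,3) test_function_probes[OF assms(1) test_functions_deriv[OF p]]]
    by (simp add: assms(4)[OF p])
qed (use causalD(1) conv_causal assms in blast)+

lemma deriv_dist_conv_heaviside:
  assumes "0 < T" "H \<in> causal T"
  shows "dist_deriv (below T) (fun_dist (below T) (conv H heaviside)) = fun_dist (below T) H"
  by (rule deriv_dist_conv_fundamental[OF assms heaviside_causal integral_heaviside_deriv])

lemma deriv_dist_conv_frac_fun_1:
  assumes "0 < T" "H \<in> causal T"
  shows "dist_deriv (below T) (fun_dist (below T) (conv (frac_fun 1) H)) = fun_dist (below T) H"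
  unfolding conv_commute[of "frac_fun 1"]
  by (rule deriv_dist_conv_fundamental[OF assms frac_fun_causal integral_frac_fun_1_deriv]) simp_all

text \<open>Since g_(1+b) is the convolution of g_1 and g_b, the derivative removes the factor
  g_1.\<close>

lemma deriv_dist_conv_frac_fun:
  assumes "0 < T" "H \<in> causal T" "b > 0"
  shows "dist_deriv (below T) (fun_dist (below T) (conv (frac_fun (1 + b)) H)) =
    fun_dist (below T) (conv (frac_fun b) H)"
  using deriv_dist_conv_frac_fun_1[OF assms(1) conv_causal[OF frac_fun_causal[OF assms(3)] assms(2)]]
    conv_frac_fun_dist[OF assms(1) _ assms(3,2), of 1] by simp

section \<open>Continuity and support of derivatives of causal functions\<close>

lemma distributions_deriv:
  assumes u: "u \<in> distributions S" shows "dist_deriv S u \<in> distributions S"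
  unfolding distributions_def
proof (intro CollectI conjI allI impI ballI)
  show "dist_deriv S u p = 0" if "p \<notin> test_functions S" for p
    using that by (simp add: dist_deriv_def restrict_dist_outside)
next
  fix p q a b assume p: "p \<in> test_functions S" and q: "q \<in> test_functions S"
  have "(\<lambda>x. a * p x + b * q x) \<in> test_functions S"
    by (intro test_functions_add test_functions_cmult p q)
  then show "dist_deriv S u (\<lambda>x. a * p x + b * q x) = a * dist_deriv S u p + b * dist_deriv S u q"
    using distributions_lincomb[OF u test_functions_deriv[OF p] test_functions_deriv[OF q]] p q
    by (simp add: dist_deriv_apply deriv_lincomb[OF test_functionsD(1)[OF p] test_functionsD(1)[OF q]])
next
  fix K assume K: "compact K \<and> K \<subseteq> S"
  have "\<forall>K. compact K \<and> K \<subseteq> S \<longrightarrow> (\<exists>C N. \<forall>p\<in>test_functions S. fun_support p \<subseteq> K \<longrightarrow>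
      \<bar>u p\<bar> \<le> C * (\<Sum>k\<le>N. SUP x. \<bar>(deriv ^^ k) p x\<bar>))"
    using u unfolding distributions_def by (elim CollectE conjE)
  from this[rule_format, OF K] obtain C N where C: "\<And>p. p \<in> test_functions S \<Longrightarrow> fun_support p \<subseteq> K \<Longrightarrow>
      \<bar>u p\<bar> \<le> C * (\<Sum>k\<le>N. SUP x. \<bar>(deriv ^^ k) p x\<bar>)"
    by blast
  show "\<exists>C N. \<forall>p\<in>test_functions S. fun_support p \<subseteq> K \<longrightarrow>
      \<bar>dist_deriv S u p\<bar> \<le> C * (\<Sum>k\<le>N. SUP x. \<bar>(deriv ^^ k) p x\<bar>)"
  proof (intro exI ballI impI)
    fix p assume p: "p \<in> test_functions S" and supp: "fun_support p \<subseteq> K"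
    have nonneg: "0 \<le> (SUP x. \<bar>(deriv ^^ k) p x\<bar>)" for k
      by (rule order_trans[OF abs_ge_zero abs_le_SUP_test_function[OF test_functions_deriv_power[OF p, of k], of 0]])
    have "\<bar>dist_deriv S u p\<bar> = \<bar>u (deriv p)\<bar>" using p by (simp add: dist_deriv_apply)
    also have "\<dots> \<le> C * (\<Sum>k\<le>N. SUP x. \<bar>(deriv ^^ k) (deriv p) x\<bar>)"
      using fun_support_deriv[of p] supp by (intro C test_functions_deriv p) auto
    also have "(\<Sum>k\<le>N. SUP x. \<bar>(deriv ^^ k) (deriv p) x\<bar>) = (\<Sum>k\<le>N. SUP x. \<bar>(deriv ^^ Suc k) p x\<bar>)"
      by (simp only: funpow_Suc_right o_apply)
    \<comment> \<open>The constant \<open>C\<close> may be negative, so it is replaced by its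
      absolute value before the sum is enlarged by the term k = 0.\<close>
    also have "C * \<dots> \<le> \<bar>C\<bar> * \<dots>"
      by (intro mult_right_mono sum_nonneg nonneg) auto
    also have "\<dots> \<le> \<bar>C\<bar> * (\<Sum>k\<le>Suc N. SUP x. \<bar>(deriv ^^ k) p x\<bar>)"
      unfolding sum.atMost_Suc_shift using nonneg[of 0] by (intro mult_left_mono) auto
    finally show "\<bar>dist_deriv S u p\<bar> \<le> \<bar>C\<bar> * (\<Sum>k\<le>Suc N. SUP x. \<bar>(deriv ^^ k) p x\<bar>)" .
  qed
qed

lemma distributions_fun_dist:
  assumes "0 < T" and F: "F \<in> causal T" shows "fun_dist (below T) F \<in> distributions (below T)"
  unfolding distributions_def
proof (intro CollectI conjI allI impI ballI)
  show "fun_dist (below T) F p = 0" if "p \<notin> test_functions (below T)" for p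
    using that by (simp add: fun_dist_def restrict_dist_outside)
next
  fix p q a b assume p: "p \<in> test_functions (below T)" and q: "q \<in> test_functions (below T)"
  have r: "(\<lambda>x. a * p x + b * q x) \<in> test_functions (below T)"
    by (intro test_functions_add test_functions_cmult p q)
  have "(LINT t|lborel. F t * (a * p t + b * q t)) = (LINT t|lborel. a * (F t * p t) + b * (F t * q t))"
    by (simp add: algebra_simps)
  also have "\<dots> = a * (LINT t|lborel. F t * p t) + b * (LINT t|lborel. F t * q t)"
    using causal_probe_integrable[OF F test_function_probes[OF assms(1) p]]
      causal_probe_integrable[OF F test_function_probes[OF assms(1) q]] by simp
  finally show "fun_dist (below T) F (\<lambda>x. a * p x + b * q x) =
      a * fun_dist (below T) F p + b * fun_dist (below T) F q"
    using p q r causalD(1)[OF F] by (simp add: fun_dist_apply)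
next
  fix K assume K: "compact K \<and> K \<subseteq> below T"
  obtain R where R: "ereal R < T" "\<And>x. x \<in> K \<Longrightarrow> x \<le> R"
  proof (cases "K = {}")
    case True
    obtain R where "0 < ereal R" "ereal R < T" using ereal_dense2[OF assms(1)] by auto
    with True that show ?thesis by simp
  next
    case False
    then obtain m where m: "m \<in> K" "\<And>x. x \<in> K \<Longrightarrow> x \<le> m"
      using K compact_attains_sup[of K] by blast
    moreover have "ereal m < T" using m(1) K by (auto simp: below_def)
    ultimately show ?thesis using that by blast
  qed
  \<comment> \<open>Order 0 suffices: the estimate is the L^1 norm of \<open>F\<close> up to R times
    the supremum of |p|.\<close>
  define C where "C = (LINT t|lborel. \<bar>indicator {..R} t * F t\<bar>)"
  show "\<exists>C N. \<forall>p\<in>test_functions (below T). fun_support p \<subseteq> K \<longrightarrow>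
      \<bar>fun_dist (below T) F p\<bar> \<le> C * (\<Sum>k\<le>N. SUP x. \<bar>(deriv ^^ k) p x\<bar>)"
  proof (intro exI ballI impI)
    fix p assume p: "p \<in> test_functions (below T)" and supp: "fun_support p \<subseteq> K"
    define B where "B = (SUP x. \<bar>p x\<bar>)"
    have B: "\<bar>p x\<bar> \<le> B" for x unfolding B_def by (rule abs_le_SUP_test_function[OF p])
    have "\<bar>LINT t|lborel. F t * p t\<bar> \<le> (LINT t|lborel. \<bar>F t * p t\<bar>)"
      by (rule integral_abs_bound)
    also have "\<dots> \<le> (LINT t|lborel. \<bar>indicator {..R} t * F t\<bar> * B)"
    proof (rule integral_mono)
      show "\<bar>F t * p t\<bar> \<le> \<bar>indicator {..R} t * F t\<bar> * B" for t
      proof (cases "t \<le> R")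
        case True
        then show ?thesis using B[of t] by (simp add: abs_mult mult_left_mono)
      next
        case False
        then have "p t = 0"
          by (intro zero_outside_fun_support[of t p]) (use supp R(2) in force)
        with False show ?thesis by simp
      qed
    qed (intro integrable_abs integrable_mult_left causal_probe_integrable[OF F] causalD(3)[OF F R(1)]
        test_function_probes[OF assms(1) p])+
    also have "\<dots> = C * B" by (simp add: C_def)
    finally show "\<bar>fun_dist (below T) F p\<bar> \<le> C * (\<Sum>k\<le>0. SUP x. \<bar>(deriv ^^ k) p x\<bar>)"
      using p causalD(1)[OF F] by (simp add: fun_dist_apply B_def)
  qed
qed

definition deriv_fun_dist :: "ereal \<Rightarrow> nat \<Rightarrow> (real \<Rightarrow> real) \<Rightarrow> functional" where
  "deriv_fun_dist T j F = (dist_deriv (below T) ^^ j) (fun_dist (below T) F)"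

lemma deriv_fun_dist_0 [simp]: "deriv_fun_dist T 0 F = fun_dist (below T) F"
  by (simp add: deriv_fun_dist_def)

lemma deriv_fun_dist_Suc: "deriv_fun_dist T (Suc j) F = dist_deriv (below T) (deriv_fun_dist T j F)"
  by (simp add: deriv_fun_dist_def)

lemma deriv_fun_dist_apply:
  assumes "F \<in> causal T" "p \<in> test_functions (below T)"
  shows "deriv_fun_dist T j F p = (-1) ^ j * (LINT t|lborel. F t * (deriv ^^ j) p t)"
  using assms(2)
proof (induction j arbitrary: p)
  case 0
  then show ?case using causalD(1)[OF assms(1)] by (simp add: fun_dist_apply)
next
  case (Suc j)
  then show ?case
    using Suc.IH[OF test_functions_deriv[OF Suc.prems]]
    by (simp add: deriv_fun_dist_Suc dist_deriv_apply funpow_Suc_right del: funpow.simps)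
qed

lemma deriv_fun_dist_outside: "p \<notin> test_functions (below T) \<Longrightarrow> deriv_fun_dist T j F p = 0"
  by (cases j) (simp_all add: deriv_fun_dist_Suc fun_dist_def dist_deriv_def restrict_dist_outside)

lemma deriv_fun_dist_distributions:
  "0 < T \<Longrightarrow> F \<in> causal T \<Longrightarrow> deriv_fun_dist T j F \<in> distributions (below T)"
  by (induction j) (auto simp: deriv_fun_dist_Suc intro: distributions_deriv distributions_fun_dist)

lemma deriv_fun_dist_negative:
  assumes "F \<in> causal T" "p \<in> test_functions {..<0}"
  shows "deriv_fun_dist T j F p = 0"
proof (cases "p \<in> test_functions (below T)")
  case True
  have "F t * (deriv ^^ j) p t = 0" for t
    using causalD(2)[OF assms(1), of t] lessThan_test_zero[OF test_functions_deriv_power[OF assms(2)], of t j]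
    by (cases "t < 0") auto
  then show ?thesis
    using deriv_fun_dist_apply[OF assms(1) True]
    by (simp only: Bochner_Integration.integral_zero mult_zero_right)
qed (rule deriv_fun_dist_outside)

lemma deriv_fun_dist_support:
  assumes "0 < T" "F \<in> causal T"
  shows "dist_support (below T) (deriv_fun_dist T j F) \<subseteq> {0..}"
proof -
  have "ereal x < T" if "x < 0" for x
    using that assms(1) less_trans[of "ereal x" 0 T] by simp
  then have "{..<0} \<subseteq> below T" by (auto simp: below_def)
  moreover have "\<forall>p\<in>test_functions {..<0}. deriv_fun_dist T j F p = 0"
    using deriv_fun_dist_negative[OF assms(2)] by blast
  ultimately have "{..<0} \<subseteq> \<Union>{U. open U \<and> U \<subseteq> below T \<and>
      (\<forall>p\<in>test_functions U. deriv_fun_dist T j F p = 0)}"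
    by (intro Union_upper) auto
  then have "dist_support (below T) (deriv_fun_dist T j F) \<subseteq> - {..<0}"
    unfolding dist_support_def by blast
  then show ?thesis by auto
qed

lemma deriv_fun_dist_E_space:
  assumes "0 < T" "F \<in> causal T" shows "deriv_fun_dist T j F \<in> E_space T"
  using deriv_fun_dist_distributions[OF assms] deriv_fun_dist_support[OF assms] assms(1)
  unfolding E_space_def by (intro CollectI conjI exI[of _ 0]) (simp_all add: zero_ereal_def[symmetric])


section \<open>The convolution with a kernel\<close>

text \<open>Dominated convergence for the difference quotients: the bound \<open>C\<close> of
  \<open>deriv p\<close> is a Lipschitz constant of \<open>p\<close>, so |G| C dominates.\<close>

lemma DERIV_corr:
  assumes G: "integrable lborel G" and p: "p \<in> test_functions S"
  shows "((\<lambda>x. LINT y|lborel. G y * p (x + y)) has_real_derivative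
    (LINT y|lborel. G y * deriv p (x + y))) (at x)"
proof -
  have [measurable]: "G \<in> borel_measurable borel" "p \<in> borel_measurable borel"
      "deriv p \<in> borel_measurable borel"
    using G test_function_borel[OF p] test_function_borel[OF test_functions_deriv[OF p]] by auto
  obtain B where B: "B \<ge> 0" "\<And>x. \<bar>p x\<bar> \<le> B" using test_function_bounded[OF p] by blast
  obtain C where C: "C \<ge> 0" "\<And>x. \<bar>deriv p x\<bar> \<le> C"
    using test_function_bounded[OF test_functions_deriv[OF p]] by blast
  have int: "integrable lborel (\<lambda>y. G y * p (x + y))" for x
    by (rule Bochner_Integration.integrable_bound[OF integrable_mult_left[OF G, of B]])
      (use B in \<open>auto simp: abs_mult intro!: mult_left_mono\<close>)
  have lip: "\<bar>p u - p v\<bar> \<le> C * \<bar>u - v\<bar>" for u v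
    using field_differentiable_bound[of UNIV p "deriv p" C u v]
      smooth_imp_DERIV[OF test_functionsD(1)[OF p]] C by simp
  have "((\<lambda>z. ((LINT y|lborel. G y * p (z + y)) - (LINT y|lborel. G y * p (x + y))) / (z - x))
      \<longlongrightarrow> (LINT y|lborel. G y * deriv p (x + y))) (at x)"
    unfolding tendsto_at_iff_sequentially
  proof (intro allI impI)
    fix X :: "nat \<Rightarrow> real" assume X: "\<forall>i. X i \<in> UNIV - {x}" "X \<longlonglongrightarrow> x"
    have "(\<lambda>i. LINT y|lborel. G y * ((p (X i + y) - p (x + y)) / (X i - x)))
        \<longlonglongrightarrow> (LINT y|lborel. G y * deriv p (x + y))"
    proof (rule integral_dominated_convergence[where w = "\<lambda>y. \<bar>G y\<bar> * C"])
      show "integrable lborel (\<lambda>y. \<bar>G y\<bar> * C)"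
        by (intro integrable_mult_left integrable_abs G)
      show "AE y in lborel. (\<lambda>i. G y * ((p (X i + y) - p (x + y)) / (X i - x)))
          \<longlonglongrightarrow> G y * deriv p (x + y)"
      proof (intro AE_I2 tendsto_mult_left)
        fix y
        have "((\<lambda>z. p (y + z)) has_real_derivative deriv p (y + x)) (at x)"
          using smooth_imp_DERIV[OF smooth_translate[OF test_functionsD(1)[OF p], of y], of x]
          by (simp add: deriv_translate[OF test_functionsD(1)[OF p]])
        then have "((\<lambda>z. (p (y + z) - p (y + x)) / (z - x)) \<longlongrightarrow> deriv p (y + x)) (at x)"
          by (simp add: has_field_derivative_iff)
        from this[unfolded tendsto_at_iff_sequentially] X
        have "((\<lambda>z. (p (y + z) - p (y + x)) / (z - x)) \<circ> X) \<longlonglongrightarrow> deriv p (y + x)"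
          by blast
        then show "(\<lambda>i. (p (X i + y) - p (x + y)) / (X i - x)) \<longlonglongrightarrow> deriv p (x + y)"
          by (simp add: o_def add.commute)
      qed
      show "AE y in lborel. norm (G y * ((p (X i + y) - p (x + y)) / (X i - x))) \<le> \<bar>G y\<bar> * C" for i
      proof (rule AE_I2)
        fix y
        have "\<bar>(p (X i + y) - p (x + y)) / (X i - x)\<bar> \<le> C"
          using lip[of "X i + y" "x + y"] X(1) by (simp add: field_simps)
        then show "norm (G y * ((p (X i + y) - p (x + y)) / (X i - x))) \<le> \<bar>G y\<bar> * C"
          by (simp only: real_norm_def abs_mult) (intro mult_left_mono; simp)
      qed
    qed measurable
    moreover have "(LINT y|lborel. G y * ((p (X i + y) - p (x + y)) / (X i - x))) =
        ((LINT y|lborel. G y * p (X i + y)) - (LINT y|lborel. G y * p (x + y))) / (X i - x)" for i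
    proof -
      have "(LINT y|lborel. G y * ((p (X i + y) - p (x + y)) / (X i - x))) =
          (LINT y|lborel. (G y * p (X i + y) - G y * p (x + y)) / (X i - x))"
        by (simp only: right_diff_distrib times_divide_eq_right)
      then show ?thesis using int by simp
    qed
    ultimately show "((\<lambda>z. ((LINT y|lborel. G y * p (z + y)) - (LINT y|lborel. G y * p (x + y))) / (z - x)) \<circ> X)
        \<longlonglongrightarrow> (LINT y|lborel. G y * deriv p (x + y))"
      by (simp only: o_def)
  qed
  then show ?thesis by (simp add: has_field_derivative_iff)
qed

text \<open>The derivative passes to \<open>p\<close>, so the images of all test functions under
  this correlation form a set to which \<open>smooth_coinduct\<close> applies. The bounded support
  of \<open>G\<close> bounds the support of the result.\<close>

lemma corr_test_function:
  assumes G: "integrable lborel G" "\<And>y. \<bar>y\<bar> > A \<Longrightarrow> G y = 0" and p: "p \<in> test_functions UNIV"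
  shows "(\<lambda>x. LINT y|lborel. G y * p (x + y)) \<in> test_functions UNIV"
proof -
  obtain a b where ab: "\<And>x. x \<le> a \<or> x \<ge> b \<Longrightarrow> p x = 0"
    using test_function_bounded_support[OF p] by blast
  show ?thesis
  proof (rule test_functionsI[of _ "{a - A..b + A}"])
    show "smooth (\<lambda>x. LINT y|lborel. G y * p (x + y))"
    proof (rule smooth_coinduct[of _ "(\<lambda>p x. LINT y|lborel. G y * p (x + y)) ` test_functions UNIV"])
      fix f assume "f \<in> (\<lambda>p x. LINT y|lborel. G y * p (x + y)) ` test_functions UNIV"
      then obtain q where q: "q \<in> test_functions UNIV" "f = (\<lambda>x. LINT y|lborel. G y * q (x + y))"
        by blast
      then show "\<exists>f'\<in>(\<lambda>p x. LINT y|lborel. G y * p (x + y)) ` test_functions UNIV.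
          \<forall>x. (f has_real_derivative f' x) (at x)"
        using DERIV_corr[OF G(1) q(1)]
        by (intro bexI[of _ "\<lambda>x. LINT y|lborel. G y * deriv q (x + y)"])
          (auto intro: test_functions_deriv)
    qed (use p in blast)
    show "(LINT y|lborel. G y * p (x + y)) = 0" if "x \<notin> {a - A..b + A}" for x
    proof -
      have "G y * p (x + y) = 0" for y
      proof (cases "\<bar>y\<bar> > A")
        case False
        then have "x + y \<le> a \<or> x + y \<ge> b" using that by auto
        then show ?thesis by (simp add: ab)
      qed (simp add: G(2))
      then show ?thesis by (simp only: Bochner_Integration.integral_zero)
    qed
  qed auto
qed

lemma deriv_power_translate:
  "smooth p \<Longrightarrow> (deriv ^^ j) (\<lambda>y. p (x + y)) = (\<lambda>y. (deriv ^^ j) p (x + y))"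
  by (induction j) (simp_all add: deriv_translate smooth_deriv_power)

text \<open>Only derivatives of order at most one are needed, because the distributions to which the
  operators \<open>J\<^sub>\<alpha>\<close> get applied are functions or first derivatives of functions.\<close>

lemma cutoff_corr:
  assumes "0 < T" and F: "F \<in> causal T" and e: "e \<in> test_functions (below T)"
    and p: "p \<in> test_functions UNIV" and j: "j \<le> 1"
  shows "(\<lambda>x. deriv_fun_dist T j F (\<lambda>y. e y * p (x + y))) \<in> test_functions UNIV"
    and "((\<lambda>x. deriv_fun_dist T j F (\<lambda>y. e y * p (x + y))) has_real_derivative
      deriv_fun_dist T j F (\<lambda>y. e y * deriv p (x + y))) (at x)"
proof -
  define G where "G e y = F y * e y" for e :: "real \<Rightarrow> real" and y
  define L where "L e p x = (LINT y|lborel. G e y * p (x + y))" for e p and x :: real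
  have G: "integrable lborel (G e)" if "e \<in> test_functions (below T)" for e
    unfolding G_def by (rule causal_probe_integrable[OF F test_function_probes[OF assms(1) that]])
  have L_test: "L e p \<in> test_functions UNIV"
    and L_DERIV: "(L e p has_real_derivative L e (deriv p) x) (at x)"
    if e: "e \<in> test_functions (below T)" and p: "p \<in> test_functions UNIV" for e p x
  proof -
    obtain a b where ab: "\<And>x. x \<le> a \<or> x \<ge> b \<Longrightarrow> e x = 0"
      using test_function_bounded_support[OF test_functions_UNIV[OF e]] by blast
    have "G e y = 0" if "\<bar>y\<bar> > max \<bar>a\<bar> \<bar>b\<bar>" for y
    proof -
      have "y \<le> a \<or> y \<ge> b" using that by auto
      then show ?thesis by (simp add: G_def ab)
    qed
    with p show "L e p \<in> test_functions UNIV"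
      unfolding L_def by (intro corr_test_function[OF G[OF e]])
    show "(L e p has_real_derivative L e (deriv p) x) (at x)"
      unfolding L_def by (rule DERIV_corr[OF G[OF e] p])
  qed
  have v0: "deriv_fun_dist T 0 F (\<lambda>y. e y * p (x + y)) = L e p x"
    if "p \<in> test_functions UNIV" for p x
    using deriv_fun_dist_apply[OF F test_functions_mult_left[OF e
          smooth_translate[OF test_functionsD(1)[OF that], of x]], of 0]
    by (simp add: L_def G_def mult.assoc)
  \<comment> \<open>By the Leibniz rule the derivative falls either on the cutoff or on
    \<open>p\<close>; both terms are correlations of the kind \<open>L\<close>.\<close>
  have v1: "deriv_fun_dist T (Suc 0) F (\<lambda>y. e y * p (x + y)) = - 1 * (L (deriv e) p x + L e (deriv p) x)"
    if p: "p \<in> test_functions UNIV" for p x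
  proof -
    have sp: "smooth p" by (rule test_functionsD(1)[OF p])
    have d: "deriv (\<lambda>y. e y * p (x + y)) = (\<lambda>y. deriv e y * p (x + y) + deriv p (x + y) * e y)"
      using DERIV_mult[OF smooth_imp_DERIV[OF test_functionsD(1)[OF e]]
          smooth_imp_DERIV[OF smooth_translate[OF sp, of x]]]
      by (intro ext DERIV_imp_deriv) (simp add: deriv_translate[OF sp])
    have int: "integrable lborel (\<lambda>y. G e y * p (x + y))"
      if e: "e \<in> test_functions (below T)" and p: "p \<in> test_functions UNIV" for e p
      using causal_probe_integrable[OF F test_function_probes[OF assms(1)
            test_functions_mult_left[OF e smooth_translate[OF test_functionsD(1)[OF p], of x]]]]
      by (simp add: G_def mult.assoc)
    have "deriv_fun_dist T (Suc 0) F (\<lambda>y. e y * p (x + y)) =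
        - (LINT y|lborel. G (deriv e) y * p (x + y) + G e y * deriv p (x + y))"
      using deriv_fun_dist_apply[OF F test_functions_mult_left[OF e smooth_translate[OF sp, of x]], of 1]
      by (simp add: d G_def distrib_left mult_ac)
    also have "\<dots> = - 1 * (L (deriv e) p x + L e (deriv p) x)"
      unfolding L_def
      using int[OF test_functions_deriv[OF e] p] int[OF e test_functions_deriv[OF p]] by simp
    finally show ?thesis .
  qed
  note e' = test_functions_deriv[OF e] and p' = test_functions_deriv[OF p]
  consider "j = 0" | "j = Suc 0" using j by linarith
  then have "(\<lambda>x. deriv_fun_dist T j F (\<lambda>y. e y * p (x + y))) \<in> test_functions UNIV \<and>
    ((\<lambda>x. deriv_fun_dist T j F (\<lambda>y. e y * p (x + y))) has_real_derivative
      deriv_fun_dist T j F (\<lambda>y. e y * deriv p (x + y))) (at x)"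
  proof cases
    case 1
    show ?thesis
      unfolding 1 v0[OF p] v0[OF p'] using L_test[OF e p] L_DERIV[OF e p] by simp
  next
    case 2
    show ?thesis
      unfolding 2 v1[OF p] v1[OF p']
      by (intro conjI test_functions_cmult test_functions_add DERIV_cmult DERIV_add
          L_test L_DERIV e e' p p')
  qed
  then show "(\<lambda>x. deriv_fun_dist T j F (\<lambda>y. e y * p (x + y))) \<in> test_functions UNIV"
    and "((\<lambda>x. deriv_fun_dist T j F (\<lambda>y. e y * p (x + y))) has_real_derivative
      deriv_fun_dist T j F (\<lambda>y. e y * deriv p (x + y))) (at x)"
    by blast+
qed

lemma cutoff_corr_value:
  assumes "0 < T" and F: "F \<in> causal T" and e: "e \<in> test_functions (below T)"
    and R: "ereal R < T" and p: "p \<in> test_functions {..<R}" and x: "x \<ge> 0"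
    and U: "open U" "dist_support (below T) (deriv_fun_dist T j F) \<inter> {..R} \<subseteq> U" "\<And>x. x \<in> U \<Longrightarrow> e x = 1"
  shows "deriv_fun_dist T j F (\<lambda>y. e y * p (x + y)) =
    (-1) ^ j * (LINT y|lborel. F y * (deriv ^^ j) p (x + y))"
proof -
  define v where "v = deriv_fun_dist T j F"
  define q where "q y = p (x + y)" for y
  have v: "v \<in> distributions (below T)"
    unfolding v_def by (rule deriv_fun_dist_distributions[OF assms(1) F])
  obtain a b where ab: "\<And>z. z \<le> a \<or> z \<ge> b \<Longrightarrow> p z = 0"
    using test_function_bounded_support[OF test_functions_UNIV[OF p]] by blast
  \<comment> \<open>As x >= 0, the translation moves the support to the left and keeps it below
    R.\<close>
  have q: "q \<in> test_functions {..<R}"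
  proof -
    have "fun_support p \<subseteq> {..<R}" by (rule test_functionsD(3)[OF p])
    then have "(\<lambda>z. - x + z) ` fun_support p \<subseteq> {..<R}" using x by auto
    moreover have "q y = 0" if "y \<notin> (\<lambda>z. - x + z) ` fun_support p" for y
    proof -
      have "x + y \<notin> fun_support p" using that by (auto simp: image_iff dest!: bspec[of _ _ "x + y"])
      then show ?thesis unfolding q_def by (rule zero_outside_fun_support[of _ p])
    qed
    moreover have "smooth q" unfolding q_def by (rule smooth_translate[OF test_functionsD(1)[OF p]])
    moreover have "compact ((\<lambda>z. - x + z) ` fun_support p)"
      by (rule compact_translation[OF test_functionsD(2)[OF p]])
    ultimately show ?thesis by (intro test_functionsI)
  qed
  obtain c V where c: "c \<in> test_functions (below T)" and V: "open V" "{0..R} \<subseteq> V" "\<And>x. x \<in> V \<Longrightarrow> c x = 1"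
    using ex_cutoff[OF R] by blast
  have eq: "(\<lambda>y. e y * q y) \<in> test_functions (below T)" "(\<lambda>y. c y * q y) \<in> test_functions (below T)"
    by (intro test_functions_mult_left e c test_functionsD(1)[OF q])+
  \<comment> \<open>Near the points of the support of \<open>v\<close> up to R both cutoffs are 1,
    and beyond R \<open>q\<close> vanishes, so the difference is supported off the support of
    \<open>v\<close>.\<close>
  have "v (\<lambda>y. e y * q y - c y * q y) = 0"
  proof (rule dist_zero_outside_support[OF v test_functions_diff[OF eq]])
    have "y \<notin> fun_support (\<lambda>y. e y * q y - c y * q y)" if y: "y \<in> dist_support (below T) v" for y
    proof (cases "y \<le> R")
      case True
      have "y \<ge> 0" using y deriv_fun_dist_support[OF assms(1) F, of j] by (auto simp: v_def)
      then have "y \<in> U \<inter> V" using U(2) V(2) True y by (auto simp: v_def)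
      then show ?thesis
        using U V by (intro not_in_fun_supportI[of "U \<inter> V"]) auto
    next
      case False
      show ?thesis
        by (rule not_in_fun_supportI[of "{R<..}"]) (use False lessThan_test_zero[OF q] in auto)
    qed
    then show "fun_support (\<lambda>y. e y * q y - c y * q y) \<inter> dist_support (below T) v = {}" by blast
  qed
  then have "v (\<lambda>y. e y * q y) = v (\<lambda>y. c y * q y)"
    using distributions_diff[OF v eq] by simp
  also have "\<dots> = (-1) ^ j * (LINT y|lborel. F y * (deriv ^^ j) (\<lambda>y. c y * q y) y)"
    unfolding v_def by (rule deriv_fun_dist_apply[OF F eq(2)])
  also have "(\<lambda>y. F y * (deriv ^^ j) (\<lambda>y. c y * q y) y) = (\<lambda>y. F y * (deriv ^^ j) q y)"
  proof
    fix y
    have cq: "(\<lambda>y. c y * q y) \<in> test_functions {..<R}"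
      by (rule test_functions_mult[OF test_functionsD(1)[OF c] q])
    consider "y < 0" | "y \<in> {0..R}" | "y \<ge> R" by fastforce
    then show "F y * (deriv ^^ j) (\<lambda>y. c y * q y) y = F y * (deriv ^^ j) q y"
    proof cases
      case 1 then show ?thesis using causalD(2)[OF F] by simp
    next
      case 2
      \<comment> \<open>A derivative depends on a whole neighbourhood of y, which is why
        \<open>c\<close> has to be 1 on the open set \<open>V\<close> and not just on [0,R].\<close>
      then have "eventually (\<lambda>z. z \<in> V) (nhds y)"
        using V by (intro eventually_nhds_in_open) auto
      then have "eventually (\<lambda>z. c z * q z = q z) (nhds y)"
        by eventually_elim (simp add: V(3))
      then show ?thesis by (simp add: higher_deriv_cong_ev[OF _ refl])
    next
      case 3
      then show ?thesis
        using lessThan_test_zero[OF test_functions_deriv_power[OF cq]]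
          lessThan_test_zero[OF test_functions_deriv_power[OF q]] by simp
    qed
  qed
  also have "(deriv ^^ j) q = (\<lambda>y. (deriv ^^ j) p (x + y))"
    unfolding q_def by (rule deriv_power_translate[OF test_functionsD(1)[OF p]])
  finally show ?thesis by (simp add: v_def q_def)
qed

text \<open>All kernels with \<open>\<alpha> > -1\<close> are treated alike as \<open>g\<^sub>\<alpha> = D g\<^sub>1\<^sub>+\<^sub>\<alpha>\<close> with a locally integrable
  \<open>g\<^sub>1\<^sub>+\<^sub>\<alpha>\<close>.\<close>

lemma frac_kernel_apply:
  assumes "\<alpha> > -1" and h: "h \<in> test_functions UNIV"
  shows "frac_kernel \<alpha> h = - (LINT x|lborel. frac_fun (1 + \<alpha>) x * deriv h x)"
proof -
  have below_top: "below \<infinity> = UNIV" by (auto simp: below_def)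
  have h': "deriv h \<in> test_functions UNIV" by (rule test_functions_deriv[OF h])
  consider "\<alpha> > 0" | "\<alpha> = 0" | "\<alpha> < 0" by linarith
  then show ?thesis
  proof cases
    case 1
    have pr: "deriv h \<in> probes \<infinity>"
      using h' by (intro test_function_probes) (simp_all add: below_top)
    have "frac_kernel \<alpha> = fun_dist UNIV (frac_fun \<alpha>)"
      using 1 by (simp add: frac_kernel_def frac_fun_def[abs_def])
    then have "frac_kernel \<alpha> h = (LINT x|lborel. frac_fun \<alpha> x * h x)"
      using h by (simp add: fun_dist_apply)
    \<comment> \<open>An integration by parts in disguise: \<open>h\<close> is minus the correlation
      of \<open>deriv h\<close> with g_1, and Fubini's theorem then joins g_1 to the kernel.\<close>
    also have "\<dots> = - (LINT x|lborel. frac_fun \<alpha> x * (LINT y|lborel. frac_fun 1 y * deriv h (x + y)))"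
      by (simp add: integral_frac_fun_1_deriv[OF h])
    also have "\<dots> = - (LINT x|lborel. conv (frac_fun \<alpha>) (frac_fun 1) x * deriv h x)"
      using integral_conv_probe[OF frac_fun_causal[OF 1] frac_fun_causal pr, of 1] by simp
    finally show ?thesis using frac_fun_conv[OF 1, of 1] by (simp add: add.commute)
  next
    case 2
    then show ?thesis
      using integral_frac_fun_1_deriv[OF h, of 0] h
      by (simp add: frac_kernel_def dirac_def restrict_dist_apply)
  next
    case 3
    have "(\<lambda>t. heaviside t * t powr \<alpha>) \<in> borel_measurable borel" by measurable
    then have "frac_kernel \<alpha> h = - (1 / Gamma (1 + \<alpha>) * (LINT t|lborel. heaviside t * t powr \<alpha> * deriv h t))"
      using 3 assms h by (simp add: frac_kernel_def dist_deriv_apply fun_dist_apply h')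
    also have "1 / Gamma (1 + \<alpha>) * (LINT t|lborel. heaviside t * t powr \<alpha> * deriv h t) =
        (LINT t|lborel. 1 / Gamma (1 + \<alpha>) * (heaviside t * t powr \<alpha> * deriv h t))"
      by simp
    also have "\<dots> = (LINT x|lborel. frac_fun (1 + \<alpha>) x * deriv h x)"
      by (simp add: frac_fun_def field_simps)
    finally show ?thesis .
  qed
qed

text \<open>\<open>g\<^sub>\<alpha> * F\<close> is the distributional derivative of \<open>frac_prim \<alpha> F = g\<^sub>1\<^sub>+\<^sub>\<alpha> * F\<close>, where \<open>g\<^sub>0 = \<delta>\<close>.\<close>

definition frac_prim :: "real \<Rightarrow> (real \<Rightarrow> real) \<Rightarrow> real \<Rightarrow> real" where
  "frac_prim \<alpha> F = (if \<alpha> = -1 then F else conv (frac_fun (1 + \<alpha>)) F)"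

lemma frac_prim_causal: "\<alpha> \<ge> -1 \<Longrightarrow> F \<in> causal T \<Longrightarrow> frac_prim \<alpha> F \<in> causal T"
  by (auto simp: frac_prim_def intro!: conv_causal frac_fun_causal)

text \<open>For \<alpha> > -1 the kernel integrates \<open>deriv h\<close> against g_(1+\<alpha>),
  which vanishes for x < 0, and for x >= 0 the cutoff has no influence on \<open>deriv h\<close>.
  What remains is the right-hand side of \<open>integral_conv_probe\<close>. For \<alpha> = -1 the
  kernel evaluates -h' at 0 instead.\<close>

lemma frac_convolution_apply:
  assumes "0 < T" and F: "F \<in> causal T" and \<alpha>: "\<alpha> \<ge> -1" and j: "j \<le> 1"
    and e: "e \<in> test_functions (below T)" and R: "ereal R < T" and p: "p \<in> test_functions {..<R}"
    and U: "open U" "dist_support (below T) (deriv_fun_dist T j F) \<inter> {..R} \<subseteq> U" "\<And>x. x \<in> U \<Longrightarrow> e x = 1"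
  shows "convolution_dist (frac_kernel \<alpha>) (cutoff_dist e (deriv_fun_dist T j F)) p =
    deriv_fun_dist T (Suc j) (frac_prim \<alpha> F) p"
proof -
  define h where "h x = deriv_fun_dist T j F (\<lambda>y. e y * p (x + y))" for x
  have pU: "p \<in> test_functions UNIV" by (rule test_functions_UNIV[OF p])
  have pT: "p \<in> test_functions (below T)" by (rule test_functions_lessThan_below[OF R p])
  have p': "deriv p \<in> test_functions {..<R}" by (rule test_functions_deriv[OF p])
  have h: "h \<in> test_functions UNIV"
    unfolding h_def by (rule cutoff_corr(1)[OF assms(1) F e pU j])
  have h': "deriv h x = (-1) ^ j * (LINT y|lborel. F y * (deriv ^^ Suc j) p (x + y))" if "x \<ge> 0" for x
  proof -
    have "deriv h x = deriv_fun_dist T j F (\<lambda>y. e y * deriv p (x + y))"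
      unfolding h_def by (rule DERIV_imp_deriv[OF cutoff_corr(2)[OF assms(1) F e pU j]])
    then show ?thesis
      using cutoff_corr_value[OF assms(1) F e R p' that U]
      by (simp add: funpow_Suc_right del: funpow.simps)
  qed
  have "convolution_dist (frac_kernel \<alpha>) (cutoff_dist e (deriv_fun_dist T j F)) p = frac_kernel \<alpha> h"
    using pU test_functions_translate[OF pU]
    by (simp add: convolution_dist_def cutoff_dist_def restrict_dist_apply h_def[abs_def])
  also have "\<dots> = (-1) ^ Suc j * (LINT t|lborel. frac_prim \<alpha> F t * (deriv ^^ Suc j) p t)"
  proof (cases "\<alpha> = -1")
    case True
    then have "frac_kernel \<alpha> h = - deriv h 0"
      using h test_functions_deriv[OF h]
      by (simp add: frac_kernel_def dist_deriv_apply dirac_def restrict_dist_apply)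
    then show ?thesis using h'[of 0] True by (simp add: frac_prim_def)
  next
    case False
    then have \<alpha>: "\<alpha> > -1" using \<alpha> by simp
    have q: "(deriv ^^ Suc j) p \<in> probes T"
      by (rule test_function_probes[OF assms(1) test_functions_deriv_power[OF pT]])
    have "frac_kernel \<alpha> h = - (LINT x|lborel. frac_fun (1 + \<alpha>) x * deriv h x)"
      by (rule frac_kernel_apply[OF \<alpha> h])
    also have "(\<lambda>x. frac_fun (1 + \<alpha>) x * deriv h x) =
        (\<lambda>x. (-1) ^ j * (frac_fun (1 + \<alpha>) x * (LINT y|lborel. F y * (deriv ^^ Suc j) p (x + y))))"
    proof
      show "frac_fun (1 + \<alpha>) x * deriv h x =
          (-1) ^ j * (frac_fun (1 + \<alpha>) x * (LINT y|lborel. F y * (deriv ^^ Suc j) p (x + y)))" for x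
        by (cases "x \<ge> 0") (simp_all add: h' frac_fun_def heaviside_def del: funpow.simps)
    qed
    also have "- (LINT x|lborel. (-1) ^ j * (frac_fun (1 + \<alpha>) x * (LINT y|lborel. F y * (deriv ^^ Suc j) p (x + y)))) =
        (-1) ^ Suc j * (LINT x|lborel. frac_fun (1 + \<alpha>) x * (LINT y|lborel. F y * (deriv ^^ Suc j) p (x + y)))"
      by simp
    also have "\<dots> = (-1) ^ Suc j * (LINT t|lborel. conv (frac_fun (1 + \<alpha>)) F t * (deriv ^^ Suc j) p t)"
      using integral_conv_probe[OF frac_fun_causal F q] \<alpha> by simp
    finally show ?thesis using False by (simp add: frac_prim_def del: funpow.simps)
  qed
  also have "\<dots> = deriv_fun_dist T (Suc j) (frac_prim \<alpha> F) p"
    by (rule deriv_fun_dist_apply[OF frac_prim_causal[OF \<alpha> F] pT, symmetric])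
  finally show ?thesis .
qed

text \<open>Existence is \<open>frac_convolution_apply\<close> for every admissible cutoff.
  Uniqueness: each test function lives below some R < T, and the cutoff of \<open>ex_cutoff\<close>
  is admissible there because the support of \<open>deriv_fun_dist T j F\<close> contains no
  negative point.\<close>

lemma frac_J_deriv_fun_dist:
  assumes "0 < T" and F: "F \<in> causal T" and \<alpha>: "\<alpha> \<ge> -1" and j: "j \<le> 1"
  shows "frac_J T \<alpha> (deriv_fun_dist T j F) = deriv_fun_dist T (Suc j) (frac_prim \<alpha> F)"
  unfolding frac_J_def
proof (rule the_equality)
  define v where "v = deriv_fun_dist T j F"
  let ?w = "deriv_fun_dist T (Suc j) (frac_prim \<alpha> F)"
  let ?c = "\<lambda>e. convolution_dist (frac_kernel \<alpha>) (cutoff_dist e v)"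
  have w_eq: "restrict_dist {..<R} ?w = restrict_dist {..<R} (?c e)"
    if "e \<in> test_functions (below T)" "ereal R < T"
      "\<exists>U. open U \<and> dist_support (below T) v \<inter> {..R} \<subseteq> U \<and> (\<forall>x\<in>U. e x = 1)" for e R
    using that frac_convolution_apply[OF assms that(1,2)]
    by (auto simp: restrict_dist_def v_def fun_eq_iff)
  show "?w \<in> E_space T \<and> (\<forall>R. \<forall>e\<in>test_functions (below T). ereal R < T \<longrightarrow>
      (\<exists>U. open U \<and> dist_support (below T) (deriv_fun_dist T j F) \<inter> {..R} \<subseteq> U \<and> (\<forall>x\<in>U. e x = 1)) \<longrightarrow>
      restrict_dist {..<R} ?w =
      restrict_dist {..<R} (convolution_dist (frac_kernel \<alpha>) (cutoff_dist e (deriv_fun_dist T j F))))"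
    using deriv_fun_dist_E_space[OF assms(1) frac_prim_causal[OF \<alpha> F]] w_eq unfolding v_def by blast
  fix w
  assume *: "w \<in> E_space T \<and> (\<forall>R. \<forall>e\<in>test_functions (below T). ereal R < T \<longrightarrow>
      (\<exists>U. open U \<and> dist_support (below T) (deriv_fun_dist T j F) \<inter> {..R} \<subseteq> U \<and> (\<forall>x\<in>U. e x = 1)) \<longrightarrow>
      restrict_dist {..<R} w =
      restrict_dist {..<R} (convolution_dist (frac_kernel \<alpha>) (cutoff_dist e (deriv_fun_dist T j F))))"
  have wE: "w \<in> E_space T" using * by blast
  have w: "restrict_dist {..<R} w = restrict_dist {..<R} (?c e)"
    if "e \<in> test_functions (below T)" "ereal R < T"
      "\<exists>U. open U \<and> dist_support (below T) v \<inter> {..R} \<subseteq> U \<and> (\<forall>x\<in>U. e x = 1)" for e R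
    using * that unfolding v_def by blast
  show "w = ?w"
  proof
    fix p
    show "w p = ?w p"
    proof (cases "p \<in> test_functions (below T)")
      case True
      then obtain R where R: "ereal R < T" "p \<in> test_functions {..<R}"
        using test_function_below[OF assms(1)] by blast
      obtain e U where e: "e \<in> test_functions (below T)" "open U" "{0..R} \<subseteq> U" "\<And>x. x \<in> U \<Longrightarrow> e x = 1"
        using ex_cutoff[OF R(1)] by blast
      have "dist_support (below T) v \<inter> {..R} \<subseteq> U"
        using deriv_fun_dist_support[OF assms(1) F, of j] e(3) by (force simp: v_def)
      with e have "\<exists>U. open U \<and> dist_support (below T) v \<inter> {..R} \<subseteq> U \<and> (\<forall>x\<in>U. e x = 1)"
        by blast
      from w[OF e(1) R(1) this] w_eq[OF e(1) R(1) this]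
      have "restrict_dist {..<R} w = restrict_dist {..<R} ?w" by simp
      then show ?thesis
        using restrict_dist_apply[OF R(2), of w] restrict_dist_apply[OF R(2), of ?w] by simp
    next
      case False
      then have "w p = 0" using wE by (auto simp: E_space_def distributions_def)
      with False show ?thesis by (simp add: deriv_fun_dist_outside)
    qed
  qed
qed


section \<open>Initial values\<close>

text \<open>A function in \<open>L1loc\<close> is only Lebesgue measurable on [0,T), and arbitrary
  elsewhere. \<open>F\<close> is a Borel version, zero on the negative axis, that is fit for
  Fubini's theorem.\<close>

definition represents :: "ereal \<Rightarrow> (real \<Rightarrow> real) \<Rightarrow> (real \<Rightarrow> real) \<Rightarrow> bool" where
  "represents T \<phi> F \<longleftrightarrow> F \<in> causal T \<and> (AE t in lebesgue. 0 \<le> t \<longrightarrow> ereal t < T \<longrightarrow> F t = \<phi> t)"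

lemma representsD:
  assumes "represents T \<phi> F"
  shows "F \<in> causal T" "AE t in lebesgue. 0 \<le> t \<longrightarrow> ereal t < T \<longrightarrow> F t = \<phi> t"
  using assms by (auto simp: represents_def)

text \<open>Completeness of Lebesgue measure transfers measurability from \<open>g\<close> to
  \<open>f\<close>, after which the integrals of \<open>g\<close> for the completed and the Borel
  measure coincide.\<close>

lemma integral_lebesgue_AE_borel:
  fixes f g :: "real \<Rightarrow> real"
  assumes g: "g \<in> borel_measurable borel" and ae: "AE x in lebesgue. g x = f x"
  shows "integral\<^sup>L lebesgue f = integral\<^sup>L lborel g"
    and "integrable lebesgue f \<longleftrightarrow> integrable lborel g"
proof -
  have [measurable]: "g \<in> borel_measurable lebesgue"
    using g by (intro measurable_completion) simp
  have [measurable]: "f \<in> borel_measurable lebesgue"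
    by (rule borel_measurable_AE[OF _ ae]) measurable
  have "integral\<^sup>L lebesgue f = integral\<^sup>L lebesgue g"
    by (rule integral_cong_AE) (use ae in auto)
  then show "integral\<^sup>L lebesgue f = integral\<^sup>L lborel g"
    using g by (simp add: integral_completion)
  have "integrable lebesgue f \<longleftrightarrow> integrable lebesgue g"
    by (rule integrable_cong_AE) (use ae in auto)
  then show "integrable lebesgue f \<longleftrightarrow> integrable lborel g"
    using g by (simp add: integrable_completion)
qed

lemma L1loc_Icc:
  assumes "f \<in> L1loc T" "ereal R < T" shows "set_integrable lebesgue {0..R} f"
proof -
  have "ereal x < T" if "x \<le> R" for x
    using that assms(2) by (meson ereal_less_eq(3) order_le_less_trans)
  then have "compact {0..R} \<and> {0..R} \<subseteq> {0..} \<inter> below T" by (auto simp: below_def)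
  then show ?thesis using assms(1) unfolding L1loc_def by blast
qed

lemma L1locI:
  assumes "\<And>R. ereal R < T \<Longrightarrow> set_integrable lebesgue {0..R} f" shows "f \<in> L1loc T"
  unfolding L1loc_def
proof (intro CollectI allI impI)
  fix K assume K: "compact K \<and> K \<subseteq> {0..} \<inter> below T"
  show "set_integrable lebesgue K f"
  proof (cases "K = {}")
    case False
    then obtain m where m: "m \<in> K" "\<And>x. x \<in> K \<Longrightarrow> x \<le> m"
      using K compact_attains_sup[of K] by blast
    then have "ereal m < T" "K \<subseteq> {0..m}" using K by (auto simp: below_def)
    moreover have "K \<in> sets lebesgue" using K by (simp add: compact_imp_closed)
    ultimately show ?thesis using assms set_integrable_subset by blast
  qed (simp add: set_integrable_def)
qed

text \<open>The truncations of \<phi> to [0,X i], with X i tending to T, are integrable, so their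
  pointwise limit, the extension of \<phi> by zero, is measurable and has a Borel version.\<close>

lemma ex_represents:
  assumes "0 < T" "\<phi> \<in> L1loc T" obtains F where "represents T \<phi> F"
proof -
  obtain X :: "nat \<Rightarrow> real" where X: "\<And>i. 0 < ereal (X i)" "\<And>i. ereal (X i) < T" "(\<lambda>i. ereal (X i)) \<longlonglongrightarrow> T"
    using ereal_incseq_approx[OF assms(1)] by metis
  define \<phi>0 where "\<phi>0 t = (if 0 \<le> t \<and> ereal t < T then \<phi> t else 0)" for t
  have "\<phi>0 \<in> borel_measurable lebesgue"
  proof (rule borel_measurable_LIMSEQ_real)
    show "(\<lambda>t. indicator {0..X i} t * \<phi> t) \<in> borel_measurable lebesgue" for i
      using L1loc_Icc[OF assms(2) X(2)[of i]]
      by (auto simp: set_integrable_def dest: borel_measurable_integrable)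
    show "(\<lambda>i. indicator {0..X i} t * \<phi> t) \<longlonglongrightarrow> \<phi>0 t" if "t \<in> space lebesgue" for t
    proof (cases "0 \<le> t \<and> ereal t < T")
      case True
      then have "eventually (\<lambda>i. ereal t < ereal (X i)) sequentially"
        using order_tendstoD(1)[OF X(3)] by blast
      then have "eventually (\<lambda>i. indicator {0..X i} t * \<phi> t = \<phi>0 t) sequentially"
        by eventually_elim (use True in \<open>auto simp: \<phi>0_def\<close>)
      then show ?thesis by (rule tendsto_eventually)
    next
      case False
      have "indicator {0..X i} t * \<phi> t = \<phi>0 t" for i
        using False X(2)[of i] order_le_less_trans[of "ereal t" "ereal (X i)" T]
        by (auto simp: \<phi>0_def indicator_def)
      then show ?thesis by simp
    qed
  qed
  then obtain F0 where F0 [measurable]: "F0 \<in> borel_measurable lborel" and ae: "AE t in lborel. \<phi>0 t = F0 t"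
    using completion_ex_borel_measurable_real by blast
  \<comment> \<open>The Borel version may be nonzero on a null set of negative reals, while
    \<open>causal\<close> demands exact zeros there.\<close>
  define F where "F t = indicator {0..} t * F0 t" for t
  have F [measurable]: "F \<in> borel_measurable borel" unfolding F_def using F0 by simp
  from AE_completion[OF ae] have ae': "AE t in lebesgue. F t = \<phi>0 t"
    by eventually_elim (auto simp: F_def \<phi>0_def indicator_def)
  have "integrable lborel (\<lambda>t. indicator {..R} t * F t)" if R: "ereal R < T" for R
  proof -
    from ae' have "AE t in lebesgue. indicator {..R} t * F t = indicator {0..R} t *\<^sub>R \<phi> t"
    proof eventually_elim
      case (elim t)
      have "ereal t < T" if "t \<le> R" using that R by (meson ereal_less_eq(3) order_le_less_trans)
      with elim show ?case by (auto simp: \<phi>0_def indicator_def)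
    qed
    then show ?thesis
      using integral_lebesgue_AE_borel(2)[of "\<lambda>t. indicator {..R} t * F t"] L1loc_Icc[OF assms(2) R]
      by (simp add: set_integrable_def)
  qed
  then have "F \<in> causal T" by (auto simp: causal_def F_def[of "_::real"])
  moreover from ae' have "AE t in lebesgue. 0 \<le> t \<longrightarrow> ereal t < T \<longrightarrow> F t = \<phi> t"
    by eventually_elim (auto simp: \<phi>0_def)
  ultimately show ?thesis using that by (auto simp: represents_def)
qed

lemma emb_represents:
  assumes "represents T \<phi> F" shows "emb T \<phi> = fun_dist (below T) F"
proof
  fix p
  note F = representsD(1)[OF assms]
  show "emb T \<phi> p = fun_dist (below T) F p"
  proof (cases "p \<in> test_functions (below T)")
    case True
    from representsD(2)[OF assms]
    have "AE t in lebesgue. F t * p t = heaviside t * \<phi> t * p t"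
    proof eventually_elim
      case (elim t)
      have "p t = 0" if "\<not> ereal t < T"
        by (rule zero_outside_fun_support[of t p])
          (use that test_functionsD(3)[OF True] in \<open>auto simp: below_def\<close>)
      then show ?case using elim causalD(2)[OF F, of t] by (auto simp: heaviside_def)
    qed
    then have "(LINT t|lebesgue. heaviside t * \<phi> t * p t) = (LINT t|lborel. F t * p t)"
      using causalD(1)[OF F] test_function_borel[OF True]
      by (intro integral_lebesgue_AE_borel(1)) auto
    then show ?thesis
      using True causalD(1)[OF F] fun_dist_apply[OF causalD(1)[OF F] True]
      by (simp add: emb_def fun_dist_def restrict_dist_def)
  qed (simp add: emb_def fun_dist_def restrict_dist_outside)
qed

lemma represents_causal: "F \<in> causal T \<Longrightarrow> represents T F F"
  by (simp add: represents_def)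

lemma causal_L1loc:
  assumes F: "F \<in> causal T" shows "F \<in> L1loc T"
proof (rule L1locI)
  fix R assume R: "ereal R < T"
  have "(\<lambda>t. indicator {..R} t * F t) = (\<lambda>t. indicator {0..R} t *\<^sub>R F t)"
    using causalD(2)[OF F] by (force simp: indicator_def)
  then show "set_integrable lebesgue {0..R} F"
    using causalD(3)[OF F R] causalD(1)[OF F]
    unfolding set_integrable_def by (subst integrable_completion) auto
qed

lemma represents_lincomb:
  assumes "represents T \<phi> F" "represents T \<psi> G"
  shows "represents T (\<lambda>t. a * \<phi> t + b * \<psi> t) (\<lambda>t. a * F t + b * G t)"
proof -
  from representsD(2)[OF assms(1)] representsD(2)[OF assms(2)]
  have "AE t in lebesgue. 0 \<le> t \<longrightarrow> ereal t < T \<longrightarrow> a * F t + b * G t = a * \<phi> t + b * \<psi> t"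
    by eventually_elim simp
  then show ?thesis
    using causal_lincomb[OF representsD(1)[OF assms(1)] representsD(1)[OF assms(2)]]
    by (simp add: represents_def)
qed

lemma represents_const: "represents T (\<lambda>t. c) (\<lambda>t. c * heaviside t)"
  using causal_lincomb[OF heaviside_causal heaviside_causal, of c 0]
  by (simp add: represents_def heaviside_def)

lemma L1loc_represents:
  assumes "represents T \<phi> F" shows "\<phi> \<in> L1loc T"
proof (rule L1locI)
  fix R assume R: "ereal R < T"
  note F = representsD(1)[OF assms]
  from representsD(2)[OF assms] have "AE t in lebesgue. indicator {..R} t * F t = indicator {0..R} t *\<^sub>R \<phi> t"
  proof eventually_elim
    case (elim t)
    have "ereal t < T" if "t \<le> R" using that R by (meson ereal_less_eq(3) order_le_less_trans)
    with elim show ?case using causalD(2)[OF F, of t] by (auto simp: indicator_def)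
  qed
  then show "set_integrable lebesgue {0..R} \<phi>"
    using integral_lebesgue_AE_borel(2)[of "\<lambda>t. indicator {..R} t * F t"] causalD(1,3)[OF F] R
    by (simp add: set_integrable_def)
qed

lemma eventually_at_right_below:
  assumes "0 < T" shows "eventually (\<lambda>t. 0 < t \<and> ereal t < T) (at_right 0)"
proof -
  obtain R where R: "0 < ereal R" "ereal R < T" using ereal_dense2[OF assms] by blast
  then have "ereal t < T" if "t < R" for t
    using that by (meson ereal_less_eq(3) less_imp_le order_le_less_trans)
  then show ?thesis
    using R(1) unfolding eventually_at_right_field by (intro exI[of _ R]) auto
qed

lemma integral_abs_diff_represents:
  assumes "represents T \<phi> F" "ereal t < T"
  shows "(LINT s:{0..t}|lebesgue. \<bar>\<phi> s - c\<bar>) = (LINT s|lborel. indicator {0..t} s * \<bar>F s - c\<bar>)"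
proof -
  from representsD(2)[OF assms(1)]
  have "AE s in lebesgue. indicator {0..t} s * \<bar>F s - c\<bar> = indicator {0..t} s *\<^sub>R \<bar>\<phi> s - c\<bar>"
  proof eventually_elim
    case (elim s)
    have "ereal s < T" if "s \<le> t" using that assms(2) by (meson ereal_less_eq(3) order_le_less_trans)
    with elim show ?case by (auto simp: indicator_def)
  qed
  then show ?thesis
    unfolding set_lebesgue_integral_def using causalD(1)[OF representsD(1)[OF assms(1)]]
    by (intro integral_lebesgue_AE_borel(1)) auto
qed

lemma has_initial_value_represents:
  assumes "0 < T" "represents T \<phi> F"
  shows "has_initial_value \<phi> c \<longleftrightarrow>
    ((\<lambda>t. 1 / t * (LINT s|lborel. indicator {0..t} s * \<bar>F s - c\<bar>)) \<longlongrightarrow> 0) (at_right 0)"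
  unfolding has_initial_value_def
  by (rule tendsto_cong, rule eventually_mono[OF eventually_at_right_below[OF assms(1)]])
    (use integral_abs_diff_represents[OF assms(2)] in auto)

lemma integrable_Icc_causal:
  assumes F: "F \<in> causal T" and t: "ereal t < T"
  shows "integrable lborel (\<lambda>s. indicator {0..t} s * (F s - c))"
proof -
  have "indicator {..t} s * F s - c * indicator {0..t} s = indicator {0..t} s * (F s - c)" for s
    using causalD(2)[OF F, of s] by (auto simp: indicator_def)
  moreover have "integrable lborel (\<lambda>s. indicator {..t} s * F s - c * indicator {0..t} s)"
    by (intro Bochner_Integration.integrable_diff integrable_mult_right causalD(3)[OF F t])
      (simp add: integrable_indicator_iff emeasure_lborel_Icc_eq)
  ultimately show ?thesis by simp
qed

text \<open>The mean of F - c is bounded by the mean of |F - c|. Unlike the defining limit, this one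
  is linear in \<open>F\<close> and can be recovered by testing the distribution.\<close>

lemma has_initial_value_average:
  assumes "0 < T" "represents T \<phi> F" "has_initial_value \<phi> c"
  shows "((\<lambda>t. 1 / t * (LINT s|lborel. indicator {0..t} s * F s)) \<longlongrightarrow> c) (at_right 0)"
proof -
  note F = representsD(1)[OF assms(2)]
  have "((\<lambda>t. 1 / t * (LINT s|lborel. indicator {0..t} s * F s) - c) \<longlongrightarrow> 0) (at_right 0)"
  proof (rule Lim_null_comparison)
    show "((\<lambda>t. 1 / t * (LINT s|lborel. indicator {0..t} s * \<bar>F s - c\<bar>)) \<longlongrightarrow> 0) (at_right 0)"
      using assms has_initial_value_represents by blast
    show "eventually (\<lambda>t. norm (1 / t * (LINT s|lborel. indicator {0..t} s * F s) - c) \<le>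
        1 / t * (LINT s|lborel. indicator {0..t} s * \<bar>F s - c\<bar>)) (at_right 0)"
      using eventually_at_right_below[OF assms(1)]
    proof eventually_elim
      case (elim t)
      have "(LINT s|lborel. indicator {0..t} s * (F s - c)) =
          (LINT s|lborel. indicator {0..t} s * (F s - 0) - c * indicator {0..t} s)"
        by (simp add: algebra_simps)
      also have "\<dots> = (LINT s|lborel. indicator {0..t} s * (F s - 0)) - c * t"
        using elim integrable_Icc_causal[OF F, of t 0]
        by (subst Bochner_Integration.integral_diff)
          (auto simp: integrable_indicator_iff emeasure_lborel_Icc_eq)
      finally have eq: "(LINT s|lborel. indicator {0..t} s * F s) - c * t =
          (LINT s|lborel. indicator {0..t} s * (F s - c))" by simp
      have "\<bar>LINT s|lborel. indicator {0..t} s * (F s - c)\<bar> \<le>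
          (LINT s|lborel. \<bar>indicator {0..t} s * (F s - c)\<bar>)"
        by (rule integral_abs_bound)
      also have "\<dots> = (LINT s|lborel. indicator {0..t} s * \<bar>F s - c\<bar>)"
        by (simp add: abs_mult)
      finally have "\<bar>(LINT s|lborel. indicator {0..t} s * F s) - c * t\<bar> \<le>
          (LINT s|lborel. indicator {0..t} s * \<bar>F s - c\<bar>)" unfolding eq .
      moreover have "1 / t * (LINT s|lborel. indicator {0..t} s * F s) - c =
          1 / t * ((LINT s|lborel. indicator {0..t} s * F s) - c * t)"
        using elim by (simp add: field_simps)
      ultimately show ?case
        using elim by (simp add: abs_mult divide_right_mono)
    qed
  qed
  then show ?thesis by (simp add: LIM_zero_iff)
qed

lemma fun_dist_eq_imp_integral_eq:
  assumes "0 < T" and F: "F \<in> causal T" and G: "G \<in> causal T"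
    and eq: "fun_dist (below T) F = fun_dist (below T) G" and t: "ereal t < T"
  shows "(LINT s|lborel. indicator {0..t} s * F s) = (LINT s|lborel. indicator {0..t} s * G s)"
proof -
  obtain s where s: "smooth s" "\<And>x. x \<le> 0 \<Longrightarrow> s x = 0" "\<And>x. x \<ge> 1 \<Longrightarrow> s x = 1"
      "\<And>x. 0 \<le> s x" "\<And>x. s x \<le> 1"
    using ex_smooth_step by blast
  \<comment> \<open>\<open>p n\<close> is 1 on [-1, t - 1/(n+1)] and 0 for x <= -2 and x >= t, with
    values in [0,1]. So it tends to 1 on [0,t), and |H| up to t dominates the products.\<close>
  define p where "p n x = s (2 + 1 * x) * s (real (Suc n) * t + (- real (Suc n)) * x)" for n x
  have p_right: "p n x = 0" if "x \<ge> t" for n x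
  proof -
    have "real (Suc n) * t + (- real (Suc n)) * x = real (Suc n) * (t - x)"
      by (simp add: algebra_simps)
    also have "\<dots> \<le> 0" using that by (intro mult_nonneg_nonpos) auto
    finally show ?thesis by (simp only: p_def s mult_zero_right)
  qed
  have p: "p n \<in> test_functions (below T)" for n
  proof (rule test_functionsI[of _ "{-2..t}"])
    show "smooth (p n)" unfolding p_def by (intro smooth_mult smooth_compose_affine s)
    show "{-2..t} \<subseteq> below T"
      using t by (auto simp: below_def intro: order_le_less_trans[of _ "ereal t"])
    show "p n x = 0" if "x \<notin> {-2..t}" for x
      using that p_right[of x n] s(2)[of "2 + x"] by (cases "x < -2") (auto simp: p_def)
  qed simp
  have lim: "(\<lambda>n. LINT x|lborel. H x * p n x) \<longlonglongrightarrow> (LINT x|lborel. indicator {0..t} x * H x)"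
    if H: "H \<in> causal T" for H
  proof (rule integral_dominated_convergence[where w = "\<lambda>x. \<bar>indicator {..t} x * H x\<bar>"])
    have [measurable]: "H \<in> borel_measurable borel" by (rule causalD(1)[OF H])
    show "(\<lambda>x. indicator {0..t} x * H x) \<in> borel_measurable lborel" by measurable
    show "(\<lambda>x. H x * p n x) \<in> borel_measurable lborel" for n
      using test_function_borel[OF p[of n]] by measurable
    show "integrable lborel (\<lambda>x. \<bar>indicator {..t} x * H x\<bar>)"
      by (intro integrable_abs causalD(3)[OF H t])
    show "AE x in lborel. norm (H x * p n x) \<le> \<bar>indicator {..t} x * H x\<bar>" for n
    proof (rule AE_I2)
      fix x
      have "\<bar>p n x\<bar> \<le> 1 * 1" unfolding p_def abs_mult using s(4,5) by (intro mult_mono) auto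
      then show "norm (H x * p n x) \<le> \<bar>indicator {..t} x * H x\<bar>"
        using p_right[of x n] mult_left_mono[of "\<bar>p n x\<bar>" 1 "\<bar>H x\<bar>"]
        by (cases "x \<le> t") (auto simp: abs_mult indicator_def)
    qed
    have "AE x in lborel. x \<noteq> t" by (rule AE_lborel_singleton)
    then show "AE x in lborel. (\<lambda>n. H x * p n x) \<longlonglongrightarrow> indicator {0..t} x * H x"
    proof eventually_elim
      case (elim x)
      consider "x < 0" | "0 \<le> x" "x < t" | "x > t" using elim by fastforce
      then show ?case
      proof cases
        case 1 then show ?thesis by (simp add: causalD(2)[OF H])
      next
        case 2
        obtain N where N: "1 / (t - x) < real N" using reals_Archimedean2 by blast
        have "p n x = 1" if "n \<ge> N" for n
        proof -
          have "1 / (t - x) \<le> real (Suc n)" using N that by (simp add: le_less_trans[of _ "real n"])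
          then have "1 \<le> real (Suc n) * (t - x)" using 2 by (simp add: pos_divide_le_eq)
          then have "1 \<le> real (Suc n) * t + (- real (Suc n)) * x" by (simp add: algebra_simps)
          moreover have "1 \<le> 2 + 1 * x" using 2 by simp
          ultimately show ?thesis by (simp only: p_def s mult_1)
        qed
        then have "eventually (\<lambda>n. H x * p n x = indicator {0..t} x * H x) sequentially"
          using 2 unfolding eventually_sequentially by (intro exI[of _ N]) auto
        then show ?thesis by (rule tendsto_eventually)
      next
        case 3 then show ?thesis by (simp add: p_right)
      qed
    qed
  qed
  have "(LINT x|lborel. F x * p n x) = (LINT x|lborel. G x * p n x)" for n
    using fun_dist_apply[OF causalD(1)[OF F] p[of n]] fun_dist_apply[OF causalD(1)[OF G] p[of n]] eq
    by simp
  then show ?thesis using lim[OF F] lim[OF G] LIMSEQ_unique by auto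
qed

text \<open>Two functions with the same embedding are compared, since the description in
  \<open>initial_value\<close> ranges over all representatives of a distribution. Their means over
  [0,t] agree, hence also the limits.\<close>

lemma has_initial_value_unique:
  assumes "0 < T" "f \<in> L1loc T" "g \<in> L1loc T" "emb T f = emb T g"
    "has_initial_value f c" "has_initial_value g d"
  shows "c = d"
proof -
  obtain F where F: "represents T f F" using ex_represents[OF assms(1,2)] .
  obtain G where G: "represents T g G" using ex_represents[OF assms(1,3)] .
  have "fun_dist (below T) F = fun_dist (below T) G"
    using assms(4) emb_represents[OF F] emb_represents[OF G] by simp
  then have "(LINT s|lborel. indicator {0..t} s * F s) = (LINT s|lborel. indicator {0..t} s * G s)"
    if "ereal t < T" for t
    using that by (intro fun_dist_eq_imp_integral_eq[OF assms(1)] representsD(1)[OF F] representsD(1)[OF G])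
  then have "eventually (\<lambda>t. 1 / t * (LINT s|lborel. indicator {0..t} s * F s) =
      1 / t * (LINT s|lborel. indicator {0..t} s * G s)) (at_right 0)"
    by (intro eventually_mono[OF eventually_at_right_below[OF assms(1)]]) auto
  from tendsto_cong[OF this] has_initial_value_average[OF assms(1) F assms(5)]
  have "((\<lambda>t. 1 / t * (LINT s|lborel. indicator {0..t} s * G s)) \<longlongrightarrow> c) (at_right 0)" by blast
  then show ?thesis
    using has_initial_value_average[OF assms(1) G assms(6)]
    by (rule tendsto_unique[OF trivial_limit_at_right_real])
qed

lemma initial_value_emb:
  assumes "0 < T" "\<phi> \<in> L1loc T" "has_initial_value \<phi> c"
  shows "initial_value T (emb T \<phi>) = c"
  unfolding initial_value_def
proof (rule the_equality)
  show "\<exists>f\<in>X_space T. emb T \<phi> = emb T f \<and> has_initial_value f c"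
    using assms by (auto simp: X_space_def)
  show "d = c" if "\<exists>f\<in>X_space T. emb T \<phi> = emb T f \<and> has_initial_value f d" for d
    using that assms has_initial_value_unique[OF assms(1)] by (fastforce simp: X_space_def)
qed

lemma has_initial_value_lincomb:
  assumes "0 < T" "\<phi> \<in> L1loc T" "\<psi> \<in> L1loc T" "has_initial_value \<phi> c" "has_initial_value \<psi> d"
  shows "has_initial_value (\<lambda>t. a * \<phi> t + b * \<psi> t) (a * c + b * d)"
proof -
  obtain F where F: "represents T \<phi> F" using ex_represents[OF assms(1,2)] .
  obtain G where G: "represents T \<psi> G" using ex_represents[OF assms(1,3)] .
  define m where "m F c t = 1 / t * (LINT s|lborel. indicator {0..t} s * \<bar>F s - c\<bar>)" for F c and t :: real
  note iff = has_initial_value_represents[OF assms(1), folded m_def]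
  have "((\<lambda>t. \<bar>a\<bar> * m F c t + \<bar>b\<bar> * m G d t) \<longlongrightarrow> \<bar>a\<bar> * 0 + \<bar>b\<bar> * 0) (at_right 0)"
    using assms iff[OF F] iff[OF G] by (intro tendsto_intros) auto
  then have lim: "((\<lambda>t. \<bar>a\<bar> * m F c t + \<bar>b\<bar> * m G d t) \<longlongrightarrow> 0) (at_right 0)" by simp
  have "(m (\<lambda>t. a * F t + b * G t) (a * c + b * d) \<longlongrightarrow> 0) (at_right 0)"
  proof (rule Lim_null_comparison[OF _ lim])
    show "eventually (\<lambda>t. norm (m (\<lambda>t. a * F t + b * G t) (a * c + b * d) t) \<le>
        \<bar>a\<bar> * m F c t + \<bar>b\<bar> * m G d t) (at_right 0)"
      using eventually_at_right_below[OF assms(1)]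
    proof eventually_elim
      case (elim t)
      have int: "integrable lborel (\<lambda>s. indicator {0..t} s * \<bar>H s - c\<bar>)" if "H \<in> causal T" for H c
        using integrable_abs[OF integrable_Icc_causal[OF that, of t c]] elim by (simp add: abs_mult)
      note FG = representsD(1)[OF F] representsD(1)[OF G]
      have "(LINT s|lborel. indicator {0..t} s * \<bar>a * F s + b * G s - (a * c + b * d)\<bar>) \<le>
          (LINT s|lborel. \<bar>a\<bar> * (indicator {0..t} s * \<bar>F s - c\<bar>) + \<bar>b\<bar> * (indicator {0..t} s * \<bar>G s - d\<bar>))"
      proof (rule integral_mono)
        show "indicator {0..t} s * \<bar>a * F s + b * G s - (a * c + b * d)\<bar> \<le>
            \<bar>a\<bar> * (indicator {0..t} s * \<bar>F s - c\<bar>) + \<bar>b\<bar> * (indicator {0..t} s * \<bar>G s - d\<bar>)" for s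
        proof -
          have "a * F s + b * G s - (a * c + b * d) = a * (F s - c) + b * (G s - d)"
            by (simp add: algebra_simps)
          then have "\<bar>a * F s + b * G s - (a * c + b * d)\<bar> \<le> \<bar>a\<bar> * \<bar>F s - c\<bar> + \<bar>b\<bar> * \<bar>G s - d\<bar>"
            using abs_triangle_ineq[of "a * (F s - c)" "b * (G s - d)"] by (simp add: abs_mult)
          then show ?thesis by (simp add: indicator_def)
        qed
      qed (intro Bochner_Integration.integrable_add integrable_mult_right int FG causal_lincomb)+
      also have "\<dots> = \<bar>a\<bar> * (LINT s|lborel. indicator {0..t} s * \<bar>F s - c\<bar>) +
          \<bar>b\<bar> * (LINT s|lborel. indicator {0..t} s * \<bar>G s - d\<bar>)"
        using int[OF FG(1), of c] int[OF FG(2), of d] by simp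
      finally have "1 / t * (LINT s|lborel. indicator {0..t} s * \<bar>a * F s + b * G s - (a * c + b * d)\<bar>) \<le>
          1 / t * (\<bar>a\<bar> * (LINT s|lborel. indicator {0..t} s * \<bar>F s - c\<bar>) +
          \<bar>b\<bar> * (LINT s|lborel. indicator {0..t} s * \<bar>G s - d\<bar>))"
        using elim by (intro mult_left_mono) auto
      moreover have "0 \<le> m (\<lambda>t. a * F t + b * G t) (a * c + b * d) t"
        unfolding m_def using elim by (intro mult_nonneg_nonneg integral_nonneg_AE AE_I2) auto
      ultimately show ?case by (simp add: m_def algebra_simps)
    qed
  qed
  then show ?thesis using iff[OF represents_lincomb[OF F G]] by simp
qed

lemma L1loc_lincomb:
  assumes "0 < T" "\<phi> \<in> L1loc T" "\<psi> \<in> L1loc T" shows "(\<lambda>t. a * \<phi> t + b * \<psi> t) \<in> L1loc T"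
  by (metis assms ex_represents represents_lincomb L1loc_represents)

lemma has_initial_value_const: "has_initial_value (\<lambda>t. c) c"
  by (simp add: has_initial_value_def set_lebesgue_integral_def)


section \<open>The Caputo derivative\<close>

lemma X_spaceE:
  assumes "0 < T" "\<phi> \<in> X_space T"
  obtains F c where "represents T \<phi> F" "has_initial_value \<phi> c" "\<phi> \<in> L1loc T"
    "initial_value T (emb T \<phi>) = c" "emb T \<phi> = fun_dist (below T) F"
proof -
  obtain c where c: "\<phi> \<in> L1loc T" "has_initial_value \<phi> c" using assms(2) by (auto simp: X_space_def)
  obtain F where F: "represents T \<phi> F" using ex_represents[OF assms(1) c(1)] .
  show ?thesis
    using that[OF F c(2,1) initial_value_emb[OF assms(1) c] emb_represents[OF F]] .
qed

lemma restrict_frac_kernel: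
  assumes "\<alpha> > 0"
  shows "restrict_dist (below T) (frac_kernel \<alpha>) = fun_dist (below T) (frac_fun \<alpha>)"
proof
  fix p show "restrict_dist (below T) (frac_kernel \<alpha>) p = fun_dist (below T) (frac_fun \<alpha>) p"
    using assms test_functions_UNIV[of p "below T"]
    by (simp add: frac_kernel_def fun_dist_def restrict_dist_def frac_fun_def)
qed

lemma deriv_fun_dist_1: "deriv_fun_dist T 1 F = dist_deriv (below T) (fun_dist (below T) F)"
  and deriv_fun_dist_2:
    "deriv_fun_dist T 2 F = dist_deriv (below T) (dist_deriv (below T) (fun_dist (below T) F))"
  by (simp_all add: deriv_fun_dist_def numeral_2_eq_2)

lemma dist_deriv_lincomb:
  assumes "\<And>p. u p = a * v p + b * w p"
  shows "dist_deriv S u p = a * dist_deriv S v p + b * dist_deriv S w p"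
  using assms by (simp add: dist_deriv_def restrict_dist_def)

lemma frac_J_fun_dist:
  assumes "0 < T" "F \<in> causal T" "\<alpha> > -1"
  shows "frac_J T \<alpha> (fun_dist (below T) F) = deriv_fun_dist T 1 (conv (frac_fun (1 + \<alpha>)) F)"
  using frac_J_deriv_fun_dist[of T F \<alpha> 0] assms by (simp add: frac_prim_def)

lemma frac_J_minus_one:
  assumes "0 < T" "F \<in> causal T"
  shows "frac_J T (-1) (fun_dist (below T) F) = deriv_fun_dist T 1 F"
  using frac_J_deriv_fun_dist[of T F "-1" 0] assms by (simp add: frac_prim_def)

text \<open>The kernel g_(1-\<gamma>) in the correction term is D of its own convolution with the
  Heaviside function, so both terms of the definition merge into one convolution. The shape
  \<open>1 * F t + (- c) * heaviside t\<close> matches the lemmas on linear combinations.\<close>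

lemma caputo_represents:
  assumes "0 < T" "represents T \<phi> F" "has_initial_value \<phi> c" "0 < \<gamma>" "\<gamma> < 1"
  shows "caputo T \<gamma> (emb T \<phi>) =
    deriv_fun_dist T 1 (conv (frac_fun (1 - \<gamma>)) (\<lambda>t. 1 * F t + (- c) * heaviside t))"
proof
  fix p
  note F = representsD(1)[OF assms(2)]
  have k: "frac_fun (1 - \<gamma>) \<in> causal T" using assms by (intro frac_fun_causal) simp
  have "initial_value T (emb T \<phi>) = c"
    by (rule initial_value_emb[OF assms(1) L1loc_represents[OF assms(2)] assms(3)])
  moreover have "frac_J T (- \<gamma>) (emb T \<phi>) = deriv_fun_dist T 1 (conv (frac_fun (1 - \<gamma>)) F)"
    using frac_J_fun_dist[OF assms(1) F, of "- \<gamma>"] assms(5) emb_represents[OF assms(2)] by simp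
  moreover have "restrict_dist (below T) (frac_kernel (1 - \<gamma>)) =
      deriv_fun_dist T 1 (conv (frac_fun (1 - \<gamma>)) heaviside)"
    using assms(5) deriv_dist_conv_heaviside[OF assms(1) k]
    by (simp only: deriv_fun_dist_1) (simp add: restrict_frac_kernel)
  ultimately have "caputo T \<gamma> (emb T \<phi>) p =
      1 * deriv_fun_dist T 1 (conv (frac_fun (1 - \<gamma>)) F) p +
      (- c) * deriv_fun_dist T 1 (conv (frac_fun (1 - \<gamma>)) heaviside) p"
    by (simp add: caputo_def)
  also have "\<dots> = deriv_fun_dist T 1 (conv (frac_fun (1 - \<gamma>)) (\<lambda>t. 1 * F t + (- c) * heaviside t)) p"
    unfolding deriv_fun_dist_1
    by (rule dist_deriv_lincomb[symmetric]) (rule fun_dist_conv_lincomb[OF assms(1) k F heaviside_causal])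
  finally show "caputo T \<gamma> (emb T \<phi>) p =
      deriv_fun_dist T 1 (conv (frac_fun (1 - \<gamma>)) (\<lambda>t. 1 * F t + (- c) * heaviside t)) p" .
qed

text \<open>J_\<alpha> adds a derivative and a factor g_(1+\<alpha>); merging the factors gives the
  second derivative of g_(2+\<alpha>-\<gamma>) convolved with \<open>H\<close>. One derivative then
  lowers the index by 1, except for \<alpha> = \<gamma> - 1, where the index is 1 and the kernel
  disappears altogether.\<close>

lemma frac_J_deriv_conv:
  assumes "0 < T" "H \<in> causal T" "0 < \<gamma>" "\<gamma> < 1" "\<alpha> \<ge> \<gamma> - 1"
  shows "frac_J T \<alpha> (deriv_fun_dist T 1 (conv (frac_fun (1 - \<gamma>)) H)) =
    (if \<alpha> = \<gamma> - 1 then deriv_fun_dist T 1 H else deriv_fun_dist T 1 (conv (frac_fun (1 + (\<alpha> - \<gamma>))) H))"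
proof -
  have c: "conv (frac_fun (1 - \<gamma>)) H \<in> causal T"
    using assms by (intro conv_causal frac_fun_causal) auto
  have "frac_J T \<alpha> (deriv_fun_dist T 1 (conv (frac_fun (1 - \<gamma>)) H)) =
      deriv_fun_dist T 2 (conv (frac_fun (1 + \<alpha>)) (conv (frac_fun (1 - \<gamma>)) H))"
    using frac_J_deriv_fun_dist[OF assms(1) c, of \<alpha> 1] assms
    by (simp add: frac_prim_def numeral_2_eq_2)
  also have "\<dots> = deriv_fun_dist T 2 (conv (frac_fun (1 + (1 + (\<alpha> - \<gamma>)))) H)"
    using conv_frac_fun_dist[OF assms(1) _ _ assms(2), of "1 + \<alpha>" "1 - \<gamma>"] assms
    by (simp add: deriv_fun_dist_2 algebra_simps)
  also have "\<dots> = (if \<alpha> = \<gamma> - 1 then deriv_fun_dist T 1 H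
      else deriv_fun_dist T 1 (conv (frac_fun (1 + (\<alpha> - \<gamma>))) H))"
  proof (cases "\<alpha> = \<gamma> - 1")
    case True
    then have "1 + (1 + (\<alpha> - \<gamma>)) = 1" by simp
    with True show ?thesis
      unfolding deriv_fun_dist_1 deriv_fun_dist_2
      by (simp only: deriv_dist_conv_frac_fun_1[OF assms(1,2)] simp_thms if_True)
  next
    case False
    with assms(5) have "1 + (\<alpha> - \<gamma>) > 0" by simp
    from deriv_dist_conv_frac_fun[OF assms(1,2) this] False show ?thesis
      unfolding deriv_fun_dist_1 deriv_fun_dist_2 by simp
  qed
  finally show ?thesis .
qed

lemma causal_minus_heaviside: "F \<in> causal T \<Longrightarrow> (\<lambda>t. 1 * F t + (- c) * heaviside t) \<in> causal T"
  by (intro causal_lincomb heaviside_causal)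

section \<open>Constants, linearity and composition rules\<close>

lemma caputo_const:
  assumes "0 < T" "0 < \<gamma>" "\<gamma> < 1"
  shows "(\<lambda>t. C) \<in> X_space T" "caputo T \<gamma> (emb T (\<lambda>t. C)) = (\<lambda>p. 0)"
proof -
  have rep: "represents T (\<lambda>t. C) (\<lambda>t. C * heaviside t)" by (rule represents_const)
  show "(\<lambda>t. C) \<in> X_space T"
    using L1loc_represents[OF rep] has_initial_value_const by (auto simp: X_space_def)
  have "conv (frac_fun (1 - \<gamma>)) (\<lambda>t. 1 * (C * heaviside t) + (- C) * heaviside t) = (\<lambda>t. 0)"
    by (simp add: conv_def fun_eq_iff)
  then have "caputo T \<gamma> (emb T (\<lambda>t. C)) = deriv_fun_dist T 1 (\<lambda>t. 0)"
    using caputo_represents[OF assms(1) rep has_initial_value_const assms(2,3)] by simp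
  also have "\<dots> = (\<lambda>p. 0)"
    unfolding deriv_fun_dist_1 by (simp add: fun_eq_iff dist_deriv_def fun_dist_def restrict_dist_def)
  finally show "caputo T \<gamma> (emb T (\<lambda>t. C)) = (\<lambda>p. 0)" .
qed

lemma caputo_E_space:
  assumes "0 < T" "0 < \<gamma>" "\<gamma> < 1" "\<phi> \<in> X_space T"
  shows "caputo T \<gamma> (emb T \<phi>) \<in> E_space T"
proof -
  obtain F c where F: "represents T \<phi> F" and c: "has_initial_value \<phi> c"
    using X_spaceE[OF assms(1,4)] by metis
  show ?thesis
    unfolding caputo_represents[OF assms(1) F c assms(2,3)]
    using assms by (intro deriv_fun_dist_E_space conv_causal frac_fun_causal causal_minus_heaviside
        representsD(1)[OF F]) auto
qed

lemma caputo_lincomb: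
  assumes "0 < T" "0 < \<gamma>" "\<gamma> < 1" "\<phi> \<in> X_space T" "\<psi> \<in> X_space T"
  shows "(\<lambda>t. a * \<phi> t + b * \<psi> t) \<in> X_space T"
    and "caputo T \<gamma> (emb T (\<lambda>t. a * \<phi> t + b * \<psi> t)) =
      (\<lambda>p. a * caputo T \<gamma> (emb T \<phi>) p + b * caputo T \<gamma> (emb T \<psi>) p)"
proof -
  obtain F c where F: "represents T \<phi> F" and c: "has_initial_value \<phi> c" "\<phi> \<in> L1loc T"
    using X_spaceE[OF assms(1,4)] by metis
  obtain G d where G: "represents T \<psi> G" and d: "has_initial_value \<psi> d" "\<psi> \<in> L1loc T"
    using X_spaceE[OF assms(1,5)] by metis
  have init: "has_initial_value (\<lambda>t. a * \<phi> t + b * \<psi> t) (a * c + b * d)"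
    by (rule has_initial_value_lincomb[OF assms(1) c(2) d(2) c(1) d(1)])
  then show "(\<lambda>t. a * \<phi> t + b * \<psi> t) \<in> X_space T"
    using L1loc_lincomb[OF assms(1) c(2) d(2)] by (auto simp: X_space_def)
  let ?F = "\<lambda>t. 1 * F t + (- c) * heaviside t" and ?G = "\<lambda>t. 1 * G t + (- d) * heaviside t"
  have "caputo T \<gamma> (emb T (\<lambda>t. a * \<phi> t + b * \<psi> t)) = deriv_fun_dist T 1
      (conv (frac_fun (1 - \<gamma>)) (\<lambda>t. 1 * (a * F t + b * G t) + (- (a * c + b * d)) * heaviside t))"
    by (rule caputo_represents[OF assms(1) represents_lincomb[OF F G] init assms(2,3)])
  also have "(\<lambda>t. 1 * (a * F t + b * G t) + (- (a * c + b * d)) * heaviside t) =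
      (\<lambda>t. a * ?F t + b * ?G t)"
    by (simp add: algebra_simps)
  also have "deriv_fun_dist T 1 (conv (frac_fun (1 - \<gamma>)) (\<lambda>t. a * ?F t + b * ?G t)) =
      (\<lambda>p. a * deriv_fun_dist T 1 (conv (frac_fun (1 - \<gamma>)) ?F) p +
        b * deriv_fun_dist T 1 (conv (frac_fun (1 - \<gamma>)) ?G) p)"
    unfolding deriv_fun_dist_1
    using assms(3) by (intro ext dist_deriv_lincomb fun_dist_conv_lincomb[OF assms(1)] frac_fun_causal
        causal_minus_heaviside representsD(1)[OF F] representsD(1)[OF G]) simp
  finally show "caputo T \<gamma> (emb T (\<lambda>t. a * \<phi> t + b * \<psi> t)) =
      (\<lambda>p. a * caputo T \<gamma> (emb T \<phi>) p + b * caputo T \<gamma> (emb T \<psi>) p)"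
    unfolding caputo_represents[OF assms(1) F c(1) assms(2,3)]
      caputo_represents[OF assms(1) G d(1) assms(2,3)] .
qed

text \<open>Either way the result is D of \<phi> - \<phi>(0+) convolved with one kernel. The two
  cases only read its index as \<open>1 - (\<gamma>\<^sub>1 - \<gamma>\<^sub>2)\<close>, which
  belongs to a Caputo derivative, or as \<open>1 + (\<gamma>\<^sub>2 - \<gamma>\<^sub>1)\<close>,
  which belongs to \<open>frac_J\<close>.\<close>

lemma frac_J_caputo:
  assumes "0 < T" "\<phi> \<in> X_space T" "0 < \<gamma>\<^sub>1" "\<gamma>\<^sub>1 < 1" "\<gamma>\<^sub>2 > \<gamma>\<^sub>1 - 1"
  shows "frac_J T \<gamma>\<^sub>2 (caputo T \<gamma>\<^sub>1 (emb T \<phi>)) =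
    (if \<gamma>\<^sub>2 < \<gamma>\<^sub>1 then caputo T (\<gamma>\<^sub>1 - \<gamma>\<^sub>2) (emb T \<phi>)
     else frac_J T (\<gamma>\<^sub>2 - \<gamma>\<^sub>1) (emb T (\<lambda>t. \<phi> t - initial_value T (emb T \<phi>))))"
proof -
  obtain F c where F: "represents T \<phi> F" and c: "has_initial_value \<phi> c" "initial_value T (emb T \<phi>) = c"
    using X_spaceE[OF assms(1,2)] by metis
  let ?F = "\<lambda>t. 1 * F t + (- c) * heaviside t"
  have F': "?F \<in> causal T" by (rule causal_minus_heaviside[OF representsD(1)[OF F]])
  have lhs: "frac_J T \<gamma>\<^sub>2 (caputo T \<gamma>\<^sub>1 (emb T \<phi>)) =
      deriv_fun_dist T 1 (conv (frac_fun (1 + (\<gamma>\<^sub>2 - \<gamma>\<^sub>1))) ?F)"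
    unfolding caputo_represents[OF assms(1) F c(1) assms(3,4)]
    using frac_J_deriv_conv[OF assms(1) F' assms(3,4), of \<gamma>\<^sub>2] assms(5) by simp
  show ?thesis
  proof (cases "\<gamma>\<^sub>2 < \<gamma>\<^sub>1")
    case True
    have "0 < \<gamma>\<^sub>1 - \<gamma>\<^sub>2" "\<gamma>\<^sub>1 - \<gamma>\<^sub>2 < 1" using True assms by auto
    from caputo_represents[OF assms(1) F c(1) this] True show ?thesis
      unfolding lhs by (simp add: algebra_simps)
  next
    case False
    have "represents T (\<lambda>t. 1 * \<phi> t + (- 1) * c) (\<lambda>t. 1 * F t + (- 1) * (c * heaviside t))"
      by (rule represents_lincomb[OF F represents_const])
    then have "represents T (\<lambda>t. \<phi> t - c) ?F" by simp
    from emb_represents[OF this] frac_J_fun_dist[OF assms(1) F', of "\<gamma>\<^sub>2 - \<gamma>\<^sub>1"] False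
    show ?thesis unfolding lhs c(2) by simp
  qed
qed

text \<open>The inner integral in \<open>Y_space\<close> is Gamma \<gamma> times the convolution of
  g_\<gamma> with \<open>f\<close>, so the defining limit says exactly that this convolution has
  initial value 0.\<close>

lemma Y_space_conv:
  assumes "0 < T" "0 < \<gamma>" "f \<in> Y_space T \<gamma>" and F: "represents T f F"
  shows "conv (frac_fun \<gamma>) F \<in> X_space T" "has_initial_value (conv (frac_fun \<gamma>) F) 0"
proof -
  have FC: "F \<in> causal T" by (rule representsD(1)[OF F])
  have [measurable]: "F \<in> borel_measurable borel" by (rule causalD(1)[OF FC])
  define A where "A t = (LINT s:{0..t}|lebesgue. (t - s) powr (\<gamma> - 1) * f s)" for t
  \<comment> \<open>This holds at every t < T and not just almost everywhere: \<open>F\<close> and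
    \<open>f\<close> differ on a null set of the integration variable s.\<close>
  have conv_A: "conv (frac_fun \<gamma>) F t = A t / Gamma \<gamma>" if t: "ereal t < T" for t
  proof -
    have "A t = (LINT s|lborel. Gamma \<gamma> * (F s * frac_fun \<gamma> (t - s)))"
      unfolding A_def set_lebesgue_integral_def
    proof (rule integral_lebesgue_AE_borel(1))
      show "(\<lambda>s. Gamma \<gamma> * (F s * frac_fun \<gamma> (t - s))) \<in> borel_measurable borel" by measurable
      from representsD(2)[OF F]
      show "AE s in lebesgue. Gamma \<gamma> * (F s * frac_fun \<gamma> (t - s)) =
          indicator {0..t} s *\<^sub>R ((t - s) powr (\<gamma> - 1) * f s)"
      proof eventually_elim
        case (elim s)
        have "ereal s < T" if "s \<le> t"
          using that t by (meson ereal_less_eq(3) order_le_less_trans)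
        with elim show ?case
          using causalD(2)[OF FC, of s] Gamma_real_pos[OF assms(2)]
          by (auto simp: frac_fun_def heaviside_def indicator_def)
      qed
    qed
    also have "\<dots> = Gamma \<gamma> * conv (frac_fun \<gamma>) F t"
      by (simp add: conv_commute[of "frac_fun \<gamma>"] conv_def)
    finally show ?thesis using Gamma_real_pos[OF assms(2)] by simp
  qed
  have "((\<lambda>\<tau>. 1 / Gamma \<gamma> * (1 / \<tau> * (LINT t:{0..\<tau>}|lebesgue. \<bar>A t\<bar>))) \<longlongrightarrow> 1 / Gamma \<gamma> * 0) (at_right 0)"
    using assms(3) by (intro tendsto_mult_left) (simp add: Y_space_def A_def)
  then have lim: "((\<lambda>\<tau>. 1 / Gamma \<gamma> * (1 / \<tau> * (LINT t:{0..\<tau>}|lebesgue. \<bar>A t\<bar>))) \<longlongrightarrow> 0) (at_right 0)"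
    by simp
  have "eventually (\<lambda>\<tau>. 1 / Gamma \<gamma> * (1 / \<tau> * (LINT t:{0..\<tau>}|lebesgue. \<bar>A t\<bar>)) =
      1 / \<tau> * (LINT s:{0..\<tau>}|lebesgue. \<bar>conv (frac_fun \<gamma>) F s - 0\<bar>)) (at_right 0)"
    using eventually_at_right_below[OF assms(1)]
  proof eventually_elim
    case (elim \<tau>)
    have "(LINT s:{0..\<tau>}|lebesgue. \<bar>conv (frac_fun \<gamma>) F s - 0\<bar>) =
        (LINT s:{0..\<tau>}|lebesgue. 1 / Gamma \<gamma> * \<bar>A s\<bar>)"
    proof (rule set_lebesgue_integral_cong)
      show "\<forall>s. s \<in> {0..\<tau>} \<longrightarrow> \<bar>conv (frac_fun \<gamma>) F s - 0\<bar> = 1 / Gamma \<gamma> * \<bar>A s\<bar>"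
      proof (intro allI impI)
        fix s assume "s \<in> {0..\<tau>}"
        then have "ereal s < T"
          using elim order_le_less_trans[of "ereal s" "ereal \<tau>" T] by simp
        then show "\<bar>conv (frac_fun \<gamma>) F s - 0\<bar> = 1 / Gamma \<gamma> * \<bar>A s\<bar>"
          using Gamma_real_pos[OF assms(2)] by (simp add: conv_A)
      qed
    qed simp
    also have "\<dots> = 1 / Gamma \<gamma> * (LINT s:{0..\<tau>}|lebesgue. \<bar>A s\<bar>)"
      by (rule set_integral_mult_right)
    finally show ?case by simp
  qed
  from Lim_transform_eventually[OF lim this]
  show init: "has_initial_value (conv (frac_fun \<gamma>) F) 0"
    unfolding has_initial_value_def .
  show "conv (frac_fun \<gamma>) F \<in> X_space T"
    using init causal_L1loc[OF conv_causal[OF frac_fun_causal[OF assms(2)] FC]]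
    by (auto simp: X_space_def)
qed

text \<open>J f has initial value 0, which leaves no correction term. Its Caputo derivative is thus
  D of a twofold convolution of \<open>f\<close>, in which the two kernels merge.\<close>

lemma caputo_frac_J:
  assumes "0 < T" "0 < \<gamma>\<^sub>1" "\<gamma>\<^sub>1 < 1" "f \<in> Y_space T \<gamma>\<^sub>1"
  shows "frac_J T \<gamma>\<^sub>1 (emb T f) \<in> emb T ` X_space T"
    and "0 < \<gamma>\<^sub>2 \<Longrightarrow> \<gamma>\<^sub>2 < 1 \<Longrightarrow>
      caputo T \<gamma>\<^sub>2 (frac_J T \<gamma>\<^sub>1 (emb T f)) = frac_J T (\<gamma>\<^sub>1 - \<gamma>\<^sub>2) (emb T f)"
proof -
  have "f \<in> L1loc T" using assms(4) by (simp add: Y_space_def)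
  then obtain F where F: "represents T f F" using ex_represents[OF assms(1)] by blast
  have FC: "F \<in> causal T" by (rule representsD(1)[OF F])
  define K where "K = conv (frac_fun \<gamma>\<^sub>1) F"
  have KC: "K \<in> causal T" unfolding K_def by (intro conv_causal frac_fun_causal assms FC)
  have K: "K \<in> X_space T" "has_initial_value K 0"
    unfolding K_def by (rule Y_space_conv[OF assms(1,2,4) F])+
  have J: "frac_J T \<gamma>\<^sub>1 (emb T f) = emb T K"
    using frac_J_fun_dist[OF assms(1) FC, of \<gamma>\<^sub>1] deriv_dist_conv_frac_fun[OF assms(1) FC assms(2)]
      emb_represents[OF F] emb_represents[OF represents_causal[OF KC]] assms(2)
    unfolding deriv_fun_dist_1 by (simp add: K_def)
  then show "frac_J T \<gamma>\<^sub>1 (emb T f) \<in> emb T ` X_space T" using K(1) by simp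
  assume \<gamma>: "0 < \<gamma>\<^sub>2" "\<gamma>\<^sub>2 < 1"
  have "caputo T \<gamma>\<^sub>2 (emb T K) =
      deriv_fun_dist T 1 (conv (frac_fun (1 - \<gamma>\<^sub>2)) (\<lambda>t. 1 * K t + (- 0) * heaviside t))"
    by (rule caputo_represents[OF assms(1) represents_causal[OF KC] K(2) \<gamma>])
  also have "\<dots> = deriv_fun_dist T 1 (conv (frac_fun (1 - \<gamma>\<^sub>2)) K)" by simp
  also have "\<dots> = deriv_fun_dist T 1 (conv (frac_fun (1 - \<gamma>\<^sub>2 + \<gamma>\<^sub>1)) F)"
    using conv_frac_fun_dist[OF assms(1) _ assms(2) FC, of "1 - \<gamma>\<^sub>2"] \<gamma>
    unfolding deriv_fun_dist_1 by (simp add: K_def)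
  also have "1 - \<gamma>\<^sub>2 + \<gamma>\<^sub>1 = 1 + (\<gamma>\<^sub>1 - \<gamma>\<^sub>2)" by simp
  also have "deriv_fun_dist T 1 (conv (frac_fun (1 + (\<gamma>\<^sub>1 - \<gamma>\<^sub>2))) F) = frac_J T (\<gamma>\<^sub>1 - \<gamma>\<^sub>2) (emb T f)"
    using frac_J_fun_dist[OF assms(1) FC, of "\<gamma>\<^sub>1 - \<gamma>\<^sub>2"] assms(2) \<gamma> emb_represents[OF F] by simp
  finally show "caputo T \<gamma>\<^sub>2 (frac_J T \<gamma>\<^sub>1 (emb T f)) = frac_J T (\<gamma>\<^sub>1 - \<gamma>\<^sub>2) (emb T f)"
    unfolding J .
qed

lemma deriv_dist_heaviside:
  "dist_deriv (below T) (fun_dist (below T) heaviside) = restrict_dist (below T) dirac"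
proof
  fix p
  show "dist_deriv (below T) (fun_dist (below T) heaviside) p = restrict_dist (below T) dirac p"
  proof (cases "p \<in> test_functions (below T)")
    case True
    then show ?thesis
      using integral_heaviside_deriv[OF True, of 0] test_functions_UNIV[OF True]
        fun_dist_apply[OF heaviside_borel test_functions_deriv[OF True]]
      by (simp add: dist_deriv_apply restrict_dist_apply dirac_def)
  qed (simp add: dist_deriv_def restrict_dist_outside)
qed

text \<open>The borderline case of \<open>frac_J_deriv_conv\<close>, in which no kernel remains: the
  value is D of \<phi> - \<phi>(0+) extended by zero, and D of the Heaviside function is
  delta.\<close>

lemma frac_J_caputo_one:
  assumes "0 < T" "\<phi> \<in> X_space T" "0 < \<gamma>" "\<gamma> < 1"
  shows "frac_J T (\<gamma> - 1) (caputo T \<gamma> (emb T \<phi>)) = caputo_one T (emb T \<phi>)"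
proof
  fix p
  obtain F c where F: "represents T \<phi> F" and c: "has_initial_value \<phi> c" "initial_value T (emb T \<phi>) = c"
    using X_spaceE[OF assms(1,2)] by metis
  note FC = representsD(1)[OF F]
  let ?F = "\<lambda>t. 1 * F t + (- c) * heaviside t"
  have "frac_J T (\<gamma> - 1) (caputo T \<gamma> (emb T \<phi>)) p = deriv_fun_dist T 1 ?F p"
    unfolding caputo_represents[OF assms(1) F c(1) assms(3,4)]
    using frac_J_deriv_conv[OF assms(1) causal_minus_heaviside[OF FC, of c] assms(3,4), of "\<gamma> - 1"]
    by (simp only: order_refl simp_thms if_True)
  also have "\<dots> = 1 * dist_deriv (below T) (fun_dist (below T) F) p +
      (- c) * dist_deriv (below T) (fun_dist (below T) heaviside) p"
    unfolding deriv_fun_dist_1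
    by (rule dist_deriv_lincomb) (rule fun_dist_lincomb[OF assms(1) FC heaviside_causal])
  also have "\<dots> = caputo_one T (emb T \<phi>) p"
    using frac_J_minus_one[OF assms(1) FC] emb_represents[OF F] c(2)
    unfolding deriv_fun_dist_1 by (simp add: caputo_one_def deriv_dist_heaviside)
  finally show "frac_J T (\<gamma> - 1) (caputo T \<gamma> (emb T \<phi>)) p = caputo_one T (emb T \<phi>) p" .
qed

section \<open>Continuous and continuously differentiable functions\<close>

lemma Icc_subset_below: "ereal R < T \<Longrightarrow> {0..R} \<subseteq> {0..} \<inter> below T"
  using order_le_less_trans[of "ereal _" "ereal R" T] by (auto simp: below_def)

lemma continuous_L1loc:
  assumes "continuous_on ({0..} \<inter> below T) f" shows "f \<in> L1loc T"
  by (rule L1locI, rule absolutely_integrable_continuous_real,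
      rule continuous_on_subset[OF assms Icc_subset_below])

lemma continuous_has_initial_value:
  assumes "0 < T" and cont: "continuous_on ({0..} \<inter> below T) f"
  shows "has_initial_value f (f 0)"
  unfolding has_initial_value_def
proof (rule tendstoI)
  fix e :: real assume e: "e > 0"
  have "0 \<in> {0..} \<inter> below T" using assms(1) by (simp add: below_def zero_ereal_def[symmetric])
  then obtain d where d: "d > 0" "\<And>s. s \<in> {0..} \<inter> below T \<Longrightarrow> dist s 0 < d \<Longrightarrow> dist (f s) (f 0) < e / 2"
    using cont e unfolding continuous_on_iff by (metis half_gt_zero)
  have "eventually (\<lambda>t::real. t < d) (at_right 0)"
    using d(1) by (auto simp: eventually_at_right_field)
  with eventually_at_right_below[OF assms(1)]
  show "eventually (\<lambda>t. dist (1 / t * (LINT s:{0..t}|lebesgue. \<bar>f s - f 0\<bar>)) 0 < e) (at_right 0)"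
  proof eventually_elim
    case (elim t)
    have sub: "{0..t} \<subseteq> {0..} \<inter> below T" by (rule Icc_subset_below) (use elim in simp)
    have "(LINT s:{0..t}|lebesgue. \<bar>f s - f 0\<bar>) \<le> (LINT s:{0..t}|lebesgue. e / 2)"
    proof (rule set_integral_mono)
      show "set_integrable lebesgue {0..t} (\<lambda>s. \<bar>f s - f 0\<bar>)"
        by (intro absolutely_integrable_continuous_real continuous_intros continuous_on_subset[OF cont sub])
      show "set_integrable lebesgue {0..t} (\<lambda>s. e / 2)"
        by (intro absolutely_integrable_continuous_real continuous_intros)
      show "\<bar>f s - f 0\<bar> \<le> e / 2" if "s \<in> {0..t}" for s
        using d(2)[of s] that sub elim by (auto simp: dist_real_def subset_iff)
    qed
    also have "\<dots> = t * (e / 2)"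
      using elim by (simp add: set_lebesgue_integral_def)
    finally have "1 / t * (LINT s:{0..t}|lebesgue. \<bar>f s - f 0\<bar>) \<le> e / 2"
      using elim by (simp add: field_simps)
    moreover have "0 \<le> 1 / t * (LINT s:{0..t}|lebesgue. \<bar>f s - f 0\<bar>)"
      unfolding set_lebesgue_integral_def using elim
      by (intro mult_nonneg_nonneg integral_nonneg_AE AE_I2) auto
    ultimately show ?case
      using e unfolding dist_real_def by linarith
  qed
qed

lemma emb_continuous_apply:
  assumes "continuous_on ({0..} \<inter> below T) f" "ereal R < T" "p \<in> test_functions {..<R}"
  shows "((\<lambda>t. f t * p t) has_integral emb T f p) {0..R}"
proof -
  have "continuous_on {0..R} (\<lambda>t. f t * p t)"
    by (intro continuous_on_mult continuous_on_subset[OF assms(1) Icc_subset_below[OF assms(2)]]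
        smooth_continuous_on test_functionsD(1)[OF assms(3)])
  then have int: "set_integrable lebesgue {0..R} (\<lambda>t. f t * p t)"
    by (rule absolutely_integrable_continuous_real)
  have "(\<lambda>t. heaviside t * f t * p t) = (\<lambda>t. indicator {0..R} t *\<^sub>R (f t * p t))"
    using lessThan_test_zero[OF assms(3)] by (force simp: heaviside_def indicator_def)
  then have "emb T f p = (LINT t:{0..R}|lebesgue. f t * p t)"
    using test_functions_lessThan_below[OF assms(2,3)]
    by (simp add: emb_def fun_dist_def restrict_dist_apply set_lebesgue_integral_def)
  also have "\<dots> = integral {0..R} (\<lambda>t. f t * p t)"
    by (rule set_lebesgue_integral_eq_integral(2)[OF int])
  finally show ?thesis
    using set_lebesgue_integral_eq_integral(1)[OF int] by (simp add: has_integral_iff)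
qed

text \<open>Extending \<phi> by zero creates a jump of height \<phi>(0) at 0; its contribution
  \<phi>(0) delta to the derivative is removed by the correction in
  \<open>caputo_one\<close>.\<close>

lemma caputo_one_C1:
  assumes "0 < T"
    and deriv: "\<forall>t\<in>{0..} \<inter> below T. (\<phi> has_real_derivative \<phi>' t) (at t within {0..} \<inter> below T)"
    and cont: "continuous_on ({0..} \<inter> below T) \<phi>'"
  shows "\<phi> \<in> X_space T" "caputo_one T (emb T \<phi>) = emb T \<phi>'"
proof -
  have cont\<phi>: "continuous_on ({0..} \<inter> below T) \<phi>"
    using deriv by (intro DERIV_continuous_on) blast
  have init: "has_initial_value \<phi> (\<phi> 0)" by (rule continuous_has_initial_value[OF assms(1) cont\<phi>])
  have L: "\<phi> \<in> L1loc T" by (rule continuous_L1loc[OF cont\<phi>])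
  show "\<phi> \<in> X_space T" using L init by (auto simp: X_space_def)
  obtain F where F: "represents T \<phi> F" using ex_represents[OF assms(1) L] .
  have eq: "caputo_one T (emb T \<phi>) p =
      dist_deriv (below T) (emb T \<phi>) p - \<phi> 0 * restrict_dist (below T) dirac p" for p
    using frac_J_minus_one[OF assms(1) representsD(1)[OF F]] emb_represents[OF F]
      initial_value_emb[OF assms(1) L init]
    unfolding deriv_fun_dist_1 by (simp add: caputo_one_def)
  show "caputo_one T (emb T \<phi>) = emb T \<phi>'"
  proof
    fix p
    show "caputo_one T (emb T \<phi>) p = emb T \<phi>' p"
    proof (cases "p \<in> test_functions (below T)")
      case True
      then obtain R where R: "ereal R < T" "0 < R" "p \<in> test_functions {..<R}"
        using test_function_below[OF assms(1)] by blast
      \<comment> \<open>The boundary term at R vanishes with \<open>p\<close>; the one at 0 is the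
        delta term.\<close>
      have "((\<lambda>t. \<phi>' t * p t + deriv p t * \<phi> t) has_integral \<phi> R * p R - \<phi> 0 * p 0) {0..R}"
      proof (rule fundamental_theorem_of_calculus)
        fix t assume t: "t \<in> {0..R}"
        then have "(\<phi> has_real_derivative \<phi>' t) (at t within {0..R})"
          using deriv Icc_subset_below[OF R(1)] by (blast intro: DERIV_subset)
        moreover have "(p has_real_derivative deriv p t) (at t within {0..R})"
          by (rule has_field_derivative_at_within[OF smooth_imp_DERIV[OF test_functionsD(1)[OF True]]])
        ultimately show "((\<lambda>t. \<phi> t * p t) has_vector_derivative \<phi>' t * p t + deriv p t * \<phi> t) (at t within {0..R})"
          unfolding has_real_derivative_iff_has_vector_derivative[symmetric] by (rule DERIV_mult)
      qed (use R in simp)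
      moreover have "((\<lambda>t. \<phi>' t * p t + deriv p t * \<phi> t) has_integral emb T \<phi>' p + emb T \<phi> (deriv p)) {0..R}"
        using has_integral_add[OF emb_continuous_apply[OF cont R(1,3)]
            emb_continuous_apply[OF cont\<phi> R(1) test_functions_deriv[OF R(3)]]]
        by (simp add: mult.commute)
      ultimately have "\<phi> R * p R - \<phi> 0 * p 0 = emb T \<phi>' p + emb T \<phi> (deriv p)"
        by (rule has_integral_unique)
      moreover have "p R = 0" by (rule lessThan_test_zero[OF R(3)]) simp
      ultimately show ?thesis
        unfolding eq using True test_functions_UNIV[OF True]
        by (simp add: dist_deriv_apply restrict_dist_apply dirac_def)
    next
      case False
      then show ?thesis
        unfolding eq by (simp add: dist_deriv_def emb_def fun_dist_def restrict_dist_outside)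
    qed
  qed
qed

text \<open>The case of \<open>frac_J_caputo\<close> with negative index
  \<open>- \<gamma>\<^sub>2\<close>: its condition
  \<open>- \<gamma>\<^sub>2 > \<gamma>\<^sub>1 - 1\<close> is the bound on the sum of the orders.
  The subtracted term is the one in the definition of \<open>caputo\<close>.\<close>

lemma caputo_caputo:
  assumes "0 < T" "\<phi> \<in> X_space T" "0 < \<gamma>\<^sub>1" "0 < \<gamma>\<^sub>2" "\<gamma>\<^sub>1 + \<gamma>\<^sub>2 < 1"
  shows "caputo T \<gamma>\<^sub>2 (caputo T \<gamma>\<^sub>1 (emb T \<phi>)) =
    (\<lambda>p. caputo T (\<gamma>\<^sub>1 + \<gamma>\<^sub>2) (emb T \<phi>) p
      - initial_value T (caputo T \<gamma>\<^sub>1 (emb T \<phi>)) * restrict_dist (below T) (frac_kernel (1 - \<gamma>\<^sub>2)) p)"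
  unfolding caputo_def[of T \<gamma>\<^sub>2]
  using frac_J_caputo[OF assms(1-3), of "- \<gamma>\<^sub>2"] assms by simp

text \<open>\<open>caputo\<close> takes its initial value from a definite description over
  representatives in \<open>X_space\<close>. Hence the memberships stated along with the equations:
  they ensure that the description denotes the intended number.\<close>

theorem lemma3p5:
  fixes T :: ereal
  assumes "0 < T"
  shows
    "(\<forall>C \<gamma>. 0 < \<gamma> \<and> \<gamma> < 1 \<longrightarrow>
        (\<lambda>t. C) \<in> X_space T \<and> caputo T \<gamma> (emb T (\<lambda>t. C)) = (\<lambda>p. 0))
     \<and>
     (\<forall>\<gamma>. 0 < \<gamma> \<and> \<gamma> < 1 \<longrightarrow>
        (\<forall>\<phi>\<in>X_space T. caputo T \<gamma> (emb T \<phi>) \<in> E_space T) \<and>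
        (\<forall>\<phi>\<in>X_space T. \<forall>\<psi>\<in>X_space T. \<forall>a b.
           (\<lambda>t. a * \<phi> t + b * \<psi> t) \<in> X_space T \<and>
           caputo T \<gamma> (emb T (\<lambda>t. a * \<phi> t + b * \<psi> t)) =
             (\<lambda>p. a * caputo T \<gamma> (emb T \<phi>) p + b * caputo T \<gamma> (emb T \<psi>) p)))
     \<and>
     (\<forall>\<phi>\<in>X_space T. \<forall>\<gamma>\<^sub>1 \<gamma>\<^sub>2. 0 < \<gamma>\<^sub>1 \<and> \<gamma>\<^sub>1 < 1 \<and> \<gamma>\<^sub>2 > \<gamma>\<^sub>1 - 1 \<longrightarrow>
        frac_J T \<gamma>\<^sub>2 (caputo T \<gamma>\<^sub>1 (emb T \<phi>)) =
          (if \<gamma>\<^sub>2 < \<gamma>\<^sub>1 then caputo T (\<gamma>\<^sub>1 - \<gamma>\<^sub>2) (emb T \<phi>)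
           else frac_J T (\<gamma>\<^sub>2 - \<gamma>\<^sub>1) (emb T (\<lambda>t. \<phi> t - initial_value T (emb T \<phi>)))))
     \<and>
     (\<forall>\<gamma>\<^sub>1. 0 < \<gamma>\<^sub>1 \<and> \<gamma>\<^sub>1 < 1 \<longrightarrow>
        (\<forall>f\<in>Y_space T \<gamma>\<^sub>1. frac_J T \<gamma>\<^sub>1 (emb T f) \<in> emb T ` X_space T \<and>
           (\<forall>\<gamma>\<^sub>2. 0 < \<gamma>\<^sub>2 \<and> \<gamma>\<^sub>2 < 1 \<longrightarrow>
              caputo T \<gamma>\<^sub>2 (frac_J T \<gamma>\<^sub>1 (emb T f)) = frac_J T (\<gamma>\<^sub>1 - \<gamma>\<^sub>2) (emb T f))))
     \<and>
     (\<forall>\<phi>\<in>X_space T. \<forall>\<gamma>\<^sub>1. 0 < \<gamma>\<^sub>1 \<and> \<gamma>\<^sub>1 < 1 \<and> caputo T \<gamma>\<^sub>1 (emb T \<phi>) \<in> emb T ` X_space T \<longrightarrow>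
        (\<forall>\<gamma>\<^sub>2. 0 < \<gamma>\<^sub>2 \<and> \<gamma>\<^sub>2 < 1 \<and> 0 < \<gamma>\<^sub>1 + \<gamma>\<^sub>2 \<and> \<gamma>\<^sub>1 + \<gamma>\<^sub>2 < 1 \<longrightarrow>
           caputo T \<gamma>\<^sub>2 (caputo T \<gamma>\<^sub>1 (emb T \<phi>)) =
             (\<lambda>p. caputo T (\<gamma>\<^sub>1 + \<gamma>\<^sub>2) (emb T \<phi>) p
                - initial_value T (caputo T \<gamma>\<^sub>1 (emb T \<phi>))
                  * restrict_dist (below T) (frac_kernel (1 - \<gamma>\<^sub>2)) p)))
     \<and>
     (\<forall>\<phi>\<in>X_space T. \<forall>\<gamma>. 0 < \<gamma> \<and> \<gamma> < 1 \<longrightarrow>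
        frac_J T (\<gamma> - 1) (caputo T \<gamma> (emb T \<phi>)) = caputo_one T (emb T \<phi>))
     \<and>
     (\<forall>\<phi> \<phi>'. (\<forall>t\<in>{0..} \<inter> below T.
                 (\<phi> has_real_derivative \<phi>' t) (at t within {0..} \<inter> below T)) \<and>
              continuous_on ({0..} \<inter> below T) \<phi>' \<longrightarrow>
        \<phi> \<in> X_space T \<and> caputo_one T (emb T \<phi>) = emb T \<phi>')"
proof (intro conjI allI ballI impI; (elim conjE)?)
qed (use assms caputo_const caputo_E_space caputo_lincomb frac_J_caputo caputo_frac_J caputo_caputo
    frac_J_caputo_one caputo_one_C1 in simp_all)

end
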